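(* For each $j$ let $\lambda_j$ be a $5$-series or $6$-series Dirichlet eigenvalue of $-\Delta$ on the Sierpiński gasket $\mathrm{SG}$ with generation of birth $j$, let $E_j$ be its eigenspace, $d_j=\dim E_j$, and $P_j$ the orthogonal projection of $L^2(\mathrm{SG},\mu)$ onto $E_j$. Let $f>0$ be continuous on $\mathrm{SG}$, let $[f]$ be the operator of multiplication by $f$, and let $\sigma_1^{(j)},\dots,\sigma_{d_j}^{(j)}$ be the eigenvalues, counted with multiplicity, of $M_j=P_j[f]P_j$ as an operator on $E_j$. If $F$ is continuous on $[0,\infty)$, then $$\lim_{j\to\infty}\frac1{d_j}\sum_{k=1}^{d_j}F(\sigma_k^{(j)})=\int_{\mathrm{SG}}F(f(x))\,d\mu(x).$$ Moreover, there are points $\{s_k^{(j)}\}_{k=1}^{d_j}$ in $\mathrm{SG}$ such that $\{\sigma_k^{(j)}\}$ and $\{f(s_k^{(j)})\}$ are "almost" equally distributed in $[0,\|f\|_{L^\infty}]$ as $j\to\infty$.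
   Context: Sierpiński gasket: let $F_1(x)=\frac12x$, $F_2(x)=\frac12x+(\frac12,0)$, $F_3(x)=\frac12x+(\frac14,\frac{\sqrt3}{4})$ on $\mathbb{R}^2$; $\mathrm{SG}$ is the unique nonempty compact set with $\mathrm{SG}=\bigcup_{i=1}^3F_i(\mathrm{SG})$. For a word $\omega=(\omega_1,\dots,\omega_m)$ in $\{1,2,3\}$, $F_\omega=F_{\omega_1}\circ\cdots\circ F_{\omega_m}$, and $F_\omega(\mathrm{SG})$ is called an $m$-cell. $\mu$ is the probability measure on $\mathrm{SG}$ giving each $m$-cell measure $3^{-m}$. $V_0=\{(0,0),(1,0),(\frac12,\frac{\sqrt3}{2})\}$ is the boundary, $V_m=\bigcup_{i=1}^3F_iV_{m-1}$; for distinct $x,y\in V_m$ write $x\sim_m y$ if $x,y$ lie in a common $m$-cell. Laplacian: $\Delta_mu(x)=\sum_{y\sim_mx}u(y)-4u(x)$ for $x\in V_m\setminus V_0$, and $\Delta u=\frac32\lim_{m\to\infty}5^m\Delta_mu$ (a continuous $u$ is in the domain with $\Delta u=g$, $g$ continuous, if the convergence to $g$ is uniform on $\bigcup_mV_m\setminus V_0$). A Dirichlet eigenfunction with eigenvalue $\lambda$ is a nonzero $u$ in the domain of $\Delta$ with $-\Delta u=\lambda u$ and $u|_{V_0}=0$; the eigenspace is the (finite-dimensional) space of these together with $0$. Series and generation of birth (spectral decimation): consider sequences $(\gamma_k)_{k\ge j}$ with $\gamma_k=\frac12\left(5+\epsilon_k\sqrt{25-4\gamma_{k-1}}\right)$ for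 $k>j$, $\epsilon_k\in\{\pm1\}$, with $\epsilon_k=1$ for only finitely many $k$, and set $\lambda=\frac32\lim_{k\to\infty}5^k\gamma_k$. The $5$-series eigenvalues with generation of birth $j\ge1$ are the $\lambda$ so obtained with $\gamma_j=5$; the $6$-series eigenvalues with generation of birth $j\ge2$ are those obtained with $\gamma_j=6$ and $\epsilon_{j+1}=+1$. (These are Dirichlet eigenvalues of $-\Delta$, of multiplicity $\frac12(3^{j-1}+3)$ and $\frac12(3^j-3)$ respectively.) "Almost" equally distributed: for finite families $\{a_k^{(j)}\}_{k=1}^{d_j}$, $\{b_k^{(j)}\}_{k=1}^{d_j}$ of numbers in an interval $I$, this means that for every continuous function $G$ on $I$, $\lim_{j\to\infty}\frac1{d_j}\sum_{k=1}^{d_j}[G(a_k^{(j)})-G(b_k^{(j)})]=0$ ("almost" refers to the number of terms running only through the subsequence $d_j$ of the positive integers). *)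

theory Defs
  imports "HOL-Probability.Probability" "HOL-Library.Function_Algebras"
begin

section \<open>The gasket, its vertex approximations and its self-similar measure\<close>

type_synonym point = "real \<times> real"

definition sg_map :: "nat \<Rightarrow> point \<Rightarrow> point" where
  "sg_map i x = (1/2) *\<^sub>R x +
     (if i = 1 then (0, 0) else if i = 2 then (1/2, 0) else (1/4, sqrt 3 / 4))"

definition SG :: "point set" where
  "SG = (THE K. compact K \<and> K \<noteq> {} \<and> K = (\<Union>i\<in>{1, 2, 3}. sg_map i ` K))"

definition words :: "nat \<Rightarrow> nat list set" where
  "words m = {w. length w = m \<and> set w \<subseteq> {1, 2, 3}}"

definition word_map :: "nat list \<Rightarrow> point \<Rightarrow> point" where
  "word_map w = foldr (\<lambda>i g. sg_map i \<circ> g) w id"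

definition cells :: "nat \<Rightarrow> point set set" where
  "cells m = (\<lambda>w. word_map w ` SG) ` words m"

definition sg_measure :: "point measure" where
  "sg_measure = (THE M. prob_space M \<and> space M = SG \<and> sets M = sets (restrict_space borel SG) \<and>
     (\<forall>m. \<forall>C\<in>cells m. measure M C = (1/3) ^ m))"

primrec vertices :: "nat \<Rightarrow> point set" where
  "vertices 0 = {(0, 0), (1, 0), (1/2, sqrt 3 / 2)}"
| "vertices (Suc m) = (\<Union>i\<in>{1, 2, 3}. sg_map i ` vertices m)"

definition neighbours :: "nat \<Rightarrow> point \<Rightarrow> point set" where
  "neighbours m x = {y \<in> vertices m. y \<noteq> x \<and> (\<exists>C\<in>cells m. x \<in> C \<and> y \<in> C)}"


section \<open>The Laplacian and its Dirichlet eigenspaces\<close>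

definition graph_laplacian :: "nat \<Rightarrow> (point \<Rightarrow> real) \<Rightarrow> point \<Rightarrow> real" where
  "graph_laplacian m u x = (\<Sum>y\<in>neighbours m x. u y) - 4 * u x"

text \<open>
  \<open>has_laplacian u g\<close> means that \<open>u\<close> is in the domain of the Laplacian, with Laplacian \<open>g\<close>.
  The discrete Laplacian of level \<open>m\<close> only makes sense at the points of \<open>vertices m - vertices 0\<close>,
  so uniform convergence on the union of all these sets means that at stage \<open>m\<close> the error is small
  at all points where that stage is defined.
\<close>

definition has_laplacian :: "(point \<Rightarrow> real) \<Rightarrow> (point \<Rightarrow> real) \<Rightarrow> bool" where
  "has_laplacian u g \<longleftrightarrow> continuous_on SG u \<and> continuous_on SG g \<and>
     (\<forall>e>0. \<exists>N. \<forall>m\<ge>N. \<forall>x \<in> vertices m - vertices 0.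
        \<bar>3/2 * 5 ^ m * graph_laplacian m u x - g x\<bar> < e)"

definition dirichlet_eigenfunction :: "real \<Rightarrow> (point \<Rightarrow> real) \<Rightarrow> bool" where
  "dirichlet_eigenfunction lam u \<longleftrightarrow> (\<exists>x\<in>SG. u x \<noteq> 0) \<and>
     has_laplacian u (\<lambda>x. - (lam * u x)) \<and> (\<forall>x\<in>vertices 0. u x = 0)"

text \<open>
  A function on the gasket is represented by its extension by zero to the plane, so that distinct
  elements of the eigenspace are distinct functions on the gasket and its dimension is the right one.
\<close>

definition dirichlet_eigenspace :: "real \<Rightarrow> (point \<Rightarrow> real) set" where
  "dirichlet_eigenspace lam =
     {u. dirichlet_eigenfunction lam u \<and> (\<forall>x. x \<notin> SG \<longrightarrow> u x = 0)} \<union> {\<lambda>x. 0}"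

definition fun_scale :: "real \<Rightarrow> ('a \<Rightarrow> real) \<Rightarrow> 'a \<Rightarrow> real" where
  "fun_scale c u = (\<lambda>x. c * u x)"

global_interpretation fun_space: vector_space "fun_scale :: real \<Rightarrow> ('a \<Rightarrow> real) \<Rightarrow> 'a \<Rightarrow> real"
  by unfold_locales (auto simp: fun_scale_def fun_eq_iff algebra_simps)


section \<open>Series of eigenvalues obtained by spectral decimation\<close>

definition decimation_sequence :: "nat \<Rightarrow> (nat \<Rightarrow> real) \<Rightarrow> (nat \<Rightarrow> real) \<Rightarrow> bool" where
  "decimation_sequence j \<epsilon> \<gamma> \<longleftrightarrow>
     (\<forall>k>j. \<epsilon> k \<in> {-1, 1} \<and> \<gamma> k = 1/2 * (5 + \<epsilon> k * sqrt (25 - 4 * \<gamma> (k - 1)))) \<and>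
     finite {k. k > j \<and> \<epsilon> k = 1}"

definition five_series :: "nat \<Rightarrow> real \<Rightarrow> bool" where
  "five_series j lam \<longleftrightarrow> j \<ge> 1 \<and>
     (\<exists>\<epsilon> \<gamma>. decimation_sequence j \<epsilon> \<gamma> \<and> \<gamma> j = 5 \<and>
        (\<lambda>k. 3/2 * (5 ^ k * \<gamma> k)) \<longlonglongrightarrow> lam)"

definition six_series :: "nat \<Rightarrow> real \<Rightarrow> bool" where
  "six_series j lam \<longleftrightarrow> j \<ge> 2 \<and>
     (\<exists>\<epsilon> \<gamma>. decimation_sequence j \<epsilon> \<gamma> \<and> \<gamma> j = 6 \<and> \<epsilon> (Suc j) = 1 \<and>
        (\<lambda>k. 3/2 * (5 ^ k * \<gamma> k)) \<longlonglongrightarrow> lam)"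


section \<open>Projection, compression and eigenvalues with multiplicity\<close>

text \<open>
  For a finite-dimensional space \<open>E\<close> of continuous functions that vanish off the gasket, no two of
  its elements agree almost everywhere, because the measure charges every cell; so
  the projection of a square integrable function onto \<open>E\<close> is a well-determined function.
\<close>

definition l2_projection :: "(point \<Rightarrow> real) set \<Rightarrow> (point \<Rightarrow> real) \<Rightarrow> point \<Rightarrow> real" where
  "l2_projection E g =
     (THE h. h \<in> E \<and> (\<forall>v\<in>E. (\<integral>x. (g x - h x) * v x \<partial>sg_measure) = 0))"

definition compressed_multiplication ::
    "(point \<Rightarrow> real) set \<Rightarrow> (point \<Rightarrow> real) \<Rightarrow> (point \<Rightarrow> real) \<Rightarrow> point \<Rightarrow> real" where
  "compressed_multiplication E f u = l2_projection E (\<lambda>x. f x * l2_projection E u x)"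

text \<open>
  \<open>s 1, \<dots>, s d\<close>, with \<open>d\<close> the dimension of \<open>E\<close>, lists the eigenvalues of the operator \<open>T\<close> on \<open>E\<close>
  with multiplicity. It is used for symmetric operators on a real inner product space, for which
  geometric and algebraic multiplicities agree and all eigenvalues are real.
\<close>

definition eigenvalue_listing ::
    "('a \<Rightarrow> real) set \<Rightarrow> (('a \<Rightarrow> real) \<Rightarrow> ('a \<Rightarrow> real)) \<Rightarrow> (nat \<Rightarrow> real) \<Rightarrow> bool" where
  "eigenvalue_listing E T s \<longleftrightarrow>
     (\<forall>t. card {k \<in> {1..fun_space.dim E}. s k = t} = fun_space.dim {u \<in> E. T u = fun_scale t u})"


section \<open>Almost equal distribution\<close>

text \<open>The families are indexed by \<open>j \<ge> 1\<close>, and the \<open>j\<close>-th one has \<open>d j\<close> members.\<close>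

definition almost_equally_distributed ::
    "real set \<Rightarrow> (nat \<Rightarrow> nat) \<Rightarrow> (nat \<Rightarrow> nat \<Rightarrow> real) \<Rightarrow> (nat \<Rightarrow> nat \<Rightarrow> real) \<Rightarrow> bool" where
  "almost_equally_distributed I d a b \<longleftrightarrow>
     (\<forall>j\<ge>1. \<forall>k\<in>{1..d j}. a j k \<in> I \<and> b j k \<in> I) \<and>
     (\<forall>G. continuous_on I G \<longrightarrow>
        (\<lambda>j. 1 / real (d j) * (\<Sum>k=1..d j. G (a j k) - G (b j k))) \<longlonglongrightarrow> 0)"

definition Linfty_norm :: "(point \<Rightarrow> real) \<Rightarrow> real" where
  "Linfty_norm f = real_of_ereal (esssup sg_measure (\<lambda>x. ereal \<bar>f x\<bar>))"

end

theory Submission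
  imports Defs
begin

text \<open>
  Fix \<open>N\<close>. If a Dirichlet eigenfunction of \<open>E\<^sub>j\<close> and its normal derivatives vanish at the corners of all
  \<open>N\<close>-cells, then its restriction to each \<open>N\<close>-cell, extended by zero, is again in \<open>E\<^sub>j\<close>. These are at most
  \<open>6 \<cdot> 3\<^sup>N\<close> linear conditions, independently of \<open>j\<close>, and the functions in \<open>E\<^sub>j\<close> supported in one
  \<open>N\<close>-cell form spaces of the same dimension \<open>e\<close> for all cells, so that \<open>3\<^sup>N e \<le> d\<^sub>j \<le> 3\<^sup>N (e + 6)\<close>.
  If \<open>f \<ge> t\<close> on certain \<open>N\<close>-cells, the quadratic form of \<open>f - t\<close> is nonnegative on the sum of their spaces,
  and hence at least \<open>e\<close> times as many of the \<open>\<sigma>\<^sub>k\<close> are at least \<open>t\<close>; likewise for \<open>f \<le> t\<close>. As \<open>d\<^sub>j\<close> tends to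
  infinity, this gives the limit for monotone functions, then for polynomials and for continuous functions.

  That \<open>d\<^sub>j\<close> tends to infinity follows from one localized eigenfunction on two levels for each series: spectral
  decimation extends it to the gasket, and it can be put into every \<open>(j - 2)\<close>-cell.

  For the last claim, connectedness of the gasket yields points with \<open>f (s\<^sub>k) = \<sigma>\<^sub>k\<close>.
\<close>

section \<open>The gasket\<close>

text \<open>The obstacle is the claim that vanishing normal derivatives allow extension by zero. At
  a corner the discrete equation needs 5^m times the discrete normal derivative to tend to 0,
  whereas a normal derivative is a limit with the smaller factor (5/3)^m. The missing rate 3^m comes
  from the remainder of that limit, which is proportional to the eigenvalue and to the maximum of
  the function: on small cells at the corner both shrink, the eigenvalue by 5 per level. This is why
  eigenfunctions are studied together with their restrictions to cells, with arbitrary boundary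
  values.

  The count of the \<sigma>'s is a dimension argument: localized functions on which the form has one
  sign meet the sum of the eigenspaces on the other side of t only in 0. Monotone functions come
  first because counts above thresholds control exactly their sums; powers are monotone on the
  nonnegative half line and span the polynomials.\<close>

definition letters :: "nat set" where
  "letters = {1, 2, 3}"

text \<open>The fixed points of the three maps; \<open>sg_map i\<close> sends a point to its
  midpoint with \<open>corner i\<close>. As in \<open>sg_map\<close>, every index other than 1 and 2
  counts as 3.\<close>

definition corner :: "nat \<Rightarrow> point" where
  "corner i = (if i = 1 then (0, 0) else if i = 2 then (1, 0) else (1/2, sqrt 3 / 2))"

definition sg_inv :: "nat \<Rightarrow> point \<Rightarrow> point" where
  "sg_inv i x = 2 *\<^sub>R x - corner i"

definition hutchinson :: "point set \<Rightarrow> point set" where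
  "hutchinson K = (\<Union>i\<in>letters. sg_map i ` K)"

definition triangle :: "point set" where
  "triangle = {x. 0 \<le> snd x \<and> snd x \<le> sqrt 3 * fst x \<and> snd x \<le> sqrt 3 * (1 - fst x)}"

lemma finite_letters [simp]: "finite letters" and card_letters [simp]: "card letters = 3"
  by (simp_all add: letters_def)

lemma letters_cases:
  assumes "i \<in> letters"
  obtains "i = 1" | "i = 2" | "i = 3"
  using assms by (auto simp: letters_def)

lemma in_letters [simp]: "1 \<in> letters" "Suc 0 \<in> letters" "2 \<in> letters" "3 \<in> letters"
  by (simp_all add: letters_def)

lemma sum_letters: "sum g letters = g 1 + g 2 + (g 3 :: 'b :: comm_monoid_add)"
  by (simp add: letters_def add.assoc)

lemma sg_map_eq: "sg_map i x = (1/2) *\<^sub>R (x + corner i)"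
  by (cases x) (auto simp: sg_map_def corner_def)

lemma sg_inv_sg_map [simp]: "sg_inv i (sg_map i x) = x"
  and sg_map_sg_inv [simp]: "sg_map i (sg_inv i x) = x"
  by (simp_all add: sg_inv_def sg_map_eq algebra_simps)

lemma sg_map_eq_iff [simp]: "sg_map i x = sg_map i y \<longleftrightarrow> x = y"
  by (metis sg_inv_sg_map)

lemma in_sg_map_image_iff: "x \<in> sg_map i ` K \<longleftrightarrow> sg_inv i x \<in> K"
  by (metis image_iff sg_inv_sg_map sg_map_sg_inv)

lemma dist_sg_map: "dist (sg_map i x) (sg_map i y) = dist x y / 2"
proof -
  have "sg_map i x - sg_map i y = (1/2) *\<^sub>R (x - y)"
    by (simp add: sg_map_eq algebra_simps)
  then show ?thesis by (simp add: dist_norm)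
qed

lemma sg_map_corner [simp]: "sg_map i (corner i) = corner i"
  by (simp add: sg_map_eq flip: scaleR_2)

text \<open>Both sides are the midpoint of two corners, the point where cell \<open>i\<close> and
  cell \<open>j\<close> touch. All gluing happens at these points.\<close>

lemma sg_map_corner_commute: "sg_map i (corner j) = sg_map j (corner i)"
  by (simp add: sg_map_eq add.commute)

lemma continuous_on_sg_map [continuous_intros]: "continuous_on S (sg_map i)"
  unfolding sg_map_eq[abs_def] by (intro continuous_intros)

lemma continuous_on_sg_inv [continuous_intros]: "continuous_on S (sg_inv i)"
  unfolding sg_inv_def[abs_def] by (intro continuous_intros)

lemma vertices_0: "vertices 0 = corner ` letters"
  by (auto simp: corner_def letters_def)

lemma corner_eq_iff: "i \<in> letters \<Longrightarrow> j \<in> letters \<Longrightarrow> corner i = corner j \<longleftrightarrow> i = j"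
  by (auto simp: corner_def letters_def)

lemma vertices_Suc: "vertices (Suc m) = hutchinson (vertices m)"
  by (simp add: hutchinson_def letters_def)

declare vertices.simps [simp del]

section \<open>Existence and uniqueness of the attractor\<close>

lemma compact_hutchinson: "compact K \<Longrightarrow> compact (hutchinson K)"
  unfolding hutchinson_def
  by (intro compact_UN compact_continuous_image continuous_intros) auto

lemma hutchinson_mono: "K \<subseteq> L \<Longrightarrow> hutchinson K \<subseteq> hutchinson L"
  unfolding hutchinson_def by blast

text \<open>The largest distance of a point of \<open>K\<close> to \<open>L\<close> is at most half of itself.\<close>

lemma subset_of_contraction:
  assumes K: "bounded K" "K \<subseteq> hutchinson K"
    and L: "closed L" "L \<noteq> {}" "hutchinson L \<subseteq> L"
  shows "K \<subseteq> L"
proof (cases "K = {}")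
  case False
  obtain l where l: "l \<in> L" using L by blast
  obtain C where C: "\<And>x. x \<in> K \<Longrightarrow> dist l x \<le> C"
    using K(1) bounded_any_center[of K l] by blast
  have bdd: "bdd_above ((\<lambda>x. infdist x L) ` K)"
    by (intro bdd_aboveI2[of _ _ C]) (metis C dist_commute infdist_le2 l)
  define D where "D = (SUP x\<in>K. infdist x L)"
  have half: "infdist x L \<le> D / 2" if x: "x \<in> K" for x
  proof -
    obtain i y where i: "i \<in> letters" "y \<in> K" "x = sg_map i y"
      using x K(2) unfolding hutchinson_def by blast
    have "infdist x L \<le> infdist y L / 2"
    proof -
      have "2 * infdist x L \<le> dist y z" if z: "z \<in> L" for z
      proof -
        have "sg_map i z \<in> L" using z i(1) L(3) unfolding hutchinson_def by blast
        then have "infdist x L \<le> dist x (sg_map i z)" by (rule infdist_le)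
        then show ?thesis by (simp add: i dist_sg_map)
      qed
      then have "2 * infdist x L \<le> infdist y L"
        unfolding infdist_notempty[OF L(2)] by (intro cINF_greatest L)
           (auto simp: L infdist_notempty)
      then show ?thesis by simp
    qed
    also have "infdist y L \<le> D" unfolding D_def by (intro cSUP_upper bdd i)
    finally show ?thesis by simp
  qed
  have "D \<le> D / 2" unfolding D_def using False half by (intro cSUP_least) (auto simp: D_def)
  then have "infdist x L = 0" if "x \<in> K" for x
    using half[OF that] infdist_nonneg[of x L] by linarith
  then show ?thesis
    using in_closed_iff_infdist_zero[OF L(1,2)] by blast
qed auto

lemma closed_triangle: "closed triangle"
proof -
  have "triangle = {x. 0 \<le> snd x} \<inter> {x. snd x \<le> sqrt 3 * fst x} \<inter> {x. snd x \<le> sqrt 3 * (1 - fst x)}"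
    by (auto simp: triangle_def)
  moreover have "closed \<dots>"
    by (intro closed_Int closed_Collect_le continuous_intros)
  ultimately show ?thesis by simp
qed

lemma compact_triangle: "compact triangle"
proof -
  have "triangle \<subseteq> {0..1} \<times> {0..2}"
  proof
    fix x assume "x \<in> triangle"
    then have x: "0 \<le> snd x" "snd x \<le> sqrt 3 * fst x" "snd x \<le> sqrt 3 * (1 - fst x)"
      by (auto simp: triangle_def)
    then have "0 \<le> sqrt 3 * fst x" "0 \<le> sqrt 3 * (1 - fst x)" by linarith+
    then have "0 \<le> fst x" "fst x \<le> 1" by (simp_all add: zero_le_mult_iff)
    moreover have "sqrt 3 * fst x \<le> sqrt 3" using \<open>fst x \<le> 1\<close> by (simp add: mult_left_le)
    moreover have "sqrt 3 \<le> 2" by (rule real_le_lsqrt) auto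
    ultimately have "snd x \<le> 2" using x(2) by linarith
    then show "x \<in> {0..1} \<times> {0..2}" using x \<open>0 \<le> fst x\<close> \<open>fst x \<le> 1\<close> by (simp add: mem_Times_iff)
  qed
  moreover have "bounded ({0..1::real} \<times> {0..2::real})"
    by (intro bounded_Times bounded_closed_interval)
  ultimately show ?thesis
    using closed_triangle bounded_subset compact_eq_bounded_closed by blast
qed

lemma hutchinson_triangle: "hutchinson triangle \<subseteq> triangle"
proof -
  have "sg_map i x \<in> triangle" if "i \<in> letters" "x \<in> triangle" for i x
  proof -
    obtain a b where x: "x = (a, b)" by (cases x)
    have "0 \<le> b" "b \<le> sqrt 3 * a" "b \<le> sqrt 3 - sqrt 3 * a" "sqrt 3 \<ge> 0"
      using that by (auto simp: triangle_def x algebra_simps)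
    then show ?thesis
      using that(1) by (elim letters_cases) (simp_all add: sg_map_def triangle_def x algebra_simps)
  qed
  then show ?thesis unfolding hutchinson_def by blast
qed

text \<open>Existence: the iterates of the triangle decrease, and their intersection is the
  attractor. Uniqueness: two attractors contain each other by the contraction argument.\<close>

lemma ex1_attractor: "\<exists>!K. compact K \<and> K \<noteq> {} \<and> K = hutchinson K"
proof (rule ex_ex1I)
  define T where "T n = (hutchinson ^^ n) triangle" for n
  have T_Suc: "T (Suc n) = hutchinson (T n)" for n by (simp add: T_def)
  have comp: "compact (T n)" for n
    by (induction n) (simp_all add: T_Suc compact_hutchinson, simp add: T_def compact_triangle)
  have ne: "T n \<noteq> {}" for n
  proof (induction n)
    case 0
    have "(0, 0) \<in> triangle" by (simp add: triangle_def)
    then show ?case by (auto simp: T_def)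
  next
    case (Suc n)
    then show ?case by (auto simp: T_Suc hutchinson_def letters_def)
  qed
  have step: "T (Suc n) \<subseteq> T n" for n
  proof (induction n)
    case 0
    then show ?case using hutchinson_triangle by (simp add: T_def)
  next
    case (Suc n)
    then show ?case using hutchinson_mono[OF Suc] by (simp add: T_Suc)
  qed
  then have anti: "T n \<subseteq> T m" if "m \<le> n" for m n
    using that lift_Suc_antimono_le[of T] by blast
  define K where "K = (\<Inter>n. T n)"
  have "compact K" unfolding K_def
    using comp compact_Inter[of "range T"] by auto
  moreover have "K \<noteq> {}" unfolding K_def
    by (intro compact_nest comp ne) (use anti in auto)
  moreover have "K = hutchinson K"
  proof
    show "hutchinson K \<subseteq> K"
    proof
      fix x assume x: "x \<in> hutchinson K"
      have "x \<in> T n" for n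
      proof -
        have "x \<in> T (Suc n)"
          using x unfolding T_Suc hutchinson_def K_def by auto
        then show ?thesis using step by blast
      qed
      then show "x \<in> K" by (simp add: K_def)
    qed
    show "K \<subseteq> hutchinson K"
    proof
      fix x assume x: "x \<in> K"
      show "x \<in> hutchinson K"
      proof (rule ccontr)
        assume "x \<notin> hutchinson K"
        then have "\<forall>i\<in>letters. \<exists>n. sg_inv i x \<notin> T n"
          by (auto simp: hutchinson_def in_sg_map_image_iff K_def)
        then obtain n where n: "\<And>i. i \<in> letters \<Longrightarrow> sg_inv i x \<notin> T (n i)" by metis
        \<comment> \<open>One level \<open>m\<close> that excludes all three preimages of
          \<open>x\<close> at once; it exists because there are finitely many maps.\<close>
        define m where "m = Max (n ` letters)"
        have "x \<in> T (Suc m)" using x by (auto simp: K_def)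
        then obtain i where i: "i \<in> letters" "sg_inv i x \<in> T m"
          by (auto simp: T_Suc hutchinson_def in_sg_map_image_iff)
        have "n i \<le> m" unfolding m_def using i by (intro Max_ge) auto
        then show False using n[OF i(1)] i(2) anti by blast
      qed
    qed
  qed
  ultimately show "\<exists>K. compact K \<and> K \<noteq> {} \<and> K = hutchinson K" by blast
next
  have "K \<subseteq> L" if "compact K" "K = hutchinson K" "compact L" "L \<noteq> {}" "L = hutchinson L" for K L
    using subset_of_contraction[of K L] that by (metis compact_imp_bounded compact_imp_closed order_refl)
  then show "K = L" if "compact K \<and> K \<noteq> {} \<and> K = hutchinson K" "compact L \<and> L \<noteq> {} \<and> L = hutchinson L" for K L
    using that by (metis subset_antisym)
qed

lemma SG_attractor: "compact SG \<and> SG \<noteq> {} \<and> SG = hutchinson SG"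
  using theI'[OF ex1_attractor] unfolding SG_def hutchinson_def letters_def .

lemma compact_SG: "compact SG" and SG_nonempty: "SG \<noteq> {}" and SG_self_similar: "SG = hutchinson SG"
  using SG_attractor by auto

lemma SG_subset_hutchinson: "SG \<subseteq> hutchinson SG" and hutchinson_SG_subset: "hutchinson SG \<subseteq> SG"
  using SG_attractor by blast+

lemma closed_SG: "closed SG"
  by (simp add: compact_SG compact_imp_closed)

lemma SG_subset_triangle: "SG \<subseteq> triangle"
proof -
  have "(0, 0) \<in> triangle" by (simp add: triangle_def)
  then show ?thesis
    using subset_of_contraction[OF compact_imp_bounded[OF compact_SG] SG_subset_hutchinson
        closed_triangle _ hutchinson_triangle] by blast
qed

lemma sg_map_in_SG: "i \<in> letters \<Longrightarrow> x \<in> SG \<Longrightarrow> sg_map i x \<in> SG"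
  using SG_self_similar unfolding hutchinson_def by blast

lemma SG_cases:
  assumes "x \<in> SG"
  obtains i y where "i \<in> letters" "y \<in> SG" "x = sg_map i y"
  using assms SG_self_similar unfolding hutchinson_def by blast

lemma corner_in_SG: "i \<in> letters \<Longrightarrow> corner i \<in> SG"
  using subset_of_contraction[of "{corner i}" SG] hutchinson_SG_subset SG_nonempty closed_SG
  by (force simp: hutchinson_def)

section \<open>Overlap of cells, and the vertices\<close>

text \<open>The three images of the surrounding triangle touch only at the midpoints of its sides,
  which are images of corners.\<close>

lemma cell_overlap:
  assumes "i \<in> letters" "j \<in> letters" "i \<noteq> j" "y \<in> SG" "z \<in> SG" "sg_map i y = sg_map j z"
  shows "y = corner j" "z = corner i"
proof -
  have *: "y = corner j" if "i \<in> letters" "j \<in> letters" "i \<noteq> j" "y \<in> SG" "z \<in> SG" "sg_map i y = sg_map j z" for i j y z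
  proof -
    have T: "y \<in> triangle" "z \<in> triangle" using that SG_subset_triangle by auto
    obtain y1 y2 z1 z2 where yz: "y = (y1, y2)" "z = (z1, z2)" by (cases y, cases z)
    \<comment> \<open>Abscissas are scaled by sqrt 3, so that all inequalities of the triangle
      become linear with \<open>s\<close> as one more unknown, and each choice of \<open>i\<close>
      and \<open>j\<close> is linear arithmetic.\<close>
    define s where "s = sqrt 3"
    have s: "s > 0" by (simp add: s_def)
    have e: "s * a = s * b \<longleftrightarrow> a = b" for a b using s by simp
    have *: "0 \<le> y2" "y2 \<le> s * y1" "y2 \<le> s - s * y1" "0 \<le> z2" "z2 \<le> s * z1" "z2 \<le> s - s * z1"
      using T by (auto simp: triangle_def yz s_def algebra_simps)
    from that(6) have eq: "y1 + fst (corner i) = z1 + fst (corner j)" "y2 + snd (corner i) = z2 + snd (corner j)"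
      by (auto simp: sg_map_eq yz prod_eq_iff)
    then have eq1: "s * y1 + s * fst (corner i) = s * z1 + s * fst (corner j)"
      by (metis distrib_left)
    have c: "k = 1 \<and> s * fst (corner k) = 0 \<and> snd (corner k) = 0 \<or>
        k = 2 \<and> s * fst (corner k) = s \<and> snd (corner k) = 0 \<or>
        k = 3 \<and> s * fst (corner k) = s / 2 \<and> snd (corner k) = s / 2" if "k \<in> letters" for k
      using that by (auto elim!: letters_cases simp: corner_def s_def)
    have "s * y1 = s * fst (corner j) \<and> y2 = snd (corner j)"
      using c[OF that(1)] c[OF that(2)] that(3) eq(2) eq1 * s
      by (elim disjE conjE; ((intro conjI; linarith) | blast))
    then show ?thesis unfolding e yz by (simp add: prod_eq_iff)
  qed
  show "y = corner j" using assms by (rule *)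
  show "z = corner i" using *[of j i z y] assms by auto
qed

lemma sg_map_eq_corner:
  assumes "i \<in> letters" "j \<in> letters" "y \<in> SG" "sg_map i y = corner j"
  shows "i = j \<and> y = corner j"
proof (cases "i = j")
  case False
  have "sg_map i y = sg_map j (corner j)" using assms by simp
  with assms False corner_in_SG[of j] have "corner j = corner i" using cell_overlap(2) by blast
  then show ?thesis using False corner_eq_iff assms by blast
qed (use assms in \<open>metis sg_inv_sg_map sg_map_corner\<close>)

lemma vertices_subset_SG: "vertices m \<subseteq> SG"
proof (induction m)
  case 0
  then show ?case unfolding vertices_0 using corner_in_SG by auto
next
  case (Suc m)
  then show ?case unfolding vertices_Suc using hutchinson_mono hutchinson_SG_subset by blast
qed

lemma vertices_Suc_mono: "vertices m \<subseteq> vertices (Suc m)"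
proof (induction m)
  case 0
  have "corner i \<in> hutchinson (corner ` letters)" if "i \<in> letters" for i
    unfolding hutchinson_def using that by (intro UN_I[of i] image_eqI[of _ _ "corner i"]) auto
  then show ?case unfolding vertices_Suc vertices_0 by blast
next
  case (Suc m)
  then show ?case using hutchinson_mono vertices_Suc by metis
qed

lemma vertices_mono: "m \<le> n \<Longrightarrow> vertices m \<subseteq> vertices n"
  using lift_Suc_mono_le[of vertices] vertices_Suc_mono by blast

lemma corner_in_vertices: "i \<in> letters \<Longrightarrow> corner i \<in> vertices m"
  using vertices_mono[of 0 m] unfolding vertices_0 by auto

lemma sg_map_in_vertices: "i \<in> letters \<Longrightarrow> x \<in> vertices m \<Longrightarrow> sg_map i x \<in> vertices (Suc m)"
  unfolding vertices_Suc hutchinson_def by auto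

lemma vertices_Suc_cases:
  assumes "x \<in> vertices (Suc m)"
  obtains i y where "i \<in> letters" "y \<in> vertices m" "x = sg_map i y"
  using assms unfolding vertices_Suc hutchinson_def by blast

lemma finite_vertices: "finite (vertices m)"
  by (induction m) (auto simp: vertices_0 vertices_Suc hutchinson_def)

text \<open>If the vertex comes from another map \<open>k\<close>, the overlap of the two cells
  forces \<open>x\<close> to be a corner, and corners are vertices of every level.\<close>

lemma sg_map_in_vertices_SucD:
  assumes "i \<in> letters" "x \<in> SG" "sg_map i x \<in> vertices (Suc m)"
  shows "x \<in> vertices m"
proof -
  obtain k z where k: "k \<in> letters" "z \<in> vertices m" "sg_map i x = sg_map k z"
    using assms(3) by (rule vertices_Suc_cases)
  then show ?thesis
    using cell_overlap(1)[of i k x z] assms corner_in_vertices vertices_subset_SG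
    by (cases "k = i") auto
qed

lemma sg_map_not_in_vertices_0:
  assumes "i \<in> letters" "x \<in> SG" "x \<notin> vertices 0"
  shows "sg_map i x \<notin> vertices 0"
  using assms sg_map_eq_corner[of i _ x] unfolding vertices_0 by blast

lemma sg_map_corner_not_in_vertices_0:
  assumes "i \<in> letters" "j \<in> letters" "i \<noteq> j"
  shows "sg_map i (corner j) \<notin> vertices 0"
  using assms sg_map_eq_corner[of i _ "corner j"] corner_in_SG corner_eq_iff unfolding vertices_0 by blast

text \<open>The closure of all vertices is mapped into itself by the three maps, so the contraction
  argument applies to it.\<close>

lemma SG_subset_closure_vertices: "SG \<subseteq> closure (\<Union>m. vertices m)"
proof (rule subset_of_contraction)
  show "bounded SG" "SG \<subseteq> hutchinson SG"
    using compact_SG SG_subset_hutchinson by (auto simp: compact_imp_bounded)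
  show "closure (\<Union>m. vertices m) \<noteq> {}" using corner_in_vertices[of 1] by fastforce
  have "sg_map i ` closure (\<Union>m. vertices m) \<subseteq> closure (\<Union>m. vertices m)" if "i \<in> letters" for i
  proof (rule image_closure_subset)
    have "sg_map i ` (\<Union>m. vertices m) \<subseteq> (\<Union>m. vertices m)"
    proof (rule image_subsetI)
      fix x assume "x \<in> (\<Union>m. vertices m)"
      then obtain m where "x \<in> vertices m" by blast
      then have "sg_map i x \<in> vertices (Suc m)" by (rule sg_map_in_vertices[OF that])
      then show "sg_map i x \<in> (\<Union>m. vertices m)" by (rule UN_I[OF UNIV_I])
    qed
    then show "sg_map i ` (\<Union>m. vertices m) \<subseteq> closure (\<Union>m. vertices m)"
      using closure_subset by (rule order_trans)
  qed (simp_all add: continuous_on_sg_map)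
  then show "hutchinson (closure (\<Union>m. vertices m)) \<subseteq> closure (\<Union>m. vertices m)"
    unfolding hutchinson_def by blast
qed simp

section \<open>Words, cells and connectedness\<close>

lemma word_map_Nil [simp]: "word_map [] = id"
  and word_map_Cons [simp]: "word_map (i # w) x = sg_map i (word_map w x)"
  by (simp_all add: word_map_def)

lemma words_0: "words 0 = {[]}"
  by (auto simp: words_def)

lemma words_Suc: "words (Suc m) = (\<Union>i\<in>letters. (#) i ` words m)"
proof -
  have "w \<in> words (Suc m) \<longleftrightarrow> w \<in> (\<Union>i\<in>letters. (#) i ` words m)" for w
    by (cases w) (auto simp: words_def letters_def)
  then show ?thesis by blast
qed

lemma finite_words: "finite (words m)"
  by (induction m) (auto simp: words_0 words_Suc)

lemma card_words: "card (words m) = 3 ^ m"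
proof (induction m)
  case (Suc m)
  have "card (words (Suc m)) = (\<Sum>i\<in>letters. card ((#) i ` words m))"
    unfolding words_Suc by (rule card_UN_disjoint) (auto simp: finite_words)
  also have "\<dots> = 3 * 3 ^ m" by (simp add: card_image Suc)
  finally show ?case by simp
qed (simp add: words_0)

lemma sum_words_Suc:
  "(\<Sum>w\<in>words (Suc m). g w) = (\<Sum>i\<in>letters. \<Sum>w\<in>words m. g (i # w) :: real)"
proof -
  have "(\<Sum>w\<in>words (Suc m). g w) = (\<Sum>i\<in>letters. \<Sum>w\<in>(#) i ` words m. g w)"
    unfolding words_Suc by (rule sum.UNION_disjoint) (auto simp: finite_words)
  then show ?thesis by (simp add: sum.reindex)
qed

lemma word_map_in_SG: "w \<in> words m \<Longrightarrow> x \<in> SG \<Longrightarrow> word_map w x \<in> SG"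
  by (induction m arbitrary: w) (auto simp: words_0 words_Suc sg_map_in_SG)

lemma SG_eq_UN_words: "SG = (\<Union>w\<in>words m. word_map w ` SG)"
proof (induction m)
  case (Suc m)
  have "(\<Union>w\<in>words (Suc m). word_map w ` SG) = (\<Union>i\<in>letters. sg_map i ` (\<Union>w\<in>words m. word_map w ` SG))"
    by (subst words_Suc, subst UN_UN_flatten) (simp add: image_UN image_image)
  also have "\<dots> = SG" using SG_self_similar unfolding Suc[symmetric] hutchinson_def by simp
  finally show ?case by simp
qed (simp add: words_0)

lemma dist_word_map: "dist (word_map w x) (word_map w y) = dist x y / 2 ^ length w"
  by (induction w) (auto simp: dist_sg_map)

lemma continuous_on_word_map: "continuous_on S (word_map w)"
proof (induction w)
  case (Cons i w)
  have "continuous_on S (sg_map i \<circ> word_map w)"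
    by (intro continuous_on_compose Cons continuous_intros)
  then show ?case by (simp add: o_def)
qed (simp add: id_def)

lemma compact_cell: "compact (word_map w ` SG)"
  by (intro compact_continuous_image continuous_on_word_map compact_SG)

text \<open>Uniform continuity together with the diameter of an \<open>n\<close>-cell, which is
  \<open>2 ^ n\<close> times smaller than that of the gasket.\<close>

lemma uniform_on_cells:
  fixes g :: "point \<Rightarrow> 'a :: metric_space"
  assumes "continuous_on SG g" "e > 0"
  obtains N where "\<And>n w x y. n \<ge> N \<Longrightarrow> w \<in> words n \<Longrightarrow> x \<in> SG \<Longrightarrow> y \<in> SG \<Longrightarrow>
    dist (g (word_map w x)) (g (word_map w y)) < e"
proof -
  have "uniformly_continuous_on SG g" using assms compact_SG compact_uniformly_continuous by blast
  then obtain d where d: "d > 0" "\<And>x y. x \<in> SG \<Longrightarrow> y \<in> SG \<Longrightarrow> dist y x < d \<Longrightarrow> dist (g y) (g x) < e"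
    using assms(2) unfolding uniformly_continuous_on_def by metis
  obtain C where C: "\<And>x y. x \<in> SG \<Longrightarrow> y \<in> SG \<Longrightarrow> dist x y \<le> C"
    using compact_imp_bounded[OF compact_SG] unfolding bounded_two_points by blast
  obtain N where N: "C / d < 2 ^ N" using real_arch_pow[of 2 "C / d"] by auto
  show ?thesis
  proof (rule that[of N])
    fix n w x y assume *: "n \<ge> N" "w \<in> words n" "x \<in> SG" "y \<in> SG"
    have "dist (word_map w x) (word_map w y) \<le> C / 2 ^ n"
      using C[OF *(3,4)] *(2) by (simp add: dist_word_map words_def divide_right_mono)
    also have "(2::real) ^ N \<le> 2 ^ n" using * by simp
    then have "C / d < 2 ^ n" using N by linarith
    then have "C / 2 ^ n < d" using d(1) by (simp add: field_simps)
    finally show "dist (g (word_map w x)) (g (word_map w y)) < e"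
      using d(2) * by (simp add: word_map_in_SG)
  qed
qed

text \<open>Any two of the three cells share a junction point, through which a constant value passes
  from one to the other.\<close>

lemma constant_on_SG_if_constant_on_cells:
  assumes "\<And>w x y. w \<in> words N \<Longrightarrow> x \<in> SG \<Longrightarrow> y \<in> SG \<Longrightarrow> g (word_map w x) = g (word_map w y)"
    and "x \<in> SG" "y \<in> SG"
  shows "g x = g y"
  using assms
proof (induction N arbitrary: g x y)
  case (Suc N)
  have *: "g (sg_map i x) = g (sg_map i y)" if "i \<in> letters" "x \<in> SG" "y \<in> SG" for i x y
  proof (rule Suc.IH[of "\<lambda>x. g (sg_map i x)"])
    fix w x y assume *: "w \<in> words N" "x \<in> SG" "y \<in> SG"
    then have "i # w \<in> words (Suc N)" using that unfolding words_Suc by blast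
    from Suc.prems(1)[OF this *(2,3)]
    show "g (sg_map i (word_map w x)) = g (sg_map i (word_map w y))" by simp
  qed (rule that)+
  obtain i x' where x: "i \<in> letters" "x' \<in> SG" "x = sg_map i x'" using Suc.prems(2) by (rule SG_cases)
  obtain j y' where y: "j \<in> letters" "y' \<in> SG" "y = sg_map j y'" using Suc.prems(3) by (rule SG_cases)
  have "g x = g (sg_map i (corner j))"
    unfolding x(3) by (rule *[OF x(1,2) corner_in_SG[OF y(1)]])
  also have "\<dots> = g (sg_map j (corner i))" by (simp add: sg_map_corner_commute)
  also have "\<dots> = g y"
    unfolding y(3) by (rule *[OF y(1) corner_in_SG[OF x(1)] y(2)])
  finally show ?case .
next
  case 0
  have "[] \<in> words 0" by (simp add: words_0)
  from 0(1)[OF this 0(2,3)] show ?case by simp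
qed

text \<open>A continuous function with finitely many values has a smallest gap between them, so it
  is constant on all sufficiently small cells and then on the gasket.\<close>

lemma connected_SG: "connected SG"
proof -
  have "g constant_on SG" if g: "continuous_on SG g" "finite (g ` SG)" for g :: "point \<Rightarrow> real"
  proof -
    have "\<forall>a\<in>g ` SG. \<exists>\<delta>>0. \<forall>x\<in>g ` SG. x \<noteq> a \<longrightarrow> \<delta> \<le> dist a x"
      using finite_set_avoid[OF g(2)] by blast
    then obtain \<delta> where \<delta>: "\<And>a. a \<in> g ` SG \<Longrightarrow> \<delta> a > 0"
      "\<And>a x. a \<in> g ` SG \<Longrightarrow> x \<in> g ` SG \<Longrightarrow> x \<noteq> a \<Longrightarrow> \<delta> a \<le> dist a x" by metis
    define e where "e = Min (\<delta> ` g ` SG)"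
    have e: "e > 0" "e \<le> dist a x" if "a \<in> g ` SG" "x \<in> g ` SG" "x \<noteq> a" for a x
    proof -
      show "e > 0" unfolding e_def using g \<delta>(1) SG_nonempty by (subst Min_gr_iff) auto
      have "e \<le> \<delta> a" unfolding e_def using g that by (intro Min_le) auto
      then show "e \<le> dist a x" using \<delta>(2)[OF that] by linarith
    qed
    have "e > 0" unfolding e_def using g \<delta>(1) SG_nonempty by (subst Min_gr_iff) auto
    then obtain N where N: "\<And>n w x y. n \<ge> N \<Longrightarrow> w \<in> words n \<Longrightarrow> x \<in> SG \<Longrightarrow> y \<in> SG \<Longrightarrow>
        dist (g (word_map w x)) (g (word_map w y)) < e"
      using uniform_on_cells[OF g(1)] by metis
    have "g (word_map w x) = g (word_map w y)" if "w \<in> words N" "x \<in> SG" "y \<in> SG" for w x y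
    proof (rule ccontr)
      assume "g (word_map w x) \<noteq> g (word_map w y)"
      then have "e \<le> dist (g (word_map w x)) (g (word_map w y))"
        using that word_map_in_SG by (intro e(2)) auto
      then show False using N[OF order_refl that] by linarith
    qed
    then show ?thesis
      unfolding constant_on_def using constant_on_SG_if_constant_on_cells SG_nonempty by blast
  qed
  then show ?thesis unfolding continuous_finite_range_constant_eq[where 'b = real] by blast
qed

section \<open>The self-similar measure\<close>

definition is_sg_measure :: "point measure \<Rightarrow> bool" where
  "is_sg_measure M \<longleftrightarrow> prob_space M \<and> space M = SG \<and> sets M = sets (restrict_space borel SG) \<and>
     (\<forall>m. \<forall>w\<in>words m. measure M (word_map w ` SG) = (1/3) ^ m)"

lemma sg_measure_eq_The: "sg_measure = (THE M. is_sg_measure M)"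
  unfolding sg_measure_def is_sg_measure_def
  by (rule arg_cong[where f = The]) (simp add: cells_def fun_eq_iff)

lemma closed_in_restrict_SG: "closed C \<Longrightarrow> C \<subseteq> SG \<Longrightarrow> C \<in> sets (restrict_space borel SG)"
  by (auto simp: sets_restrict_space_iff closed_SG)

lemma cell_subset_SG: "w \<in> words m \<Longrightarrow> word_map w ` SG \<subseteq> SG"
  using word_map_in_SG by blast

text \<open>Cells overlap, and \<open>M\<close> is not known to give junction points mass 0.
  Subadditivity bounds the union over \<open>W\<close> and the union over its complement from above;
  as the two cover a set of mass 1, both bounds are attained.\<close>

lemma measure_UN_cells:
  assumes M: "is_sg_measure M" and W: "W \<subseteq> words m"
  shows "measure M (\<Union>w\<in>W. word_map w ` SG) = card W / 3 ^ m"
proof -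
  interpret prob_space M using M by (simp add: is_sg_measure_def)
  have fin: "finite W" "finite (words m - W)" using W finite_words finite_subset by blast+
  have cell: "word_map w ` SG \<in> sets M" if "w \<in> words m" for w
    using M compact_imp_closed[OF compact_cell] cell_subset_SG[OF that]
    by (auto simp: is_sg_measure_def intro!: closed_in_restrict_SG)
  have le: "measure M (\<Union>w\<in>V. word_map w ` SG) \<le> card V / 3 ^ m" if "V \<subseteq> words m" "finite V" for V
  proof -
    have "measure M (\<Union>w\<in>V. word_map w ` SG) \<le> (\<Sum>w\<in>V. measure M (word_map w ` SG))"
      using that cell by (intro finite_measure_subadditive_finite) auto
    also have "\<dots> = (\<Sum>w\<in>V. (1/3) ^ m)"
      using that M by (intro sum.cong) (auto simp: is_sg_measure_def)
    finally show ?thesis by (simp add: power_divide)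
  qed
  have UN: "(\<Union>w\<in>W. word_map w ` SG) \<union> (\<Union>w\<in>words m - W. word_map w ` SG) = SG"
    by (rule trans[OF _ SG_eq_UN_words[of m, symmetric]]) (use W in blast)
  have "1 = measure M ((\<Union>w\<in>W. word_map w ` SG) \<union> (\<Union>w\<in>words m - W. word_map w ` SG))"
    unfolding UN using M prob_space by (simp add: is_sg_measure_def)
  also have "\<dots> \<le> measure M (\<Union>w\<in>W. word_map w ` SG) + measure M (\<Union>w\<in>words m - W. word_map w ` SG)"
    using W fin cell by (intro measure_Un_le sets.finite_UN) auto
  finally have "1 \<le> measure M (\<Union>w\<in>W. word_map w ` SG) + card (words m - W) / 3 ^ m"
    using le[OF Diff_subset fin(2)] by linarith
  moreover have c: "real (card (words m - W)) = 3 ^ m - real (card W)"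
    using W fin card_mono[OF finite_words W] by (simp add: card_Diff_subset card_words of_nat_diff)
  have "real (card (words m - W)) / 3 ^ m = 1 - card W / 3 ^ m"
    unfolding c by (simp add: diff_divide_distrib)
  ultimately show ?thesis using le[OF W fin(1)] by linarith
qed

text \<open>The cells of a given level that meet a closed set have the same total measure for both measures.\<close>

lemma is_sg_measure_closed_le:
  assumes M: "is_sg_measure M" and N: "is_sg_measure N" and C: "closed C"
  shows "measure M (C \<inter> SG) \<le> measure N (C \<inter> SG)"
proof (cases "C = {}")
  case False
  interpret M: prob_space M using M by (simp add: is_sg_measure_def)
  interpret N: prob_space N using N by (simp add: is_sg_measure_def)
  have sets: "sets M = sets (restrict_space borel SG)" "sets N = sets (restrict_space borel SG)"
    using M N by (auto simp: is_sg_measure_def)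
  obtain D where D: "\<And>x y. x \<in> SG \<Longrightarrow> y \<in> SG \<Longrightarrow> dist x y \<le> D"
    using compact_imp_bounded[OF compact_SG] unfolding bounded_two_points by blast
  have D0: "D \<ge> 0" using D SG_nonempty by fastforce
  \<comment> \<open>\<open>B m\<close> contains every \<open>m\<close>-cell that meets
    \<open>C\<close>, and these neighbourhoods shrink to \<open>C \<inter> SG\<close>.\<close>
  define B where "B m = {x. infdist x C \<le> D / 2 ^ m} \<inter> SG" for m :: nat
  have closed_B: "closed (B m)" for m
    unfolding B_def by (intro closed_Int closed_SG closed_Collect_le continuous_intros)
  have B_sets: "B m \<in> sets N" for m
    unfolding sets using closed_B by (intro closed_in_restrict_SG) (auto simp: B_def)
  have bound: "measure M (C \<inter> SG) \<le> measure N (B m)" for m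
  proof -
    define W where "W = {w \<in> words m. word_map w ` SG \<inter> C \<noteq> {}}"
    define U where "U = (\<Union>w\<in>W. word_map w ` SG)"
    have W: "W \<subseteq> words m" "finite W" by (auto simp: W_def finite_words)
    have closed_U: "closed U"
      unfolding U_def using W compact_imp_closed[OF compact_cell] by (intro closed_UN) auto
    have U_SG: "U \<subseteq> SG" unfolding U_def using W cell_subset_SG by blast
    have U_sets: "U \<in> sets M" unfolding sets by (intro closed_in_restrict_SG closed_U U_SG)
    have "C \<inter> SG \<subseteq> U"
      using SG_eq_UN_words[of m] unfolding U_def W_def by blast
    then have "measure M (C \<inter> SG) \<le> measure M U" using U_sets by (rule M.finite_measure_mono)
    also have "\<dots> = measure N U"
      unfolding U_def using measure_UN_cells[OF M W(1)] measure_UN_cells[OF N W(1)] by simp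
    also have "U \<subseteq> B m"
    proof
      fix x assume x: "x \<in> U"
      then obtain w y z where *: "w \<in> words m" "x = word_map w y" "y \<in> SG" "z \<in> SG" "word_map w z \<in> C"
        unfolding U_def W_def by blast
      have "infdist x C \<le> dist x (word_map w z)" using * by (intro infdist_le)
      also have "\<dots> \<le> D / 2 ^ m" using D * by (simp add: dist_word_map words_def divide_right_mono)
      finally show "x \<in> B m" using x U_SG by (auto simp: B_def)
    qed
    then have "measure N U \<le> measure N (B m)" using B_sets by (rule N.finite_measure_mono)
    finally show ?thesis .
  qed
  have "decseq B"
    unfolding B_def decseq_def
  proof (intro allI impI Int_mono subsetI CollectI)
    fix m n x assume "m \<le> n" "x \<in> {x. infdist x C \<le> D / 2 ^ n}"
    moreover have "D / 2 ^ n \<le> D / 2 ^ m" using D0 \<open>m \<le> n\<close> by (intro divide_left_mono) auto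
    ultimately show "infdist x C \<le> D / 2 ^ m" by simp
  qed auto
  then have "(\<lambda>m. measure N (B m)) \<longlonglongrightarrow> measure N (\<Inter>m. B m)"
    using B_sets by (intro N.finite_Lim_measure_decseq) auto
  moreover have "(\<Inter>m. B m) = C \<inter> SG"
  proof (intro equalityI subsetI)
    fix x assume x: "x \<in> (\<Inter>m. B m)"
    have "(\<lambda>m. D * (1/2) ^ m) \<longlonglongrightarrow> D * 0" by (intro tendsto_intros) auto
    then have "infdist x C \<le> D * 0"
      by (rule LIMSEQ_le_const) (use x in \<open>auto simp: B_def power_divide\<close>)
    then have "infdist x C = 0" using infdist_nonneg[of x C] by simp
    then show "x \<in> C \<inter> SG" using x C False in_closed_iff_infdist_zero by (auto simp: B_def)
  next
    fix x assume "x \<in> C \<inter> SG"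
    then show "x \<in> (\<Inter>m. B m)" using D0 by (auto simp: B_def)
  qed
  ultimately have "(\<lambda>m. measure N (B m)) \<longlonglongrightarrow> measure N (C \<inter> SG)" by simp
  then show ?thesis by (rule LIMSEQ_le_const) (use bound in auto)
qed simp

text \<open>Closed sets generate the Borel sets and are stable under intersection. Both measures are
  pushed to the plane, where this generator lives, and compared there.\<close>

lemma is_sg_measure_unique:
  assumes M: "is_sg_measure M" and N: "is_sg_measure N"
  shows "M = N"
proof -
  interpret M: prob_space M using M by (simp add: is_sg_measure_def)
  interpret N: prob_space N using N by (simp add: is_sg_measure_def)
  have sets: "sets M = sets (restrict_space borel SG)" "sets N = sets (restrict_space borel SG)"
    and space: "space M = SG" "space N = SG"
    using M N by (auto simp: is_sg_measure_def)
  have id: "(\<lambda>x. x) \<in> measurable M borel" "(\<lambda>x. x) \<in> measurable N borel"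
    unfolding measurable_cong_sets[OF sets(1) refl] measurable_cong_sets[OF sets(2) refl]
    by (auto intro: measurable_restrict_space1)
  have eq: "distr M borel (\<lambda>x. x) = distr N borel (\<lambda>x. x)"
  proof (rule measure_eqI_generator_eq[where E = "Collect closed" and \<Omega> = UNIV and A = "\<lambda>_. UNIV"])
    show "Int_stable (Collect closed :: point set set)" by (auto simp: Int_stable_def)
    fix C :: "point set" assume C: "C \<in> Collect closed"
    then have "C \<in> sets borel" by simp
    have "measure M (C \<inter> SG) = measure N (C \<inter> SG)"
      using is_sg_measure_closed_le[OF M N] is_sg_measure_closed_le[OF N M] C by (intro antisym) auto
    then show "emeasure (distr M borel (\<lambda>x. x)) C = emeasure (distr N borel (\<lambda>x. x)) C"
      using id \<open>C \<in> sets borel\<close>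
      by (simp add: emeasure_distr space M.emeasure_eq_measure N.emeasure_eq_measure)
  next
    show "emeasure (distr M borel (\<lambda>x. x)) UNIV \<noteq> \<infinity>"
      using id by (simp add: emeasure_distr M.emeasure_eq_measure)
  qed (auto simp: borel_eq_closed)
  show ?thesis
  proof (rule measure_eqI)
    fix A assume A: "A \<in> sets M"
    then have A': "A \<in> sets borel" "A \<subseteq> SG" "A \<in> sets N"
      using sets by (auto simp: sets_restrict_space_iff closed_SG)
    have "emeasure M A = emeasure (distr M borel (\<lambda>x. x)) A"
      using id A' by (simp add: emeasure_distr space Int_absorb2)
    also have "\<dots> = emeasure N A"
      unfolding eq using id A' by (simp add: emeasure_distr space Int_absorb2)
    finally show "emeasure M A = emeasure N A" .
  qed (simp add: sets)
qed

section \<open>Existence of the measure as the law of a random address\<close>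

text \<open>The point with address \<open>s\<close>: composing the maps \<open>sg_map\<close> along
  the stream turns the nested cells into this series.\<close>

definition code :: "nat stream \<Rightarrow> point" where
  "code s = (\<Sum>n. (1/2) ^ Suc n *\<^sub>R corner (s !! n))"

definition coin :: "nat measure" where
  "coin = measure_pmf (pmf_of_set letters)"

definition code_measure :: "point measure" where
  "code_measure = distr (stream_space coin) (restrict_space borel SG) code"

lemma norm_corner_le: "norm (corner i) \<le> 1"
  by (simp add: corner_def norm_Pair power_divide)

lemma summable_code: "summable (\<lambda>n. (1/2) ^ Suc n *\<^sub>R corner (s !! n))"
proof (rule summable_comparison_test)
  show "summable (\<lambda>n. (1/2::real) ^ Suc n)" using power_half_series sums_summable by blast
  have "norm ((1/2) ^ Suc n *\<^sub>R corner (s !! n)) \<le> (1/2) ^ Suc n" for n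
    using mult_left_mono[OF norm_corner_le[of "s !! n"], of "(1/2) ^ Suc n"] by simp
  then show "\<exists>N. \<forall>n\<ge>N. norm ((1/2) ^ Suc n *\<^sub>R corner (s !! n)) \<le> (1/2) ^ Suc n" by blast
qed

lemma norm_code_le: "norm (code s) \<le> 1"
proof -
  have s: "(\<lambda>n. (1/2::real) ^ Suc n) sums 1" by (rule power_half_series)
  have "norm (code s) \<le> (\<Sum>n. (1/2::real) ^ Suc n)"
    unfolding code_def
  proof (rule norm_suminf_le)
    show "norm ((1/2) ^ Suc n *\<^sub>R corner (s !! n)) \<le> (1/2) ^ Suc n" for n
      using mult_left_mono[OF norm_corner_le[of "s !! n"], of "(1/2) ^ Suc n"] by simp
  qed (use s sums_summable in blast)
  then show ?thesis using sums_unique[OF s] by simp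
qed

lemma code_Stream: "code (i ## s) = sg_map i (code s)"
proof -
  have "code (i ## s) = (1/2) *\<^sub>R corner i + (\<Sum>n. (1/2) ^ Suc (Suc n) *\<^sub>R corner (s !! n))"
    unfolding code_def using suminf_split_head[OF summable_code[of "i ## s"]] by (simp add: algebra_simps)
  also have "(\<Sum>n. (1/2) ^ Suc (Suc n) *\<^sub>R corner (s !! n)) = (1/2) *\<^sub>R code s"
    unfolding code_def using suminf_scaleR_right[OF summable_code[of s], of "1/2"] by simp
  finally show ?thesis by (simp add: sg_map_eq algebra_simps)
qed

text \<open>Streams range over all naturals. Numbers outside \<open>letters\<close> act like 3, so
  \<open>code\<close> maps every stream into the gasket, not only almost every one.\<close>

lemma sg_map_other: "i \<notin> letters \<Longrightarrow> sg_map i = sg_map 3"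
  by (auto simp: sg_map_def letters_def)

lemma code_in_SG: "code s \<in> SG"
proof -
  have "range code \<subseteq> SG"
  proof (rule subset_of_contraction)
    show "bounded (range code)" using norm_code_le by (auto simp: bounded_iff)
    show "range code \<subseteq> hutchinson (range code)"
    proof (rule image_subsetI)
      fix s
      have "code s = sg_map (shd s) (code (stl s))" using code_Stream[of "shd s" "stl s"] by simp
      moreover have "sg_map (shd s) = sg_map (if shd s \<in> letters then shd s else 3)"
        using sg_map_other by simp
      ultimately have "code s = sg_map (if shd s \<in> letters then shd s else 3) (code (stl s))" by metis
      moreover have "(if shd s \<in> letters then shd s else 3) \<in> letters" by simp
      ultimately show "code s \<in> hutchinson (range code)" unfolding hutchinson_def by blast
    qed
  qed (simp_all add: closed_SG SG_nonempty hutchinson_SG_subset)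
  then show ?thesis by blast
qed

interpretation coin: prob_space coin
  unfolding coin_def by (rule measure_pmf.prob_space_axioms)

interpretation stream: prob_space "stream_space coin"
  by (rule coin.prob_space_stream_space)

lemma measurable_code [measurable]: "code \<in> measurable (stream_space coin) (restrict_space borel SG)"
proof (rule measurable_restrict_space2)
  show "code \<in> borel_measurable (stream_space coin)"
  proof (rule borel_measurable_LIMSEQ_metric)
    fix n
    have [measurable]: "corner \<in> measurable coin borel" by (simp add: coin_def)
    show "(\<lambda>s. \<Sum>k<n. (1/2) ^ Suc k *\<^sub>R corner (s !! k)) \<in> borel_measurable (stream_space coin)"
      by measurable
  next
    fix s
    show "(\<lambda>n. \<Sum>k<n. (1/2) ^ Suc k *\<^sub>R corner (s !! k)) \<longlonglongrightarrow> code s"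
      unfolding code_def by (rule summable_LIMSEQ[OF summable_code])
  qed
qed (simp add: code_in_SG)

lemma nn_integral_coin: "(\<integral>\<^sup>+i. h i \<partial>coin) = (\<Sum>i\<in>letters. h i) / 3"
  unfolding coin_def by (subst nn_integral_pmf_of_set) (auto simp: letters_def)

lemma space_code_measure [simp]: "space code_measure = SG"
  and sets_code_measure: "sets code_measure = sets (restrict_space borel SG)"
  by (simp_all add: code_measure_def space_restrict_space)

interpretation code: prob_space code_measure
  unfolding code_measure_def by (rule stream.prob_space_distr) simp

lemma measurable_sg_map_SG [measurable]:
  "i \<in> letters \<Longrightarrow> sg_map i \<in> measurable (restrict_space borel SG) (restrict_space borel SG)"
  by (intro measurable_restrict_space3 borel_measurable_continuous_onI continuous_on_sg_map)
     (auto simp: sg_map_in_SG)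

text \<open>Conditioning on the first letter of the address: the rest of the stream has the same law
  again.\<close>

lemma nn_integral_code_measure:
  assumes h: "h \<in> borel_measurable (restrict_space borel SG)"
  shows "(\<integral>\<^sup>+x. h x \<partial>code_measure) = (\<Sum>i\<in>letters. \<integral>\<^sup>+x. h (sg_map i x) \<partial>code_measure) / 3"
proof -
  have "(\<integral>\<^sup>+x. h x \<partial>code_measure) = (\<integral>\<^sup>+s. h (code s) \<partial>stream_space coin)"
    unfolding code_measure_def using h by (intro nn_integral_distr) auto
  also have "\<dots> = (\<integral>\<^sup>+i. (\<integral>\<^sup>+s. h (code (i ## s)) \<partial>stream_space coin) \<partial>coin)"
    by (intro coin.nn_integral_stream_space measurable_compose[OF measurable_code h])
  also have "\<dots> = (\<Sum>i\<in>letters. \<integral>\<^sup>+s. h (sg_map i (code s)) \<partial>stream_space coin) / 3"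
    by (simp add: nn_integral_coin code_Stream)
  also have "\<dots> = (\<Sum>i\<in>letters. \<integral>\<^sup>+x. h (sg_map i x) \<partial>code_measure) / 3"
    unfolding code_measure_def using h
    by (intro arg_cong2[where f = "(/)"] sum.cong nn_integral_distr[symmetric] measurable_compose[OF measurable_sg_map_SG]) auto
  finally show ?thesis .
qed

lemma emeasure_code_measure:
  assumes A: "A \<in> sets code_measure"
  shows "emeasure code_measure A =
    (\<Sum>i\<in>letters. emeasure code_measure {x \<in> SG. sg_map i x \<in> A}) / 3"
proof -
  have meas: "{x \<in> SG. sg_map i x \<in> A} \<in> sets code_measure" if "i \<in> letters" for i
  proof -
    have "sg_map i -` A \<inter> space code_measure \<in> sets code_measure"
      using measurable_sg_map_SG[OF that] A sets_code_measure
      by (intro measurable_sets[of _ _ code_measure]) (auto cong: measurable_cong_sets)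
    then show ?thesis by (simp add: vimage_def Int_def conj_commute)
  qed
  have "emeasure code_measure A = (\<integral>\<^sup>+x. indicator A x \<partial>code_measure)"
    using A by simp
  also have "\<dots> = (\<Sum>i\<in>letters. \<integral>\<^sup>+x. indicator A (sg_map i x) \<partial>code_measure) / 3"
    using A by (intro nn_integral_code_measure) (simp add: sets_code_measure)
  also have "(\<Sum>i\<in>letters. \<integral>\<^sup>+x. indicator A (sg_map i x) \<partial>code_measure) =
      (\<Sum>i\<in>letters. emeasure code_measure {x \<in> SG. sg_map i x \<in> A})"
  proof (intro sum.cong refl)
    fix i assume i: "i \<in> letters"
    have "(\<integral>\<^sup>+x. indicator A (sg_map i x) \<partial>code_measure) =
        (\<integral>\<^sup>+x. indicator {x \<in> SG. sg_map i x \<in> A} x \<partial>code_measure)"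
      by (intro nn_integral_cong) (auto simp: indicator_def)
    then show "(\<integral>\<^sup>+x. indicator A (sg_map i x) \<partial>code_measure) = emeasure code_measure {x \<in> SG. sg_map i x \<in> A}"
      using meas[OF i] by simp
  qed
  finally show ?thesis .
qed

lemma measure_code_measure:
  assumes A: "A \<in> sets code_measure"
  shows "measure code_measure A =
    (\<Sum>i\<in>letters. measure code_measure {x \<in> SG. sg_map i x \<in> A}) / 3"
proof -
  have "ennreal (measure code_measure A) =
      ennreal ((\<Sum>i\<in>letters. measure code_measure {x \<in> SG. sg_map i x \<in> A}) / 3)"
    using emeasure_code_measure[OF A]
    by (simp add: code.emeasure_eq_measure sum_ennreal ennreal_divide_numeral sum_nonneg)
  then show ?thesis by (simp add: sum_nonneg)
qed

text \<open>Only the corner's own map hits it, and only from the corner itself; self-similarity then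
  makes its mass a third of itself.\<close>

lemma measure_code_measure_corner:
  assumes i: "i \<in> letters"
  shows "measure code_measure {corner i} = 0"
proof -
  have "{corner i} \<in> sets code_measure"
    using corner_in_SG[OF i] by (simp add: sets_code_measure closed_in_restrict_SG)
  then have "measure code_measure {corner i} =
      (\<Sum>k\<in>letters. measure code_measure {x \<in> SG. sg_map k x = corner i}) / 3"
    by (simp add: measure_code_measure)
  also have "\<dots> = (\<Sum>k\<in>letters. if k = i then measure code_measure {corner i} else 0) / 3"
  proof (intro arg_cong2[where f = "(/)"] sum.cong refl)
    fix k assume k: "k \<in> letters"
    have "{x \<in> SG. sg_map k x = corner i} = (if k = i then {corner i} else {})"
      using sg_map_eq_corner[OF k i] corner_in_SG[OF i] by auto
    then show "measure code_measure {x \<in> SG. sg_map k x = corner i} =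
        (if k = i then measure code_measure {corner i} else 0)" by simp
  qed
  also have "\<dots> = measure code_measure {corner i} / 3" using i by simp
  finally show ?thesis by simp
qed

lemma is_sg_measure_code_measure: "is_sg_measure code_measure"
proof -
  have "measure code_measure (word_map w ` SG) = (1/3) ^ m" if "w \<in> words m" for m w
    using that
  proof (induction m arbitrary: w)
    case 0
    then show ?case using code.prob_space by (simp add: words_0)
  next
    case (Suc m)
    then obtain i v where w: "w = i # v" "i \<in> letters" "v \<in> words m" by (auto simp: words_Suc)
    define B where "B = word_map v ` SG"
    have B: "B \<subseteq> SG" unfolding B_def using w cell_subset_SG by blast
    have wB: "word_map w ` SG = sg_map i ` B" by (simp add: w B_def image_image)
    have "word_map w ` SG \<in> sets code_measure"
      unfolding sets_code_measure
      by (intro closed_in_restrict_SG compact_imp_closed compact_cell cell_subset_SG[OF Suc.prems])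
    then have "measure code_measure (word_map w ` SG) =
        (\<Sum>k\<in>letters. measure code_measure {x \<in> SG. sg_map k x \<in> sg_map i ` B}) / 3"
      unfolding wB by (rule measure_code_measure)
    also have "\<dots> = (\<Sum>k\<in>letters. if k = i then measure code_measure B else 0) / 3"
    proof (intro arg_cong2[where f = "(/)"] sum.cong refl)
      fix k assume k: "k \<in> letters"
      show "measure code_measure {x \<in> SG. sg_map k x \<in> sg_map i ` B} =
          (if k = i then measure code_measure B else 0)"
      proof (cases "k = i")
        case True
        then have "{x \<in> SG. sg_map k x \<in> sg_map i ` B} = B" using B by auto
        then show ?thesis using True by simp
      next
        case False
        \<comment> \<open>Another cell contributes at most the common junction point, whose preimage
          is a corner and hence null.\<close>
        have "{x \<in> SG. sg_map k x \<in> sg_map i ` B} \<subseteq> {corner i}"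
          using cell_overlap(1)[OF k w(2) False] B by blast
        then have "measure code_measure {x \<in> SG. sg_map k x \<in> sg_map i ` B} \<le> measure code_measure {corner i}"
          using corner_in_SG[OF w(2)]
          by (intro code.finite_measure_mono) (simp_all add: sets_code_measure closed_in_restrict_SG)
        then show ?thesis
          using False measure_code_measure_corner[OF w(2)] by (simp add: measure_le_0_iff)
      qed
    qed
    also have "\<dots> = measure code_measure B / 3" using w by simp
    finally show ?case using Suc.IH[OF w(3)] by (simp add: B_def)
  qed
  then show ?thesis
    by (simp add: is_sg_measure_def sets_code_measure code.prob_space_axioms)
qed

lemma sg_measure_eq: "sg_measure = code_measure"
  unfolding sg_measure_eq_The
  using is_sg_measure_code_measure is_sg_measure_unique by (intro the_equality) blast+

interpretation sg: prob_space sg_measure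
  unfolding sg_measure_eq by (rule code.prob_space_axioms)

lemma space_sg_measure [simp]: "space sg_measure = SG"
  and sets_sg_measure: "sets sg_measure = sets (restrict_space borel SG)"
  by (simp_all add: sg_measure_eq sets_code_measure)

section \<open>Integration of continuous functions\<close>

lemma borel_measurable_sg:
  fixes g :: "point \<Rightarrow> real"
  assumes "continuous_on SG g"
  shows "g \<in> borel_measurable sg_measure"
  using borel_measurable_continuous_on_restrict[OF assms] sets_sg_measure by (simp cong: measurable_cong_sets)

lemma bounded_on_SG:
  fixes g :: "point \<Rightarrow> real"
  assumes "continuous_on SG g"
  obtains B where "B > 0" "\<And>x. x \<in> SG \<Longrightarrow> \<bar>g x\<bar> \<le> B"
  using compact_imp_bounded[OF compact_continuous_image[OF assms compact_SG]]
  by (auto simp: bounded_pos)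

lemma integrable_sg:
  fixes g :: "point \<Rightarrow> real"
  assumes "continuous_on SG g"
  shows "integrable sg_measure g"
proof -
  obtain B where "\<And>x. x \<in> SG \<Longrightarrow> \<bar>g x\<bar> \<le> B" using bounded_on_SG[OF assms] by blast
  then show ?thesis
    by (intro sg.integrable_const_bound[of _ B] borel_measurable_sg assms AE_I2) simp_all
qed

lemma continuous_on_comp_sg_map:
  "continuous_on SG g \<Longrightarrow> i \<in> letters \<Longrightarrow> continuous_on SG (\<lambda>x. g (sg_map i x))"
  by (rule continuous_on_compose2[OF _ continuous_on_sg_map]) (auto simp: sg_map_in_SG)

lemma continuous_on_comp_word_map:
  "continuous_on SG g \<Longrightarrow> w \<in> words m \<Longrightarrow> continuous_on SG (\<lambda>x. g (word_map w x))"
  by (rule continuous_on_compose2[OF _ continuous_on_word_map]) (auto simp: word_map_in_SG)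

lemma integral_sg_self_similar:
  fixes g :: "point \<Rightarrow> real"
  assumes g: "continuous_on SG g"
  shows "(\<integral>x. g x \<partial>sg_measure) = (\<Sum>i\<in>letters. \<integral>x. g (sg_map i x) \<partial>sg_measure) / 3"
proof -
  have nonneg: "(\<integral>x. g x \<partial>sg_measure) = (\<Sum>i\<in>letters. \<integral>x. g (sg_map i x) \<partial>sg_measure) / 3"
    if g: "continuous_on SG g" "\<And>x. x \<in> SG \<Longrightarrow> g x \<ge> 0" for g :: "point \<Rightarrow> real"
  proof -
    have g': "continuous_on SG (\<lambda>x. g (sg_map i x))" "\<And>x. x \<in> SG \<Longrightarrow> g (sg_map i x) \<ge> 0" if "i \<in> letters" for i
      using that g sg_map_in_SG continuous_on_comp_sg_map by auto
    have "ennreal (\<integral>x. g x \<partial>sg_measure) = (\<integral>\<^sup>+x. g x \<partial>sg_measure)"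
      using g by (intro nn_integral_eq_integral[symmetric] integrable_sg AE_I2) auto
    also have "\<dots> = (\<Sum>i\<in>letters. \<integral>\<^sup>+x. g (sg_map i x) \<partial>sg_measure) / 3"
      unfolding sg_measure_eq using borel_measurable_sg[OF g(1)]
      by (intro nn_integral_code_measure) (simp add: sets_sg_measure cong: measurable_cong_sets)
    also have "(\<Sum>i\<in>letters. \<integral>\<^sup>+x. g (sg_map i x) \<partial>sg_measure) =
        (\<Sum>i\<in>letters. ennreal (\<integral>x. g (sg_map i x) \<partial>sg_measure))"
      using g' by (intro sum.cong nn_integral_eq_integral integrable_sg AE_I2) auto
    also have "\<dots> / 3 = ennreal ((\<Sum>i\<in>letters. \<integral>x. g (sg_map i x) \<partial>sg_measure) / 3)"
    proof -
      have "(\<integral>x. g (sg_map i x) \<partial>sg_measure) \<ge> 0" if "i \<in> letters" for i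
        using g'(2)[OF that] by (intro integral_nonneg_AE AE_I2) auto
      then show ?thesis by (simp add: sum_ennreal sum_nonneg flip: ennreal_divide_numeral)
    qed
    finally show ?thesis
      using g g' by (subst (asm) ennreal_inj)
        (auto intro!: integral_nonneg_AE AE_I2 divide_nonneg_nonneg sum_nonneg)
  qed
  \<comment> \<open>Adding the bound \<open>B\<close> reduces a general integrand to a nonnegative
    one, which the first half of the proof handles by nonnegative integrals.\<close>
  obtain B where B: "\<And>x. x \<in> SG \<Longrightarrow> \<bar>g x\<bar> \<le> B" using bounded_on_SG[OF g] by blast
  have "(\<integral>x. g x + B \<partial>sg_measure) = (\<Sum>i\<in>letters. \<integral>x. g (sg_map i x) + B \<partial>sg_measure) / 3"
    using B by (intro nonneg continuous_intros g) (force simp: abs_le_iff)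
  moreover have "(\<integral>x. g x + B \<partial>sg_measure) = (\<integral>x. g x \<partial>sg_measure) + B"
    using integrable_sg[OF g] sg.prob_space by simp
  moreover have "(\<integral>x. g (sg_map i x) + B \<partial>sg_measure) = (\<integral>x. g (sg_map i x) \<partial>sg_measure) + B"
    if "i \<in> letters" for i
    using integrable_sg[OF continuous_on_comp_sg_map[OF g that]] sg.prob_space by simp
  ultimately show ?thesis by (simp add: sum.distrib add_divide_distrib)
qed

lemma integral_sg_words:
  fixes g :: "point \<Rightarrow> real"
  assumes "continuous_on SG g"
  shows "(\<integral>x. g x \<partial>sg_measure) = (\<Sum>w\<in>words m. \<integral>x. g (word_map w x) \<partial>sg_measure) / 3 ^ m"
  using assms
proof (induction m arbitrary: g)
  case (Suc m)
  have "(\<integral>x. g x \<partial>sg_measure) = (\<Sum>i\<in>letters. \<integral>x. g (sg_map i x) \<partial>sg_measure) / 3"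
    by (rule integral_sg_self_similar[OF Suc.prems])
  also have "\<dots> = (\<Sum>i\<in>letters. (\<Sum>w\<in>words m. \<integral>x. g (sg_map i (word_map w x)) \<partial>sg_measure) / 3 ^ m) / 3"
    using Suc.IH[OF continuous_on_comp_sg_map[OF Suc.prems]] by simp
  finally show ?case by (simp add: sum_words_Suc sum_divide_distrib field_simps)
qed (simp add: words_0)

text \<open>By continuity \<open>g\<close> stays above half its value at \<open>x\<close> on a small
  cell, and each cell has a positive share in the integral.\<close>

lemma integral_sg_pos:
  fixes g :: "point \<Rightarrow> real"
  assumes g: "continuous_on SG g" "\<And>x. x \<in> SG \<Longrightarrow> g x \<ge> 0" and x: "x \<in> SG" "g x > 0"
  shows "(\<integral>x. g x \<partial>sg_measure) > 0"
proof -
  have "g x / 2 > 0" using x by simp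
  then obtain N where N: "\<And>n w x' y. n \<ge> N \<Longrightarrow> w \<in> words n \<Longrightarrow> x' \<in> SG \<Longrightarrow> y \<in> SG \<Longrightarrow>
      dist (g (word_map w x')) (g (word_map w y)) < g x / 2"
    using uniform_on_cells[OF g(1)] by metis
  obtain w z where w: "w \<in> words N" "z \<in> SG" "x = word_map w z"
    using x(1) SG_eq_UN_words[of N] by blast
  have "g x / 2 \<le> g (word_map w y)" if "y \<in> SG" for y
    using N[OF order_refl w(1,2) that] unfolding w(3)[symmetric] dist_real_def by linarith
  then have "(\<integral>y. g x / 2 \<partial>sg_measure) \<le> (\<integral>y. g (word_map w y) \<partial>sg_measure)"
    by (intro integral_mono integrable_sg continuous_on_comp_word_map[OF g(1) w(1)] continuous_intros) auto
  then have "g x / 2 \<le> (\<integral>y. g (word_map w y) \<partial>sg_measure)"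
    using sg.prob_space by simp
  also have "\<dots> \<le> (\<Sum>w\<in>words N. \<integral>y. g (word_map w y) \<partial>sg_measure)"
    by (intro member_le_sum w finite_words integral_nonneg_AE AE_I2 g(2))
      (simp, metis DiffD1 word_map_in_SG)
  finally have "0 < (\<Sum>w\<in>words N. \<integral>y. g (word_map w y) \<partial>sg_measure)"
    using x by linarith
  then show ?thesis unfolding integral_sg_words[OF g(1), of N] by simp
qed

lemma SG_eqI_of_integral:
  fixes u :: "point \<Rightarrow> real"
  assumes "continuous_on SG u" "(\<integral>x. u x * u x \<partial>sg_measure) = 0" "x \<in> SG"
  shows "u x = 0"
proof (rule ccontr)
  assume "u x \<noteq> 0"
  then have "0 < u x * u x" by (metis not_real_square_gt_zero)
  then have "(\<integral>x. u x * u x \<partial>sg_measure) > 0"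
    using assms by (intro integral_sg_pos[of _ x] continuous_intros) auto
  then show False using assms by simp
qed

text \<open>The measure charges every cell, so the essential supremum of a continuous function
  bounds all its values.\<close>

lemma sg_le_Linfty_norm:
  assumes f: "continuous_on SG f" and x: "x \<in> SG"
  shows "f x \<le> Linfty_norm f"
proof -
  define c where "c = esssup sg_measure (\<lambda>x. ereal \<bar>f x\<bar>)"
  have abs_cont: "continuous_on SG (\<lambda>x. \<bar>f x\<bar>)" by (intro continuous_intros f)
  have meas: "(\<lambda>x. ereal \<bar>f x\<bar>) \<in> borel_measurable sg_measure"
    using borel_measurable_sg[OF abs_cont] by simp
  obtain B where B: "\<And>x. x \<in> SG \<Longrightarrow> \<bar>f x\<bar> \<le> B" using bounded_on_SG[OF f] by blast
  have "c \<le> ereal B"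
    unfolding c_def by (intro esssup_I meas AE_I2) (use B in auto)
  moreover have "ereal \<bar>f y\<bar> \<le> c" if y: "y \<in> SG" for y
  proof (rule ccontr)
    assume "\<not> ereal \<bar>f y\<bar> \<le> c"
    then obtain b where b: "c < ereal b" "ereal b < ereal \<bar>f y\<bar>"
      using ereal_dense2 by (metis not_le)
    \<comment> \<open>The excess of \<bar>f\<bar> over \<open>b\<close> is continuous and positive
      at \<open>y\<close>, yet it vanishes almost everywhere.\<close>
    have "(\<integral>x. max 0 (\<bar>f x\<bar> - b) \<partial>sg_measure) > 0"
      using y b by (intro integral_sg_pos[of _ y] continuous_intros f) auto
    moreover have "AE x in sg_measure. ereal \<bar>f x\<bar> \<le> c"
      unfolding c_def by (rule esssup_AE)
    then have "AE x in sg_measure. max 0 (\<bar>f x\<bar> - b) = 0"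
    proof eventually_elim
      case (elim x)
      then have "ereal \<bar>f x\<bar> < ereal b" using b(1) by (rule le_less_trans)
      then show ?case by simp
    qed
    then have "(\<integral>x. max 0 (\<bar>f x\<bar> - b) \<partial>sg_measure) = 0"
      by (rule integral_eq_zero_AE)
    ultimately show False by simp
  qed
  ultimately have "ereal \<bar>f x\<bar> \<le> c" "c \<le> ereal B" using x by auto
  \<comment> \<open>The essential supremum lies between two reals, so \<open>real_of_ereal\<close>
    keeps its value.\<close>
  then obtain r where "c = ereal r" by (cases c) auto
  then show ?thesis using \<open>ereal \<bar>f x\<bar> \<le> c\<close> by (simp add: Linfty_norm_def c_def[symmetric])
qed

section \<open>The graph Laplacians\<close>

text \<open>
  The sum over the cells at \<open>x\<close> of the differences between \<open>u\<close> at the other vertices of the cell and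
  \<open>u x\<close>. Away from the boundary this is the graph Laplacian; at a boundary point it is a
  discrete normal derivative.
\<close>

primrec neumann :: "nat \<Rightarrow> (point \<Rightarrow> real) \<Rightarrow> point \<Rightarrow> real" where
  "neumann 0 u x = (\<Sum>i\<in>letters. u (corner i)) - 3 * u x"
| "neumann (Suc m) u x = (\<Sum>k\<in>letters. if x \<in> sg_map k ` vertices m
     then neumann m (\<lambda>y. u (sg_map k y)) (sg_inv k x) else 0)"

text \<open>Seen from cell \<open>i\<close>, a vertex is interior to the cell, or it is the corner
  that stays on the boundary, or a corner that becomes a junction with cell \<open>j\<close>.
  Passing to the next level splits along these cases.\<close>

lemma vertices_cases:
  assumes "z \<in> vertices m" "i \<in> letters"
  obtains (interior) "z \<notin> vertices 0" | (fixed) "z = corner i"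
    | (junction) j where "j \<in> letters" "j \<noteq> i" "z = corner j"
  using assms unfolding vertices_0 by blast

text \<open>Such a point lies in cell \<open>i\<close> only. The summand \<open>H\<close> is
  arbitrary, so that the lemma serves both \<open>neumann\<close> and sums over neighbours.\<close>

lemma sum_cells_at_interior:
  fixes H :: "nat \<Rightarrow> real"
  assumes i: "i \<in> letters" and z: "z \<in> vertices m" "z \<notin> vertices 0 \<or> z = corner i"
  shows "(\<Sum>k\<in>letters. if sg_map i z \<in> sg_map k ` vertices m then H k else 0) = H i"
proof -
  have "(if sg_map i z \<in> sg_map k ` vertices m then H k else 0) = (if k = i then H k else 0)"
    if k: "k \<in> letters" for k
  proof (cases "k = i")
    case False
    have "sg_map i z \<notin> sg_map k ` vertices m"
    proof
      assume "sg_map i z \<in> sg_map k ` vertices m"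
      then obtain y where y: "y \<in> vertices m" "sg_map i z = sg_map k y" by blast
      then have "z = corner k"
        using cell_overlap(1)[of i k z y] i k False z vertices_subset_SG by blast
      then show False using z(2) k i False corner_eq_iff unfolding vertices_0 by blast
    qed
    then show ?thesis using False by simp
  qed (use z in auto)
  then have "(\<Sum>k\<in>letters. if sg_map i z \<in> sg_map k ` vertices m then H k else 0) =
      (\<Sum>k\<in>letters. if k = i then H k else 0)" by (intro sum.cong refl)
  then show ?thesis using i by simp
qed

text \<open>A third cell \<open>k\<close> through the junction would force
  \<open>corner j = corner k\<close>, so exactly two summands survive.\<close>

lemma sum_cells_at_junction:
  fixes H :: "nat \<Rightarrow> real"
  assumes i: "i \<in> letters" and j: "j \<in> letters" "j \<noteq> i"
  shows "(\<Sum>k\<in>letters. if sg_map i (corner j) \<in> sg_map k ` vertices m then H k else 0) = H i + H j"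
proof -
  have "(if sg_map i (corner j) \<in> sg_map k ` vertices m then H k else 0) =
      (if k = i then H k else 0) + (if k = j then H k else 0)"
    if k: "k \<in> letters" for k
  proof -
    have "sg_map i (corner j) \<in> sg_map k ` vertices m \<longleftrightarrow> k = i \<or> k = j"
    proof
      assume "sg_map i (corner j) \<in> sg_map k ` vertices m"
      then obtain y where y: "y \<in> vertices m" "sg_map i (corner j) = sg_map k y" by blast
      show "k = i \<or> k = j"
      proof (rule ccontr)
        assume *: "\<not> (k = i \<or> k = j)"
        then have "corner j = corner k"
          using cell_overlap(1)[of i k "corner j" y] i k y corner_in_SG[OF j(1)] vertices_subset_SG by blast
        then show False using * j k corner_eq_iff by blast
      qed
    next
      assume "k = i \<or> k = j"
      then show "sg_map i (corner j) \<in> sg_map k ` vertices m"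
        using image_eqI[OF refl corner_in_vertices[OF j(1)], of "sg_map i" m]
          image_eqI[of _ "sg_map j" "corner i", OF sg_map_corner_commute corner_in_vertices[OF i], of m] by blast
    qed
    then show ?thesis using j by auto
  qed
  then have "(\<Sum>k\<in>letters. if sg_map i (corner j) \<in> sg_map k ` vertices m then H k else 0) =
      (\<Sum>k\<in>letters. (if k = i then H k else 0) + (if k = j then H k else 0))" by (intro sum.cong refl)
  then show ?thesis using i j by (simp add: sum.distrib)
qed

lemma neumann_interior:
  assumes "i \<in> letters" "z \<in> vertices m" "z \<notin> vertices 0 \<or> z = corner i"
  shows "neumann (Suc m) u (sg_map i z) = neumann m (\<lambda>y. u (sg_map i y)) z"
  using sum_cells_at_interior[OF assms, of "\<lambda>k. neumann m (\<lambda>y. u (sg_map k y)) (sg_inv k (sg_map i z))"]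
  by simp

lemma neumann_corner:
  assumes "i \<in> letters"
  shows "neumann (Suc m) u (corner i) = neumann m (\<lambda>y. u (sg_map i y)) (corner i)"
  using neumann_interior[OF assms corner_in_vertices[OF assms], of m u] by simp

lemma neumann_junction:
  assumes "i \<in> letters" "j \<in> letters" "j \<noteq> i"
  shows "neumann (Suc m) u (sg_map i (corner j)) =
    neumann m (\<lambda>y. u (sg_map i y)) (corner j) + neumann m (\<lambda>y. u (sg_map j y)) (corner i)"
proof -
  have "sg_inv j (sg_map i (corner j)) = corner i"
    by (metis sg_map_corner_commute sg_inv_sg_map)
  then show ?thesis
    using sum_cells_at_junction[OF assms, of m "\<lambda>k. neumann m (\<lambda>y. u (sg_map k y)) (sg_inv k (sg_map i (corner j)))"]
    by simp
qed

declare neumann.simps(2) [simp del]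

lemma neumann_cong:
  assumes "\<And>y. y \<in> vertices m \<Longrightarrow> u y = v y" "x \<in> vertices m"
  shows "neumann m u x = neumann m v x"
  using assms
proof (induction m arbitrary: u v x)
  case 0
  then have "u (corner i) = v (corner i)" if "i \<in> letters" for i
    using that corner_in_vertices by blast
  then show ?case using 0 by simp
next
  case (Suc m)
  have "neumann m (\<lambda>y. u (sg_map k y)) (sg_inv k x) = neumann m (\<lambda>y. v (sg_map k y)) (sg_inv k x)"
    if "k \<in> letters" "x \<in> sg_map k ` vertices m" for k
    using that by (intro Suc.IH Suc.prems(1) sg_map_in_vertices) auto
  then show ?case unfolding neumann.simps by (intro sum.cong) auto
qed

lemma neumann_linear:
  "neumann m (\<lambda>x. a * u x + b * v x) x = a * neumann m u x + b * neumann m v x"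
proof (induction m arbitrary: u v x)
  case 0
  then show ?case by (simp add: sum_letters algebra_simps)
next
  case (Suc m)
  show ?case unfolding neumann.simps Suc sum_distrib_left sum.distrib[symmetric]
    by (intro sum.cong) auto
qed

lemma neumann_zero: "neumann m (\<lambda>x. 0) x = 0"
  using neumann_linear[of m 0 "\<lambda>x. 0" 0 "\<lambda>x. 0" x] by simp

section \<open>Neighbours and the graph Laplacian\<close>

lemma cells_0: "cells 0 = {SG}"
  by (simp add: cells_def words_0)

lemma cells_Suc: "cells (Suc m) = (\<Union>i\<in>letters. (\<lambda>C. sg_map i ` C) ` cells m)"
  by (simp add: cells_def words_Suc image_UN image_image)

lemma cell_subset: "C \<in> cells m \<Longrightarrow> C \<subseteq> SG"
  unfolding cells_def using cell_subset_SG by blast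

lemma neighbours_subset: "neighbours m x \<subseteq> vertices m - {x}"
  by (auto simp: neighbours_def)

lemma neighbours_Suc:
  assumes "x \<in> vertices (Suc m)"
  shows "neighbours (Suc m) x =
    (\<Union>i\<in>{i \<in> letters. x \<in> sg_map i ` vertices m}. sg_map i ` neighbours m (sg_inv i x))"
proof (intro equalityI subsetI)
  fix y assume "y \<in> neighbours (Suc m) x"
  then obtain i C where y: "y \<in> vertices (Suc m)" "y \<noteq> x" "i \<in> letters" "C \<in> cells m"
    "x \<in> sg_map i ` C" "y \<in> sg_map i ` C"
    unfolding neighbours_def cells_Suc by blast
  then obtain x' y' where xy: "x = sg_map i x'" "y = sg_map i y'" "x' \<in> C" "y' \<in> C" by blast
  have "x' \<in> vertices m" "y' \<in> vertices m"
    using sg_map_in_vertices_SucD[OF y(3)] cell_subset[OF y(4)] xy y(1) assms by blast+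
  moreover from this have "y' \<in> neighbours m (sg_inv i x)"
    unfolding neighbours_def using xy y(2,4) by auto
  ultimately show "y \<in> (\<Union>i\<in>{i \<in> letters. x \<in> sg_map i ` vertices m}. sg_map i ` neighbours m (sg_inv i x))"
    using xy y(3) by blast
next
  fix y assume "y \<in> (\<Union>i\<in>{i \<in> letters. x \<in> sg_map i ` vertices m}. sg_map i ` neighbours m (sg_inv i x))"
  then obtain i x' y' where i: "i \<in> letters" "x = sg_map i x'" "x' \<in> vertices m" "y' \<in> neighbours m x'" "y = sg_map i y'"
    by auto
  then obtain C where "y' \<in> vertices m" "y' \<noteq> x'" "C \<in> cells m" "x' \<in> C" "y' \<in> C"
    unfolding neighbours_def by blast
  moreover from this have "sg_map i ` C \<in> cells (Suc m)" "x \<in> sg_map i ` C" "y \<in> sg_map i ` C"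
    unfolding cells_Suc i(2,5) using i(1) by (auto intro!: imageI)
  moreover have "y \<in> vertices (Suc m)"
    unfolding i(5) using i(1) \<open>y' \<in> vertices m\<close> by (rule sg_map_in_vertices)
  moreover have "y \<noteq> x"
    unfolding i(2,5) using \<open>y' \<noteq> x'\<close> by simp
  ultimately show "y \<in> neighbours (Suc m) x"
    unfolding neighbours_def mem_Collect_eq by (intro conjI bexI[of _ "sg_map i ` C"])
qed

text \<open>If \<open>x\<close> lies in two cells, it is their only common point, so its neighbours
  inside different cells are different and the sum splits over cells.\<close>

lemma sum_neighbours_Suc:
  assumes "x \<in> vertices (Suc m)"
  shows "(\<Sum>y\<in>neighbours (Suc m) x. u y) = (\<Sum>k\<in>letters. if x \<in> sg_map k ` vertices m
     then (\<Sum>y\<in>neighbours m (sg_inv k x). u (sg_map k y)) else (0 :: real))"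
proof -
  let ?I = "{i \<in> letters. x \<in> sg_map i ` vertices m}"
  have "(\<Sum>y\<in>neighbours (Suc m) x. u y) = (\<Sum>k\<in>?I. \<Sum>y\<in>sg_map k ` neighbours m (sg_inv k x). u y)"
    unfolding neighbours_Suc[OF assms]
  proof (rule sum.UNION_disjoint)
    show "\<forall>i\<in>?I. finite (sg_map i ` neighbours m (sg_inv i x))"
      using finite_subset[OF neighbours_subset] finite_vertices by blast
    show "\<forall>i\<in>?I. \<forall>j\<in>?I. i \<noteq> j \<longrightarrow>
      sg_map i ` neighbours m (sg_inv i x) \<inter> sg_map j ` neighbours m (sg_inv j x) = {}"
    proof (intro ballI impI)
      fix i j assume ij: "i \<in> ?I" "j \<in> ?I" "i \<noteq> j"
      obtain x1 x2 where x: "x = sg_map i x1" "x = sg_map j x2" "x1 \<in> SG" "x2 \<in> SG"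
        using ij vertices_subset_SG by blast
      have x1: "x1 = corner j" using cell_overlap(1)[of i j x1 x2] ij x by simp
      show "sg_map i ` neighbours m (sg_inv i x) \<inter> sg_map j ` neighbours m (sg_inv j x) = {}"
      proof (rule ccontr)
        assume "\<not> ?thesis"
        then obtain y where "y \<in> sg_map i ` neighbours m (sg_inv i x)"
          "y \<in> sg_map j ` neighbours m (sg_inv j x)" by blast
        then obtain y1 y2 where y: "y1 \<in> neighbours m (sg_inv i x)" "y2 \<in> neighbours m (sg_inv j x)"
          "sg_map i y1 = sg_map j y2" by (metis imageE)
        then have "y1 \<in> SG" "y2 \<in> SG" "y1 \<noteq> sg_inv i x"
          using neighbours_subset vertices_subset_SG by blast+
        moreover from this have "y1 = corner j" using cell_overlap(1)[of i j y1 y2] ij y by simp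
        ultimately show False using x(1) x1 by simp
      qed
    qed
  qed simp
  also have "\<dots> = (\<Sum>k\<in>?I. \<Sum>y\<in>neighbours m (sg_inv k x). u (sg_map k y))"
    by (rule sum.cong[OF refl], subst sum.reindex) (auto simp: inj_on_def)
  also have "\<dots> = (\<Sum>k\<in>letters. if x \<in> sg_map k ` vertices m
     then (\<Sum>y\<in>neighbours m (sg_inv k x). u (sg_map k y)) else 0)"
    by (rule sum.inter_filter) simp
  finally show ?thesis .
qed

text \<open>2 and 4 are the degrees of the graph; at a junction the degrees 2 inside the two cells
  add up to 4.\<close>

lemma sum_neighbours:
  assumes "x \<in> vertices m"
  shows "(\<Sum>y\<in>neighbours m x. u y) = neumann m u x + (if x \<in> vertices 0 then 2 else 4) * u x"
  using assms
proof (induction m arbitrary: u x)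
  case 0
  have "neighbours 0 x = corner ` letters - {x}"
    using 0 vertices_subset_SG[of 0] unfolding neighbours_def cells_0 vertices_0 by auto
  moreover have "x \<in> corner ` letters" using 0 unfolding vertices_0 .
  moreover have "(\<Sum>y\<in>corner ` letters. u y) = (\<Sum>i\<in>letters. u (corner i))"
    by (subst sum.reindex) (auto simp: inj_on_def corner_eq_iff)
  ultimately show ?case using 0 by (simp add: sum_diff1)
next
  case (Suc m)
  obtain i z where z: "i \<in> letters" "z \<in> vertices m" "x = sg_map i z"
    using Suc.prems by (rule vertices_Suc_cases)
  define H where "H k = (\<Sum>y\<in>neighbours m (sg_inv k x). u (sg_map k y))" for k
  have sum: "(\<Sum>y\<in>neighbours (Suc m) x. u y) =
      (\<Sum>k\<in>letters. if sg_map i z \<in> sg_map k ` vertices m then H k else 0)"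
    using sum_neighbours_Suc[OF Suc.prems, of u] unfolding H_def z(3) .
  have H: "H i = neumann m (\<lambda>y. u (sg_map i y)) z + (if z \<in> vertices 0 then 2 else 4) * u x"
    unfolding H_def z(3) sg_inv_sg_map by (rule Suc.IH[OF z(2)])
  show ?case using z(2,1)
  proof (cases rule: vertices_cases)
    case interior
    then show ?thesis
      unfolding sum using sum_cells_at_interior[OF z(1,2)] neumann_interior[OF z(1,2), of u] H
        sg_map_not_in_vertices_0[OF z(1) _ interior] z vertices_subset_SG by auto
  next
    case fixed
    then have "x \<in> vertices 0" "z \<in> vertices 0" using z by (simp_all add: vertices_0)
    then show ?thesis
      unfolding sum using sum_cells_at_interior[OF z(1,2)] neumann_interior[OF z(1,2), of u] H fixed z
      by auto
  next
    case (junction j)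
    have x: "x = sg_map j (corner i)" using z(3) junction sg_map_corner_commute by simp
    have "H j = neumann m (\<lambda>y. u (sg_map j y)) (corner i) + (if corner i \<in> vertices 0 then 2 else 4) * u x"
      unfolding H_def x sg_inv_sg_map by (rule Suc.IH[OF corner_in_vertices[OF z(1)]])
    moreover have "corner i \<in> vertices 0" "z \<in> vertices 0"
      using z junction by (simp_all add: vertices_0)
    moreover have "x \<notin> vertices 0"
      unfolding z(3) junction(3) using sg_map_corner_not_in_vertices_0[OF z(1) junction(1)] junction(2) by blast
    ultimately show ?thesis
      unfolding sum junction(3) sum_cells_at_junction[OF z(1) junction(1,2)]
      using neumann_junction[OF z(1) junction(1,2), of m u] H junction(3) z(3) by simp
  qed
qed

lemma graph_laplacian_eq_neumann:
  assumes "x \<in> vertices m" "x \<notin> vertices 0"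
  shows "graph_laplacian m u x = neumann m u x"
  using assms by (simp add: graph_laplacian_def sum_neighbours)

section \<open>Estimates between consecutive levels\<close>

text \<open>
  The difference is \<open>(2 D + 2 D' + D'') / 3\<close>, where \<open>D\<close>, \<open>D'\<close>, \<open>D''\<close> are the values of the Laplacian at the three
  midpoints of the corner cell, \<open>D''\<close> at the one opposite the corner.
\<close>

lemma neumann_corner_refine:
  assumes "i \<in> letters" and "\<And>x. x \<in> vertices (Suc k) \<Longrightarrow> x \<notin> vertices 0 \<Longrightarrow> \<bar>neumann (Suc k) u x\<bar> \<le> \<theta>"
  shows "\<bar>neumann k u (corner i) - 5/3 * neumann (Suc k) u (corner i)\<bar> \<le> 5/3 * \<theta>"
  using assms(2)
proof (induction k arbitrary: u)
  case 0
  \<comment> \<open>A symmetric array with the corners on the diagonal and the midpoints off it. The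
    estimate becomes linear arithmetic in six values.\<close>
  define v where "v a b = u (sg_map a (corner b))" for a b
  have comm: "v b a = v a b" for a b by (simp add: v_def sg_map_corner_commute)
  have diag: "v a a = u (corner a)" for a by (simp add: v_def)
  have J: "neumann (Suc 0) u (sg_map a (corner b)) = (\<Sum>c\<in>letters. v a c) + (\<Sum>c\<in>letters. v b c) - 6 * v a b"
    if "a \<in> letters" "b \<in> letters" "b \<noteq> a" for a b
    using neumann_junction[OF that, of 0 u] by (simp add: v_def sg_map_corner_commute)
  have C: "neumann (Suc 0) u (corner a) = (\<Sum>c\<in>letters. v a c) - 3 * v a a" if "a \<in> letters" for a
    using neumann_corner[OF that, of 0 u] by (simp add: v_def)
  have b: "\<bar>(\<Sum>c\<in>letters. v a c) + (\<Sum>c\<in>letters. v b c) - 6 * v a b\<bar> \<le> \<theta>"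
    if "a \<in> letters" "b \<in> letters" "b \<noteq> a" for a b
    using 0[of "sg_map a (corner b)"] J[OF that] sg_map_in_vertices[OF that(1) corner_in_vertices[OF that(2)], of 0]
      sg_map_corner_not_in_vertices_0[OF that(1,2)] that(3) by auto
  have b': "\<bar>(\<Sum>c\<in>letters. v 1 c) + (\<Sum>c\<in>letters. v 2 c) - 6 * v 1 2\<bar> \<le> \<theta>"
    "\<bar>(\<Sum>c\<in>letters. v 1 c) + (\<Sum>c\<in>letters. v 3 c) - 6 * v 1 3\<bar> \<le> \<theta>"
    "\<bar>(\<Sum>c\<in>letters. v 2 c) + (\<Sum>c\<in>letters. v 3 c) - 6 * v 2 3\<bar> \<le> \<theta>"
    by (intro b; simp)+
  have "neumann 0 u (corner i) = (\<Sum>c\<in>letters. v c c) - 3 * v i i" by (simp add: diag)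
  moreover have "\<bar>(\<Sum>c\<in>letters. v c c) - 3 * v i i - 5/3 * ((\<Sum>c\<in>letters. v i c) - 3 * v i i)\<bar> \<le> 5/3 * \<theta>"
    using assms(1)
  proof (cases rule: letters_cases)
    case 1
    show ?thesis
      using b' unfolding 1 sum_letters comm[of 2 1] comm[of 3 1] comm[of 3 2] abs_le_iff by argo
  next
    case 2
    show ?thesis
      using b' unfolding 2 sum_letters comm[of 2 1] comm[of 3 1] comm[of 3 2] abs_le_iff by argo
  next
    case 3
    show ?thesis
      using b' unfolding 3 sum_letters comm[of 2 1] comm[of 3 1] comm[of 3 2] abs_le_iff by argo
  qed
  ultimately show ?case using C[OF assms(1)] by simp
next
  case (Suc k)
  let ?v = "\<lambda>y. u (sg_map i y)"
  have "\<bar>neumann k ?v (corner i) - 5/3 * neumann (Suc k) ?v (corner i)\<bar> \<le> 5/3 * \<theta>"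
  proof (rule Suc.IH)
    fix x assume x: "x \<in> vertices (Suc k)" "x \<notin> vertices 0"
    have "sg_map i x \<in> vertices (Suc (Suc k))" "sg_map i x \<notin> vertices 0"
      using sg_map_in_vertices sg_map_not_in_vertices_0 assms(1) x vertices_subset_SG by blast+
    then show "\<bar>neumann (Suc k) ?v x\<bar> \<le> \<theta>"
      using Suc.prems[of "sg_map i x"] neumann_interior[of i x "Suc k" u] assms(1) x by simp
  qed
  then show ?case by (simp add: neumann_corner[OF assms(1)])
qed

text \<open>At a junction \<open>neumann\<close> is the sum of two corner terms. Refining each costs
  5/3 \<theta>, and 5/3 times the finer value costs another 5/3 \<theta>; together 5 \<theta>. On
  level 0 there are no interior vertices.\<close>

lemma neumann_coarsen:
  assumes "\<And>x. x \<in> vertices (Suc k) \<Longrightarrow> x \<notin> vertices 0 \<Longrightarrow> \<bar>neumann (Suc k) u x\<bar> \<le> \<theta>"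
    and "x \<in> vertices k" "x \<notin> vertices 0"
  shows "\<bar>neumann k u x\<bar> \<le> 5 * \<theta>"
  using assms
proof (induction k arbitrary: u x)
  case (Suc k)
  have restrict: "\<bar>neumann (Suc k) (\<lambda>y. u (sg_map i y)) y\<bar> \<le> \<theta>"
    if "i \<in> letters" "y \<in> vertices (Suc k)" "y \<notin> vertices 0" for i y
  proof -
    have "sg_map i y \<in> vertices (Suc (Suc k))" "sg_map i y \<notin> vertices 0"
      using sg_map_in_vertices sg_map_not_in_vertices_0 that vertices_subset_SG by blast+
    then show ?thesis
      using Suc.prems(1)[of "sg_map i y"] neumann_interior[of i y "Suc k" u] that by simp
  qed
  obtain i z where z: "i \<in> letters" "z \<in> vertices k" "x = sg_map i z"
    using Suc.prems(2) by (rule vertices_Suc_cases)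
  from z(2,1) show ?case
  proof (cases rule: vertices_cases)
    case interior
    have "\<bar>neumann k (\<lambda>y. u (sg_map i y)) z\<bar> \<le> 5 * \<theta>"
      using restrict[OF z(1)] z(2) interior by (rule Suc.IH)
    then show ?thesis using neumann_interior[OF z(1,2), of u] interior z(3) by simp
  next
    case fixed
    then show ?thesis using Suc.prems(3) z by (simp add: vertices_0)
  next
    case (junction j)
    let ?u = "\<lambda>i y. u (sg_map i y)"
    have "\<bar>neumann k (?u i) (corner j) - 5/3 * neumann (Suc k) (?u i) (corner j)\<bar> \<le> 5/3 * \<theta>"
      "\<bar>neumann k (?u j) (corner i) - 5/3 * neumann (Suc k) (?u j) (corner i)\<bar> \<le> 5/3 * \<theta>"
      using restrict z(1) junction(1) by (intro neumann_corner_refine; simp)+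
    moreover have "neumann (Suc k) u x = neumann k (?u i) (corner j) + neumann k (?u j) (corner i)"
      "neumann (Suc (Suc k)) u x = neumann (Suc k) (?u i) (corner j) + neumann (Suc k) (?u j) (corner i)"
      unfolding z(3) junction(3) by (rule neumann_junction[OF z(1) junction(1,2)])+
    moreover have "\<bar>neumann (Suc (Suc k)) u x\<bar> \<le> \<theta>"
      using Suc.prems vertices_Suc_mono by blast
    ultimately show ?thesis by linarith
  qed
qed simp

text \<open>A maximum principle: if M is the largest of the three midpoint values of a cell, the
  equation at its point gives 4 M \<le> 2 \<beta> + 2 M + \<theta>. The same holds for the negative
  of \<open>u\<close>.\<close>

lemma neumann_step_bound:
  assumes "\<And>x. x \<in> vertices (Suc k) \<Longrightarrow> x \<notin> vertices 0 \<Longrightarrow> \<bar>neumann (Suc k) u x\<bar> \<le> \<theta>"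
    and "\<And>x. x \<in> vertices k \<Longrightarrow> \<bar>u x\<bar> \<le> \<beta>"
    and "x \<in> vertices (Suc k)" and "\<theta> \<ge> 0"
  shows "\<bar>u x\<bar> \<le> \<beta> + \<theta> / 2"
  using assms
proof (induction k arbitrary: u x)
  case 0
  define v where "v a b = u (sg_map a (corner b))" for a b
  have comm: "v b a = v a b" for a b by (simp add: v_def sg_map_corner_commute)
  have d: "\<bar>v a a\<bar> \<le> \<beta>" if "a \<in> letters" for a
    using 0(2)[of "corner a"] that by (simp add: v_def corner_in_vertices)
  have J: "neumann (Suc 0) u (sg_map a (corner b)) = (\<Sum>c\<in>letters. v a c) + (\<Sum>c\<in>letters. v b c) - 6 * v a b"
    if "a \<in> letters" "b \<in> letters" "b \<noteq> a" for a b
    using neumann_junction[OF that, of 0 u] by (simp add: v_def sg_map_corner_commute)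
  have b: "\<bar>(\<Sum>c\<in>letters. v a c) + (\<Sum>c\<in>letters. v b c) - 6 * v a b\<bar> \<le> \<theta>"
    if "a \<in> letters" "b \<in> letters" "b \<noteq> a" for a b
    using 0(1)[of "sg_map a (corner b)"] J[OF that] sg_map_in_vertices[OF that(1) corner_in_vertices[OF that(2)], of 0]
      sg_map_corner_not_in_vertices_0[OF that(1,2)] that(3) by auto
  have b': "\<bar>(\<Sum>c\<in>letters. v 1 c) + (\<Sum>c\<in>letters. v 2 c) - 6 * v 1 2\<bar> \<le> \<theta>"
    "\<bar>(\<Sum>c\<in>letters. v 1 c) + (\<Sum>c\<in>letters. v 3 c) - 6 * v 1 3\<bar> \<le> \<theta>"
    "\<bar>(\<Sum>c\<in>letters. v 2 c) + (\<Sum>c\<in>letters. v 3 c) - 6 * v 2 3\<bar> \<le> \<theta>"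
    by (intro b; simp)+
  have d': "\<bar>v 1 1\<bar> \<le> \<beta>" "\<bar>v 2 2\<bar> \<le> \<beta>" "\<bar>v 3 3\<bar> \<le> \<beta>" by (intro d; simp)+
  have m: "\<bar>v 1 2\<bar> \<le> \<beta> + \<theta> / 2 \<and> \<bar>v 1 3\<bar> \<le> \<beta> + \<theta> / 2 \<and> \<bar>v 2 3\<bar> \<le> \<beta> + \<theta> / 2"
    using b' d' unfolding sum_letters comm[of 2 1] comm[of 3 1] comm[of 3 2] abs_le_iff
    by (intro conjI; elim conjE; linarith)
  from 0(3) show ?case
  proof (rule vertices_Suc_cases)
    fix i z assume z: "i \<in> letters" "z \<in> vertices 0" "x = sg_map i z"
    then obtain j where j: "j \<in> letters" "z = corner j" unfolding vertices_0 by blast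
    have "u x = v i j" using z j by (simp add: v_def)
    moreover have "\<bar>v i j\<bar> \<le> \<beta> + \<theta> / 2"
      using z(1) j(1) m d' 0(4) comm by (elim letters_cases) (simp_all add: comm[of 2 1] comm[of 3 1] comm[of 3 2])
    ultimately show ?thesis by simp
  qed
next
  case (Suc k)
  obtain i z where z: "i \<in> letters" "z \<in> vertices (Suc k)" "x = sg_map i z"
    using Suc.prems(3) by (rule vertices_Suc_cases)
  have "\<bar>neumann (Suc k) (\<lambda>y. u (sg_map i y)) y\<bar> \<le> \<theta>"
    if "y \<in> vertices (Suc k)" "y \<notin> vertices 0" for y
  proof -
    have "sg_map i y \<in> vertices (Suc (Suc k))" "sg_map i y \<notin> vertices 0"
      using sg_map_in_vertices sg_map_not_in_vertices_0 that z(1) vertices_subset_SG by blast+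
    then show ?thesis
      using Suc.prems(1)[of "sg_map i y"] neumann_interior[of i y "Suc k" u] that z(1) by simp
  qed
  moreover have "\<bar>u (sg_map i y)\<bar> \<le> \<beta>" if "y \<in> vertices k" for y
    using that sg_map_in_vertices[OF z(1)] Suc.prems(2) by blast
  ultimately have "\<bar>u (sg_map i z)\<bar> \<le> \<beta> + \<theta> / 2"
    using z(2) Suc.prems(4) by (rule Suc.IH)
  then show ?case using z by simp
qed

section \<open>Eigenfunctions with arbitrary boundary values\<close>

text \<open>Without boundary condition, because the restriction of an eigenfunction to a cell is
  again of this kind but may take any values at the corners.\<close>

definition solutions :: "real \<Rightarrow> (point \<Rightarrow> real) set" where
  "solutions lam = {u. continuous_on SG u \<and> (\<forall>x. x \<notin> SG \<longrightarrow> u x = 0) \<and>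
     (\<forall>e>0. \<exists>N. \<forall>m\<ge>N. \<forall>x\<in>vertices m - vertices 0. \<bar>3/2 * 5 ^ m * neumann m u x + lam * u x\<bar> < e)}"

text \<open>
  The difference to the Dirichlet eigenspace is that the condition is also imposed at the boundary
  points, where it forces the normal derivative to vanish. These are the eigenfunctions that can be
  extended by zero from a cell to the whole gasket.
\<close>

definition localizable :: "real \<Rightarrow> (point \<Rightarrow> real) set" where
  "localizable lam = {u. continuous_on SG u \<and> (\<forall>x. x \<notin> SG \<longrightarrow> u x = 0) \<and> (\<forall>i\<in>letters. u (corner i) = 0) \<and>
     (\<forall>e>0. \<exists>N. \<forall>m\<ge>N. \<forall>x\<in>vertices m. \<bar>3/2 * 5 ^ m * neumann m u x + lam * u x\<bar> < e)}"

lemma solutionsD: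
  assumes "u \<in> solutions lam"
  shows "continuous_on SG u" "x \<notin> SG \<Longrightarrow> u x = 0"
    "e > 0 \<Longrightarrow> \<exists>N. \<forall>m\<ge>N. \<forall>x\<in>vertices m - vertices 0. \<bar>3/2 * 5 ^ m * neumann m u x + lam * u x\<bar> < e"
  using assms unfolding solutions_def by blast+

lemma localizableD:
  assumes "u \<in> localizable lam"
  shows "continuous_on SG u" "x \<notin> SG \<Longrightarrow> u x = 0" "i \<in> letters \<Longrightarrow> u (corner i) = 0"
    "e > 0 \<Longrightarrow> \<exists>N. \<forall>m\<ge>N. \<forall>x\<in>vertices m. \<bar>3/2 * 5 ^ m * neumann m u x + lam * u x\<bar> < e"
  using assms unfolding localizable_def by blast+

lemma has_laplacian_iff:
  "has_laplacian u (\<lambda>x. - (lam * u x)) \<longleftrightarrow> continuous_on SG u \<and>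
     (\<forall>e>0. \<exists>N. \<forall>m\<ge>N. \<forall>x\<in>vertices m - vertices 0. \<bar>3/2 * 5 ^ m * neumann m u x + lam * u x\<bar> < e)"
proof -
  have "continuous_on SG (\<lambda>x. - (lam * u x))" if "continuous_on SG u"
    using that by (intro continuous_intros)
  moreover have "\<bar>3/2 * 5 ^ m * graph_laplacian m u x - - (lam * u x)\<bar> = \<bar>3/2 * 5 ^ m * neumann m u x + lam * u x\<bar>"
    if "x \<in> vertices m - vertices 0" for m x
    using that by (simp add: graph_laplacian_eq_neumann)
  ultimately show ?thesis unfolding has_laplacian_def by (metis (no_types, lifting))
qed

text \<open>The zero function, which the eigenspace adjoins separately, satisfies the equation too,
  so the eigenspace is cut out by linear conditions alone.\<close>

lemma dirichlet_eigenspace_eq: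
  "dirichlet_eigenspace lam = {u \<in> solutions lam. \<forall>i\<in>letters. u (corner i) = 0}"
proof -
  have mem: "u \<in> {u \<in> solutions lam. \<forall>i\<in>letters. u (corner i) = 0} \<longleftrightarrow>
      has_laplacian u (\<lambda>x. - (lam * u x)) \<and> (\<forall>x. x \<notin> SG \<longrightarrow> u x = 0) \<and> (\<forall>x\<in>vertices 0. u x = 0)" for u
    unfolding has_laplacian_iff vertices_0 solutions_def by auto
  have zero: "(\<lambda>x. 0) \<in> {u \<in> solutions lam. \<forall>i\<in>letters. u (corner i) = 0}"
    by (simp add: solutions_def neumann_zero)
  show ?thesis
  proof (intro equalityI subsetI)
    fix u assume "u \<in> dirichlet_eigenspace lam"
    then consider "dirichlet_eigenfunction lam u" "\<forall>x. x \<notin> SG \<longrightarrow> u x = 0" | "u = (\<lambda>x. 0)"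
      unfolding dirichlet_eigenspace_def by blast
    then show "u \<in> {u \<in> solutions lam. \<forall>i\<in>letters. u (corner i) = 0}"
    proof cases
      case 1
      then show ?thesis unfolding mem dirichlet_eigenfunction_def by blast
    next
      case 2
      then show ?thesis using zero by (simp only:)
    qed
  next
    fix u assume "u \<in> {u \<in> solutions lam. \<forall>i\<in>letters. u (corner i) = 0}"
    then have u: "has_laplacian u (\<lambda>x. - (lam * u x))" "\<forall>x. x \<notin> SG \<longrightarrow> u x = 0" "\<forall>x\<in>vertices 0. u x = 0"
      unfolding mem by blast+
    show "u \<in> dirichlet_eigenspace lam"
    proof (cases "\<exists>x\<in>SG. u x \<noteq> 0")
      case False
      then have "u = (\<lambda>x. 0)" using u(2) by (intro ext) metis
      then show ?thesis by (simp add: dirichlet_eigenspace_def)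
    qed (use u in \<open>simp add: dirichlet_eigenspace_def dirichlet_eigenfunction_def\<close>)
  qed
qed

lemma linear_combination_eventually_small:
  fixes S :: "nat \<Rightarrow> point set"
  assumes "\<And>e. e > 0 \<Longrightarrow> \<exists>N. \<forall>m\<ge>N. \<forall>x\<in>S m. \<bar>3/2 * 5 ^ m * neumann m u x + lam * u x\<bar> < e"
    and "\<And>e. e > 0 \<Longrightarrow> \<exists>N. \<forall>m\<ge>N. \<forall>x\<in>S m. \<bar>3/2 * 5 ^ m * neumann m v x + lam * v x\<bar> < e"
    and "e > 0"
  shows "\<exists>N. \<forall>m\<ge>N. \<forall>x\<in>S m.
    \<bar>3/2 * 5 ^ m * neumann m (\<lambda>x. a * u x + b * v x) x + lam * (a * u x + b * v x)\<bar> < e"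
proof -
  define d where "d = e / (\<bar>a\<bar> + \<bar>b\<bar> + 1)"
  have d: "d > 0" using assms(3) by (simp add: d_def add_nonneg_pos)
  obtain N where N: "\<And>m x. m \<ge> N \<Longrightarrow> x \<in> S m \<Longrightarrow> \<bar>3/2 * 5 ^ m * neumann m u x + lam * u x\<bar> < d"
    using assms(1)[OF d] by blast
  obtain M where M: "\<And>m x. m \<ge> M \<Longrightarrow> x \<in> S m \<Longrightarrow> \<bar>3/2 * 5 ^ m * neumann m v x + lam * v x\<bar> < d"
    using assms(2)[OF d] by blast
  have "\<bar>3/2 * 5 ^ m * neumann m (\<lambda>x. a * u x + b * v x) x + lam * (a * u x + b * v x)\<bar> < e"
    if "m \<ge> max N M" "x \<in> S m" for m x
  proof -
    let ?U = "3/2 * 5 ^ m * neumann m u x + lam * u x" and ?V = "3/2 * 5 ^ m * neumann m v x + lam * v x"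
    have "3/2 * 5 ^ m * neumann m (\<lambda>x. a * u x + b * v x) x + lam * (a * u x + b * v x) = a * ?U + b * ?V"
      by (simp add: neumann_linear algebra_simps)
    also have "\<bar>\<dots>\<bar> \<le> \<bar>a\<bar> * \<bar>?U\<bar> + \<bar>b\<bar> * \<bar>?V\<bar>"
      using abs_triangle_ineq[of "a * ?U" "b * ?V"] by (simp only: abs_mult)
    also have "\<dots> \<le> \<bar>a\<bar> * d + \<bar>b\<bar> * d"
      using N[of m x] M[of m x] that by (intro add_mono mult_left_mono) auto
    also have "\<dots> < (\<bar>a\<bar> + \<bar>b\<bar> + 1) * d" using d by (simp add: algebra_simps)
    also have "\<dots> = e" unfolding d_def by (simp add: add_nonneg_pos add.commute)
    finally show ?thesis .
  qed
  then show ?thesis by blast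
qed

lemma solutions_linear:
  assumes u: "u \<in> solutions lam" and v: "v \<in> solutions lam"
  shows "(\<lambda>x. a * u x + b * v x) \<in> solutions lam"
proof -
  have "continuous_on SG (\<lambda>x. a * u x + b * v x)"
    using solutionsD(1)[OF u] solutionsD(1)[OF v] by (intro continuous_intros)
  moreover have "a * u x + b * v x = 0" if "x \<notin> SG" for x
    using solutionsD(2)[OF u] solutionsD(2)[OF v] that by simp
  ultimately show ?thesis
    unfolding solutions_def mem_Collect_eq
    using linear_combination_eventually_small[of "\<lambda>m. vertices m - vertices 0", OF solutionsD(3)[OF u] solutionsD(3)[OF v]]
    by blast
qed

lemma subspaceI_linear:
  assumes "V \<noteq> {}" "\<And>a b u v. u \<in> V \<Longrightarrow> v \<in> V \<Longrightarrow> (\<lambda>x. a * u x + b * v x) \<in> V"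
  shows "fun_space.subspace (V :: ('a \<Rightarrow> real) set)"
proof -
  obtain u where "u \<in> V" using assms(1) by blast
  then have "0 \<in> V" using assms(2)[of u u 0 0] by (simp add: zero_fun_def)
  moreover have "u + v \<in> V" if "u \<in> V" "v \<in> V" for u v
    using assms(2)[OF that, of 1 1] by (simp add: plus_fun_def)
  moreover have "fun_scale c u \<in> V" if "u \<in> V" for c u
    using assms(2)[OF that that, of c 0] by (simp add: fun_scale_def)
  ultimately show ?thesis unfolding fun_space.subspace_def by blast
qed

lemma subspace_dirichlet_eigenspace: "fun_space.subspace (dirichlet_eigenspace lam)"
proof (rule subspaceI_linear)
  show "dirichlet_eigenspace lam \<noteq> {}" by (auto simp: dirichlet_eigenspace_def)
  show "(\<lambda>x. a * u x + b * v x) \<in> dirichlet_eigenspace lam"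
    if "u \<in> dirichlet_eigenspace lam" "v \<in> dirichlet_eigenspace lam" for a b u v
    using that solutions_linear[of u lam v a b] by (simp add: dirichlet_eigenspace_eq)
qed

lemma localizable_subset_dirichlet: "localizable lam \<subseteq> dirichlet_eigenspace lam"
  unfolding dirichlet_eigenspace_eq localizable_def solutions_def by blast

section \<open>A priori bounds and uniqueness\<close>

lemma neumann_coarsen_iterate:
  assumes "\<And>x. x \<in> vertices (l + n) \<Longrightarrow> x \<notin> vertices 0 \<Longrightarrow> \<bar>neumann (l + n) u x\<bar> \<le> \<theta>"
    and "x \<in> vertices l" "x \<notin> vertices 0"
  shows "\<bar>neumann l u x\<bar> \<le> 5 ^ n * \<theta>"
  using assms(1)
proof (induction n arbitrary: \<theta>)
  case 0
  then show ?case using assms(2,3) by simp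
next
  case (Suc n)
  have "\<bar>neumann (l + n) u y\<bar> \<le> 5 * \<theta>" if "y \<in> vertices (l + n)" "y \<notin> vertices 0" for y
    using Suc.prems that by (intro neumann_coarsen) auto
  from Suc.IH[OF this] show ?case by simp
qed

text \<open>Passing to the limit in the coarsening estimate gets rid of the error terms.\<close>

lemma neumann_bound:
  assumes u: "u \<in> solutions lam" and B: "\<And>x. x \<in> SG \<Longrightarrow> \<bar>u x\<bar> \<le> B"
    and x: "x \<in> vertices l" "x \<notin> vertices 0"
  shows "\<bar>neumann l u x\<bar> \<le> 2/3 * (\<bar>lam\<bar> * B) / 5 ^ l"
proof (rule field_le_epsilon)
  fix e :: real assume e: "e > 0"
  obtain N where N: "\<And>m x. m \<ge> N \<Longrightarrow> x \<in> vertices m - vertices 0 \<Longrightarrow> \<bar>3/2 * 5 ^ m * neumann m u x + lam * u x\<bar> < e"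
    using solutionsD(3)[OF u e] by blast
  have "\<bar>neumann (l + N) u y\<bar> \<le> 2/3 * (\<bar>lam\<bar> * B + e) / 5 ^ (l + N)"
    if "y \<in> vertices (l + N)" "y \<notin> vertices 0" for y
  proof -
    have y: "y \<in> SG" using that vertices_subset_SG by blast
    have "\<bar>lam * u y\<bar> \<le> \<bar>lam\<bar> * B" unfolding abs_mult using B[OF y] by (intro mult_left_mono) auto
    moreover have "\<bar>3/2 * 5 ^ (l + N) * neumann (l + N) u y + lam * u y\<bar> < e"
      using that by (intro N) auto
    ultimately have "\<bar>3/2 * 5 ^ (l + N) * neumann (l + N) u y\<bar> \<le> \<bar>lam\<bar> * B + e"
      by linarith
    then have "3/2 * 5 ^ (l + N) * \<bar>neumann (l + N) u y\<bar> \<le> \<bar>lam\<bar> * B + e"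
      by (simp add: abs_mult)
    then show ?thesis by (simp add: field_simps)
  qed
  then have "\<bar>neumann l u x\<bar> \<le> 5 ^ N * (2/3 * (\<bar>lam\<bar> * B + e) / 5 ^ (l + N))"
    by (rule neumann_coarsen_iterate) (use x in auto)
  also have "\<dots> = 2/3 * (\<bar>lam\<bar> * B) / 5 ^ l + 2/3 * e / 5 ^ l"
    by (simp add: power_add field_simps)
  also have "2/3 * e / 5 ^ l \<le> e / 1" using e by (intro frac_le) auto
  finally show "\<bar>neumann l u x\<bar> \<le> 2/3 * (\<bar>lam\<bar> * B) / 5 ^ l + e" by simp
qed

lemma bound_from_vertices:
  assumes u: "continuous_on SG u" and b: "\<And>m x. x \<in> vertices m \<Longrightarrow> \<bar>u x\<bar> \<le> b" and x: "x \<in> SG"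
  shows "\<bar>u x :: real\<bar> \<le> b"
proof -
  have V: "(\<Union>m. vertices m) \<subseteq> SG" using vertices_subset_SG by blast
  then have "closure (\<Union>m. vertices m) \<subseteq> SG" using closed_SG closure_minimal by blast
  then have "continuous_on (closure (\<Union>m. vertices m)) (\<lambda>x. \<bar>u x\<bar>)"
    using u continuous_on_subset by (intro continuous_intros) blast
  then show ?thesis
    by (rule continuous_le_on_closure) (use x b SG_subset_closure_vertices in auto)
qed

text \<open>Let B be the maximum of \<bar>u\<bar>. The refinement to level m + n + 1 adds at most
  \<bar>lam\<bar> B / (3 5^(m + n + 1)); all of them together add \<bar>lam\<bar> B / (12 5^m),
  which is \<open>c\<close>. Hence B \<le> c, and the bound on \<open>lam\<close> leaves only B =
  0.\<close>

lemma solutions_eq_0_of_vertices: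
  assumes u: "u \<in> solutions lam" and 0: "\<And>x. x \<in> vertices m \<Longrightarrow> u x = 0" and m: "\<bar>lam\<bar> < 12 * 5 ^ m"
  shows "u = (\<lambda>x. 0)"
proof -
  have cont: "continuous_on SG u" by (rule solutionsD(1)[OF u])
  have "continuous_on SG (\<lambda>x. \<bar>u x\<bar>)" by (intro continuous_intros cont)
  then obtain x0 where x0: "x0 \<in> SG" "\<And>x. x \<in> SG \<Longrightarrow> \<bar>u x\<bar> \<le> \<bar>u x0\<bar>"
    using continuous_attains_sup[OF compact_SG SG_nonempty] by metis
  define B where "B = \<bar>u x0\<bar>"
  have B: "\<bar>u x\<bar> \<le> B" if "x \<in> SG" for x using x0(2)[OF that] by (simp add: B_def)
  have B0: "B \<ge> 0" by (simp add: B_def)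
  define c where "c = \<bar>lam\<bar> * B / (12 * 5 ^ m)"
  have c0: "c \<ge> 0" using B0 by (simp add: c_def)
  have level: "\<bar>u x\<bar> \<le> c * (1 - 1 / 5 ^ n)" if "x \<in> vertices (m + n)" for n x
    using that
  proof (induction n arbitrary: x)
    case 0
    then show ?case using assms(2) by simp
  next
    case (Suc n)
    have "\<bar>u x\<bar> \<le> c * (1 - 1 / 5 ^ n) + (2/3 * (\<bar>lam\<bar> * B) / 5 ^ Suc (m + n)) / 2"
      using Suc.IH Suc.prems neumann_bound[OF u B, where l = "Suc (m + n)"] B0
      by (intro neumann_step_bound[of "m + n"]) auto
    also have "\<dots> = c * (1 - 1 / 5 ^ Suc n)"
      by (simp add: c_def power_add field_simps)
    finally show ?case .
  qed
  have "\<bar>u x\<bar> \<le> c" if x: "x \<in> vertices n" for n x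
  proof -
    have "x \<in> vertices (m + n)" using x vertices_mono[of n "m + n"] by auto
    then have "\<bar>u x\<bar> \<le> c * (1 - 1 / 5 ^ n)" by (rule level)
    also have "\<dots> \<le> c * 1" using c0 by (intro mult_left_mono) auto
    finally show ?thesis by simp
  qed
  then have "B \<le> c" unfolding B_def by (rule bound_from_vertices[OF cont _ x0(1)])
  then have "B * (12 * 5 ^ m - \<bar>lam\<bar>) \<le> 0" by (simp add: c_def field_simps)
  then have "B \<le> 0" using m by (simp add: mult_le_0_iff)
  show ?thesis
  proof
    fix x show "u x = 0"
      using B[of x] \<open>B \<le> 0\<close> solutionsD(2)[OF u, of x] by (cases "x \<in> SG") auto
  qed
qed

section \<open>Restriction to cells\<close>

definition restrict_cell :: "nat list \<Rightarrow> (point \<Rightarrow> real) \<Rightarrow> point \<Rightarrow> real" where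
  "restrict_cell w u x = (if x \<in> SG then u (word_map w x) else 0)"

lemma restrict_cell_Nil: "(\<And>x. x \<notin> SG \<Longrightarrow> u x = 0) \<Longrightarrow> restrict_cell [] u = u"
  by (auto simp: restrict_cell_def fun_eq_iff)

lemma restrict_cell_Cons: "w \<in> words m \<Longrightarrow> restrict_cell (i # w) u = restrict_cell w (restrict_cell [i] u)"
  by (auto simp: restrict_cell_def fun_eq_iff word_map_in_SG)

lemma neumann_restrict_cell:
  "x \<in> vertices m \<Longrightarrow> neumann m (restrict_cell [i] u) x = neumann m (\<lambda>y. u (sg_map i y)) x"
  by (rule neumann_cong) (use vertices_subset_SG in \<open>auto simp: restrict_cell_def\<close>)

text \<open>Interior points of the cell are interior in the gasket, and passing to the cell shifts
  the level by one, so a factor 5 moves into the eigenvalue.\<close>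

lemma restrict_cell_1_in_solutions:
  assumes u: "u \<in> solutions lam" and i: "i \<in> letters"
  shows "restrict_cell [i] u \<in> solutions (lam / 5)"
  unfolding solutions_def
proof (intro CollectI conjI allI impI)
  have "continuous_on SG (restrict_cell [i] u) = continuous_on SG (\<lambda>x. u (sg_map i x))"
    by (rule continuous_on_cong) (auto simp: restrict_cell_def)
  then show "continuous_on SG (restrict_cell [i] u)"
    using continuous_on_comp_sg_map[OF solutionsD(1)[OF u] i] by simp
  show "restrict_cell [i] u x = 0" if "x \<notin> SG" for x
    using that by (simp add: restrict_cell_def)
  fix e :: real assume e: "e > 0"
  then obtain N where N: "\<And>m x. m \<ge> N \<Longrightarrow> x \<in> vertices m - vertices 0 \<Longrightarrow> \<bar>3/2 * 5 ^ m * neumann m u x + lam * u x\<bar> < 5 * e"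
    using solutionsD(3)[OF u, of "5 * e"] by auto
  have "\<bar>3/2 * 5 ^ m * neumann m (restrict_cell [i] u) x + lam / 5 * restrict_cell [i] u x\<bar> < e"
    if "m \<ge> N" and x: "x \<in> vertices m - vertices 0" for m x
  proof -
    have xSG: "x \<in> SG" using x vertices_subset_SG by blast
    have "sg_map i x \<in> vertices (Suc m) - vertices 0"
      using x sg_map_in_vertices[OF i] sg_map_not_in_vertices_0[OF i xSG] by blast
    then have "\<bar>3/2 * 5 ^ Suc m * neumann (Suc m) u (sg_map i x) + lam * u (sg_map i x)\<bar> < 5 * e"
      using N[of "Suc m" "sg_map i x"] that by simp
    moreover have "neumann (Suc m) u (sg_map i x) = neumann m (restrict_cell [i] u) x"
      using neumann_interior[OF i, of x m u] neumann_restrict_cell[of x m i u] x by simp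
    moreover have "u (sg_map i x) = restrict_cell [i] u x" using xSG by (simp add: restrict_cell_def)
    ultimately have "\<bar>5 * (3/2 * 5 ^ m * neumann m (restrict_cell [i] u) x + lam / 5 * restrict_cell [i] u x)\<bar> < 5 * e"
      by (simp add: algebra_simps)
    then show ?thesis by (simp only: abs_mult) simp
  qed
  then show "\<exists>N. \<forall>m\<ge>N. \<forall>x\<in>vertices m - vertices 0.
      \<bar>3/2 * 5 ^ m * neumann m (restrict_cell [i] u) x + lam / 5 * restrict_cell [i] u x\<bar> < e" by blast
qed

lemma restrict_cell_in_solutions:
  assumes "u \<in> solutions lam" "w \<in> words m"
  shows "restrict_cell w u \<in> solutions (lam / 5 ^ m)"
  using assms
proof (induction m arbitrary: u lam w)
  case 0
  then show ?case using restrict_cell_Nil solutionsD(2)[OF 0(1)] by (simp add: words_0)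
next
  case (Suc m)
  then obtain i v where w: "w = i # v" "i \<in> letters" "v \<in> words m" by (auto simp: words_Suc)
  have "restrict_cell v (restrict_cell [i] u) \<in> solutions (lam / 5 / 5 ^ m)"
    by (intro Suc.IH restrict_cell_1_in_solutions Suc.prems w)
  then show ?case using w by (simp add: restrict_cell_Cons)
qed

section \<open>Normal derivatives\<close>

text \<open>Telescoping; 3/2 is the sum of the geometric series with ratio 1/3.\<close>

lemma geometric_limit:
  fixes a :: "nat \<Rightarrow> real"
  assumes "\<And>k. \<bar>a k - a (Suc k)\<bar> \<le> c * (1/3) ^ k"
  shows "a \<longlonglongrightarrow> lim a" and "\<bar>a k - lim a\<bar> \<le> 3/2 * c * (1/3) ^ k"
proof -
  have "c \<ge> 0" using assms[of 0] by simp
  have tele: "\<bar>a k - a (k + n)\<bar> \<le> 3/2 * c * (1/3) ^ k * (1 - (1/3) ^ n)" for k n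
  proof (induction n)
    case (Suc n)
    have "\<bar>a k - a (k + Suc n)\<bar> \<le> \<bar>a k - a (k + n)\<bar> + \<bar>a (k + n) - a (Suc (k + n))\<bar>" by simp
    also have "\<dots> \<le> 3/2 * c * (1/3) ^ k * (1 - (1/3) ^ n) + c * (1/3) ^ (k + n)"
      by (intro add_mono Suc assms)
    also have "\<dots> = 3/2 * c * (1/3) ^ k * (1 - (1/3) ^ Suc n)"
    proof -
      have "3/2 * c * A * (1 - D) + c * (A * D) = 3/2 * c * A * (1 - 1/3 * D)" for A D
        by (simp add: field_simps)
      then show ?thesis by (simp only: power_add power_Suc)
    qed
    finally show ?case .
  qed simp
  have le: "\<bar>a k - a n\<bar> \<le> 3/2 * c * (1/3) ^ k" if "n \<ge> k" for k n
  proof -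
    have "\<bar>a k - a (k + (n - k))\<bar> \<le> 3/2 * c * (1/3) ^ k * (1 - (1/3) ^ (n - k))" by (rule tele)
    also have "\<dots> \<le> 3/2 * c * (1/3) ^ k * 1" using \<open>c \<ge> 0\<close> by (intro mult_left_mono) auto
    finally show ?thesis using that by simp
  qed
  have small: "(\<lambda>k. 3/2 * c * (1/3) ^ k) \<longlonglongrightarrow> 3/2 * c * 0" by (intro tendsto_intros) auto
  have "Cauchy a"
  proof (rule CauchyI')
    fix e :: real assume "e > 0"
    then have "eventually (\<lambda>k. 3/2 * c * (1/3) ^ k < e) sequentially"
      using order_tendstoD(2)[OF small, of e] by simp
    then obtain M where M: "\<And>k. k \<ge> M \<Longrightarrow> 3/2 * c * (1/3) ^ k < e"
      unfolding eventually_sequentially by blast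
    have "dist (a m) (a n) < e" if "m \<ge> M" "n > m" for m n
      using le[of m n] M[of m] that by (simp add: dist_real_def)
    then show "\<exists>M. \<forall>m\<ge>M. \<forall>n>m. dist (a m) (a n) < e" by blast
  qed
  then show lim: "a \<longlonglongrightarrow> lim a" by (simp add: Cauchy_convergent_iff convergent_LIMSEQ_iff)
  show "\<bar>a k - lim a\<bar> \<le> 3/2 * c * (1/3) ^ k"
  proof (rule LIMSEQ_le_const2)
    show "(\<lambda>n. \<bar>a k - a n\<bar>) \<longlonglongrightarrow> \<bar>a k - lim a\<bar>" by (intro tendsto_intros lim)
  qed (use le in blast)
qed

text \<open>The negative of the usual outward normal derivative, since \<open>neumann\<close>
  subtracts the value at the corner. The factor 5/3 is the energy renormalisation of the
  gasket.\<close>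

definition normal_derivative :: "nat \<Rightarrow> (point \<Rightarrow> real) \<Rightarrow> real" where
  "normal_derivative i u = lim (\<lambda>k. (5/3) ^ k * neumann k u (corner i))"

text \<open>Refinement changes the corner term by at most 5/3 times the bound on the interior
  Laplacian, which decays like 5^(-k); after multiplication by (5/3)^k the increments decay like
  (1/3)^k.\<close>

lemma normal_derivative:
  assumes u: "u \<in> solutions lam" and B: "\<And>x. x \<in> SG \<Longrightarrow> \<bar>u x\<bar> \<le> B" and i: "i \<in> letters"
  shows "(\<lambda>k. (5/3) ^ k * neumann k u (corner i)) \<longlonglongrightarrow> normal_derivative i u"
    and "\<bar>(5/3) ^ k * neumann k u (corner i) - normal_derivative i u\<bar> \<le> \<bar>lam\<bar> * B / 3 * (1/3) ^ k"
proof -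
  define a where "a k = (5/3) ^ k * neumann k u (corner i)" for k
  have "\<bar>a k - a (Suc k)\<bar> \<le> (2/9 * (\<bar>lam\<bar> * B)) * (1/3) ^ k" for k
  proof -
    have "\<bar>neumann k u (corner i) - 5/3 * neumann (Suc k) u (corner i)\<bar> \<le> 5/3 * (2/3 * (\<bar>lam\<bar> * B) / 5 ^ Suc k)"
      by (intro neumann_corner_refine i neumann_bound[OF u B])
    then have "(5/3) ^ k * \<bar>neumann k u (corner i) - 5/3 * neumann (Suc k) u (corner i)\<bar> \<le>
        (5/3) ^ k * (5/3 * (2/3 * (\<bar>lam\<bar> * B) / 5 ^ Suc k))" by (intro mult_left_mono) auto
    also have "\<dots> = (2/9 * (\<bar>lam\<bar> * B)) * (1/3) ^ k" by (simp add: field_simps)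
    also have "(5/3) ^ k * \<bar>neumann k u (corner i) - 5/3 * neumann (Suc k) u (corner i)\<bar> = \<bar>a k - a (Suc k)\<bar>"
    proof -
      have "a k - a (Suc k) = (5/3) ^ k * (neumann k u (corner i) - 5/3 * neumann (Suc k) u (corner i))"
        by (simp add: a_def algebra_simps)
      then show ?thesis by (simp add: abs_mult)
    qed
    finally show ?thesis .
  qed
  from geometric_limit[OF this]
  show "(\<lambda>k. (5/3) ^ k * neumann k u (corner i)) \<longlonglongrightarrow> normal_derivative i u"
    and "\<bar>(5/3) ^ k * neumann k u (corner i) - normal_derivative i u\<bar> \<le> \<bar>lam\<bar> * B / 3 * (1/3) ^ k"
    unfolding a_def normal_derivative_def by (simp_all add: field_simps)
qed

lemma normal_derivative_linear:
  assumes u: "u \<in> solutions lam" and v: "v \<in> solutions lam" and i: "i \<in> letters"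
  shows "normal_derivative i (\<lambda>x. a * u x + b * v x) = a * normal_derivative i u + b * normal_derivative i v"
proof -
  obtain B C where B: "\<And>x. x \<in> SG \<Longrightarrow> \<bar>u x\<bar> \<le> B" and C: "\<And>x. x \<in> SG \<Longrightarrow> \<bar>v x\<bar> \<le> C"
    using bounded_on_SG solutionsD(1)[OF u] solutionsD(1)[OF v] by metis
  have "(\<lambda>k. a * ((5/3) ^ k * neumann k u (corner i)) + b * ((5/3) ^ k * neumann k v (corner i)))
      \<longlonglongrightarrow> a * normal_derivative i u + b * normal_derivative i v"
    by (intro tendsto_intros normal_derivative(1)[OF u B i] normal_derivative(1)[OF v C i])
  then have "(\<lambda>k. (5/3) ^ k * neumann k (\<lambda>x. a * u x + b * v x) (corner i))
      \<longlonglongrightarrow> a * normal_derivative i u + b * normal_derivative i v"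
    by (simp add: neumann_linear algebra_simps)
  then show ?thesis unfolding normal_derivative_def by (rule limI)
qed

lemma word_map_replicate_corner: "word_map (replicate p i) (corner i) = corner i"
  by (induction p) auto

lemma replicate_in_words: "i \<in> letters \<Longrightarrow> replicate p i \<in> words p"
  by (auto simp: words_def letters_def)

lemma neumann_restrict_cell_replicate:
  assumes "i \<in> letters"
  shows "neumann k (restrict_cell (replicate p i) u) (corner i) = neumann (p + k) u (corner i)"
proof (induction p arbitrary: u)
  case 0
  show ?case
    by (rule trans[OF neumann_cong[of k _ u]])
       (use vertices_subset_SG corner_in_vertices[OF assms] in \<open>auto simp: restrict_cell_def\<close>)
next
  case (Suc p)
  have "neumann k (restrict_cell (replicate (Suc p) i) u) (corner i) =
      neumann (p + k) (restrict_cell [i] u) (corner i)"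
    using Suc.IH restrict_cell_Cons[OF replicate_in_words[OF assms], where i = i and u = u] by simp
  also have "\<dots> = neumann (Suc p + k) u (corner i)"
    using neumann_restrict_cell[OF corner_in_vertices[OF assms]] neumann_corner[OF assms] by simp
  finally show ?case .
qed

text \<open>
  The estimate for the normal derivative is applied to the cells shrinking to the corner, on which
  \<open>u\<close> is small; all terms scale in the same way.
\<close>

lemma neumann_corner_small:
  assumes u: "u \<in> solutions lam" and i: "i \<in> letters"
    and 0: "u (corner i) = 0" "normal_derivative i u = 0"
  shows "(\<lambda>m. 5 ^ m * neumann m u (corner i)) \<longlonglongrightarrow> 0"
proof (rule LIMSEQ_I)
  fix e :: real assume e: "e > 0"
  define \<eta> where "\<eta> = e / (\<bar>lam\<bar> + 1)"
  have \<eta>: "\<eta> > 0" using e by (simp add: \<eta>_def add_nonneg_pos)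
  obtain p where p: "\<And>n w x y. n \<ge> p \<Longrightarrow> w \<in> words n \<Longrightarrow> x \<in> SG \<Longrightarrow> y \<in> SG \<Longrightarrow>
      dist (u (word_map w x)) (u (word_map w y)) < \<eta>"
    using uniform_on_cells[OF solutionsD(1)[OF u] \<eta>] by metis
  define v where "v = restrict_cell (replicate p i) u"
  have v: "v \<in> solutions (lam / 5 ^ p)"
    unfolding v_def by (intro restrict_cell_in_solutions u replicate_in_words i)
  have v_le: "\<bar>v x\<bar> \<le> \<eta>" if "x \<in> SG" for x
    using p[OF order_refl replicate_in_words[OF i] that corner_in_SG[OF i]] that 0(1)
    by (simp add: v_def restrict_cell_def word_map_replicate_corner)
  have neu: "neumann k v (corner i) = neumann (p + k) u (corner i)" for k
    unfolding v_def by (rule neumann_restrict_cell_replicate[OF i])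
  obtain B where B: "\<And>x. x \<in> SG \<Longrightarrow> \<bar>u x\<bar> \<le> B" using bounded_on_SG[OF solutionsD(1)[OF u]] by blast
  have "(\<lambda>k. (5/3) ^ (k + p) * neumann (k + p) u (corner i)) \<longlonglongrightarrow> 0"
    using LIMSEQ_ignore_initial_segment[OF normal_derivative(1)[OF u B i]] 0(2) by simp
  then have "(\<lambda>k. (3/5) ^ p * ((5/3) ^ (k + p) * neumann (k + p) u (corner i))) \<longlonglongrightarrow> (3/5) ^ p * 0"
    by (rule tendsto_mult_left)
  moreover have "(3/5) ^ p * ((5/3) ^ (k + p) * neumann (k + p) u (corner i)) = (5/3) ^ k * neumann k v (corner i)" for k
    by (simp add: neu power_add power_divide add.commute)
  ultimately have "normal_derivative i v = 0"
    unfolding normal_derivative_def by (simp add: limI)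
  then have v_bound: "\<bar>(5/3) ^ k * neumann k v (corner i)\<bar> \<le> \<bar>lam / 5 ^ p\<bar> * \<eta> / 3 * (1/3) ^ k" for k
    using normal_derivative(2)[OF v v_le i, of k] by simp
  have "norm (5 ^ m * neumann m u (corner i) - 0) < e" if "m \<ge> p" for m
  proof -
    define k where "k = m - p"
    have m: "m = p + k" using that by (simp add: k_def)
    \<comment> \<open>5^m = 5^p 3^k (5/3)^k: the first factor is absorbed by the eigenvalue
      \<open>lam / 5 ^ p\<close> of \<open>v\<close>, the second by the rate (1/3)^k, and
      \<open>\<eta>\<close> survives.\<close>
    have "norm (5 ^ m * neumann m u (corner i) - 0) = 5 ^ p * 3 ^ k * \<bar>(5/3) ^ k * neumann k v (corner i)\<bar>"
      by (simp add: m neu abs_mult power_add power_divide)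
    also have "\<dots> \<le> 5 ^ p * 3 ^ k * (\<bar>lam / 5 ^ p\<bar> * \<eta> / 3 * (1/3) ^ k)"
      by (intro mult_left_mono v_bound) auto
    also have "\<dots> = \<bar>lam\<bar> * \<eta> / 3" by (simp add: power_divide abs_divide)
    also have "\<dots> \<le> \<bar>lam\<bar> * \<eta>" using \<eta> by simp
    also have "\<dots> < (\<bar>lam\<bar> + 1) * \<eta>" using \<eta> by (simp add: algebra_simps)
    also have "\<dots> = e" unfolding \<eta>_def by (simp add: add_nonneg_pos add.commute)
    finally show ?thesis .
  qed
  then show "\<exists>N. \<forall>m\<ge>N. norm (5 ^ m * neumann m u (corner i) - 0) < e" by blast
qed

lemma localizableI:
  assumes u: "u \<in> solutions lam"
    and 0: "\<And>i. i \<in> letters \<Longrightarrow> u (corner i) = 0" "\<And>i. i \<in> letters \<Longrightarrow> normal_derivative i u = 0"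
  shows "u \<in> localizable lam"
  unfolding localizable_def
proof (intro CollectI conjI allI impI)
  show "continuous_on SG u" by (rule solutionsD(1)[OF u])
  show "u x = 0" if "x \<notin> SG" for x by (rule solutionsD(2)[OF u that])
  show "\<forall>i\<in>letters. u (corner i) = 0" using 0(1) by blast
  fix e :: real assume e: "e > 0"
  have "eventually (\<lambda>m. \<forall>x\<in>vertices m - vertices 0. \<bar>3/2 * 5 ^ m * neumann m u x + lam * u x\<bar> < e) sequentially"
    using solutionsD(3)[OF u e] unfolding eventually_sequentially .
  moreover have "eventually (\<lambda>m. \<forall>i\<in>letters. \<bar>3/2 * (5 ^ m * neumann m u (corner i))\<bar> < e) sequentially"
  proof (rule eventually_ball_finite[OF finite_letters], rule ballI)
    fix i assume i: "i \<in> letters"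
    have "(\<lambda>m. \<bar>3/2 * (5 ^ m * neumann m u (corner i))\<bar>) \<longlonglongrightarrow> \<bar>3/2 * 0\<bar>"
      by (intro tendsto_intros neumann_corner_small[OF u i 0(1)[OF i] 0(2)[OF i]])
    then show "eventually (\<lambda>m. \<bar>3/2 * (5 ^ m * neumann m u (corner i))\<bar> < e) sequentially"
      using e by (intro order_tendstoD(2)) auto
  qed
  ultimately have "eventually (\<lambda>m. \<forall>x\<in>vertices m. \<bar>3/2 * 5 ^ m * neumann m u x + lam * u x\<bar> < e) sequentially"
  proof eventually_elim
    case (elim m)
    show ?case
    proof
      fix x assume x: "x \<in> vertices m"
      show "\<bar>3/2 * 5 ^ m * neumann m u x + lam * u x\<bar> < e"
      proof (cases "x \<in> vertices 0")
        case True
        then obtain i where "i \<in> letters" "x = corner i" unfolding vertices_0 by blast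
        then show ?thesis using elim(2) 0(1) by (simp add: mult.assoc)
      qed (use elim(1) x in blast)
    qed
  qed
  then show "\<exists>N. \<forall>m\<ge>N. \<forall>x\<in>vertices m. \<bar>3/2 * 5 ^ m * neumann m u x + lam * u x\<bar> < e"
    unfolding eventually_sequentially .
qed

section \<open>Gluing and extension by zero\<close>

text \<open>\<open>SOME\<close> picks a cell containing \<open>x\<close>. Corner \<open>j\<close> of
  cell \<open>i\<close> and corner \<open>i\<close> of cell \<open>j\<close> are the same point, so
  for a \<open>compatible\<close> family the choice does not matter.\<close>

definition glue :: "(nat \<Rightarrow> point \<Rightarrow> real) \<Rightarrow> point \<Rightarrow> real" where
  "glue g x = (if x \<in> SG then g (SOME i. i \<in> letters \<and> sg_inv i x \<in> SG)
     (sg_inv (SOME i. i \<in> letters \<and> sg_inv i x \<in> SG) x) else 0)"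

definition compatible :: "(nat \<Rightarrow> point \<Rightarrow> real) \<Rightarrow> bool" where
  "compatible g \<longleftrightarrow> (\<forall>i\<in>letters. \<forall>j\<in>letters. g i (corner j) = g j (corner i))"

lemma glue_sg_map:
  assumes g: "compatible g" and i: "i \<in> letters" and x: "x \<in> SG"
  shows "glue g (sg_map i x) = g i x"
proof -
  define k where "k = (SOME k. k \<in> letters \<and> sg_inv k (sg_map i x) \<in> SG)"
  have "k \<in> letters \<and> sg_inv k (sg_map i x) \<in> SG"
    unfolding k_def by (rule someI[of _ i]) (use i x in simp)
  then have k: "k \<in> letters" "sg_inv k (sg_map i x) \<in> SG" by blast+
  have eq: "glue g (sg_map i x) = g k (sg_inv k (sg_map i x))"
    unfolding glue_def k_def using sg_map_in_SG[OF i x] by simp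
  show ?thesis
  proof (cases "k = i")
    case False
    have "sg_map i x = sg_map k (sg_inv k (sg_map i x))" by simp
    then have "x = corner k" "sg_inv k (sg_map i x) = corner i"
      using cell_overlap[OF i k(1) _ x k(2)] False by blast+
    then show ?thesis unfolding eq using g i k(1) by (simp add: compatible_def)
  qed (use eq in simp)
qed

lemma continuous_on_glue:
  assumes g: "compatible g" and cont: "\<And>i. i \<in> letters \<Longrightarrow> continuous_on SG (g i)"
  shows "continuous_on SG (glue g)"
proof -
  have "continuous_on (\<Union>i\<in>letters. sg_map i ` SG) (glue g)"
  proof (rule continuous_on_closed_Union)
    fix i assume i: "i \<in> letters"
    show "closed (sg_map i ` SG)"
      by (intro compact_imp_closed compact_continuous_image continuous_on_sg_map compact_SG)
    have "continuous_on (sg_map i ` SG) (\<lambda>x. g i (sg_inv i x))"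
      by (rule continuous_on_compose2[OF cont[OF i] continuous_on_sg_inv]) auto
    then show "continuous_on (sg_map i ` SG) (glue g)"
      by (rule continuous_on_eq) (auto simp: glue_sg_map[OF g i])
  qed simp
  then show ?thesis using SG_self_similar by (simp add: hutchinson_def)
qed

lemma glue_outside: "x \<notin> SG \<Longrightarrow> glue g x = 0"
  by (simp add: glue_def)

lemma neumann_glue:
  assumes g: "compatible g" and i: "i \<in> letters" and x: "x \<in> vertices m"
  shows "neumann m (\<lambda>y. glue g (sg_map i y)) x = neumann m (g i) x"
  by (rule neumann_cong[OF _ x], rule glue_sg_map[OF g i]) (use vertices_subset_SG in blast)

lemma neumann_glue_junction:
  assumes "compatible g" "i \<in> letters" "j \<in> letters" "j \<noteq> i"
  shows "neumann (Suc m) (glue g) (sg_map i (corner j)) = neumann m (g i) (corner j) + neumann m (g j) (corner i)"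
  unfolding neumann_junction[OF assms(2-4)]
  using assms neumann_glue corner_in_vertices by simp

lemma neumann_glue_interior:
  assumes "compatible g" "i \<in> letters" "z \<in> vertices m" "z \<notin> vertices 0 \<or> z = corner i"
  shows "neumann (Suc m) (glue g) (sg_map i z) = neumann m (g i) z"
  unfolding neumann_interior[OF assms(2-4)] using assms neumann_glue by simp

section \<open>Transplantation into a cell\<close>

definition transplant1 :: "nat \<Rightarrow> (point \<Rightarrow> real) \<Rightarrow> point \<Rightarrow> real" where
  "transplant1 i v = glue (\<lambda>k. if k = i then v else (\<lambda>_. 0))"

primrec transplant :: "nat list \<Rightarrow> (point \<Rightarrow> real) \<Rightarrow> point \<Rightarrow> real" where
  "transplant [] v = v"
| "transplant (i # w) v = transplant1 i (transplant w v)"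

lemma compatible_transplant1:
  "v \<in> localizable mu \<Longrightarrow> compatible (\<lambda>k. if k = i then v else (\<lambda>_. 0))"
  by (simp add: compatible_def localizableD(3))

lemma transplant1_sg_map:
  assumes "v \<in> localizable mu" "k \<in> letters" "x \<in> SG"
  shows "transplant1 i v (sg_map k x) = (if k = i then v x else 0)"
  unfolding transplant1_def
  using glue_sg_map[OF compatible_transplant1[OF assms(1)] assms(2,3), of i] by simp

text \<open>This is where the equation at the corners matters: at a junction the neighbouring cell
  carries 0 and contributes nothing to \<open>neumann\<close>, so the contribution of cell
  \<open>i\<close> has to satisfy the equation alone.\<close>

lemma transplant1_in_localizable:
  assumes v: "v \<in> localizable mu" and i: "i \<in> letters"
  shows "transplant1 i v \<in> localizable (5 * mu)"
  unfolding localizable_def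
proof (intro CollectI conjI allI impI ballI)
  define g where "g k = (if k = i then v else (\<lambda>_. 0))" for k
  have g: "compatible g" unfolding g_def by (rule compatible_transplant1[OF v])
  have T: "transplant1 i v = glue g" by (simp add: transplant1_def g_def[abs_def])
  show "continuous_on SG (transplant1 i v)"
    unfolding T by (rule continuous_on_glue[OF g]) (use localizableD(1)[OF v] in \<open>simp add: g_def\<close>)
  show "transplant1 i v x = 0" if "x \<notin> SG" for x using that by (simp add: T glue_outside)
  show "transplant1 i v (corner k) = 0" if k: "k \<in> letters" for k
    using transplant1_sg_map[OF v k corner_in_SG[OF k], of i] localizableD(3)[OF v k]
    unfolding sg_map_corner by metis
  fix e :: real assume e: "e > 0"
  then obtain N where N: "\<And>m x. m \<ge> N \<Longrightarrow> x \<in> vertices m \<Longrightarrow> \<bar>3/2 * 5 ^ m * neumann m v x + mu * v x\<bar> < e / 5"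
    using localizableD(4)[OF v, of "e / 5"] by auto
  have "\<bar>3/2 * 5 ^ Suc m * neumann (Suc m) (glue g) x + 5 * mu * glue g x\<bar> < e"
    if m: "m \<ge> N" and x: "x \<in> vertices (Suc m)" for m x
  proof -
    have "(if x \<in> sg_map k ` vertices m then neumann m (\<lambda>y. glue g (sg_map k y)) (sg_inv k x) else 0) =
      (if k = i then if x \<in> sg_map i ` vertices m then neumann m v (sg_inv i x) else 0 else 0)"
      if k: "k \<in> letters" for k
    proof (cases "x \<in> sg_map k ` vertices m")
      case True
      then have "neumann m (\<lambda>y. glue g (sg_map k y)) (sg_inv k x) = neumann m (g k) (sg_inv k x)"
        by (intro neumann_glue g k) auto
      then show ?thesis using True by (cases "k = i") (simp_all add: g_def neumann_zero)
    qed auto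
    then have "neumann (Suc m) (glue g) x =
      (\<Sum>k\<in>letters. if k = i then if x \<in> sg_map i ` vertices m then neumann m v (sg_inv i x) else 0 else 0)"
      unfolding neumann.simps(2) by (intro sum.cong refl)
    then have neu: "neumann (Suc m) (glue g) x = (if x \<in> sg_map i ` vertices m then neumann m v (sg_inv i x) else 0)"
      using i by simp
    show ?thesis
    proof (cases "x \<in> sg_map i ` vertices m")
      case True
      then obtain z where z: "z \<in> vertices m" "x = sg_map i z" by blast
      have "glue g x = v z"
        using glue_sg_map[OF g i, of z] z vertices_subset_SG by (auto simp: g_def)
      moreover have "neumann (Suc m) (glue g) x = neumann m v z" using neu True z by simp
      ultimately have "3/2 * 5 ^ Suc m * neumann (Suc m) (glue g) x + 5 * mu * glue g x =
          5 * (3/2 * 5 ^ m * neumann m v z + mu * v z)" by (simp add: algebra_simps)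
      then have "\<bar>3/2 * 5 ^ Suc m * neumann (Suc m) (glue g) x + 5 * mu * glue g x\<bar> =
          5 * \<bar>3/2 * 5 ^ m * neumann m v z + mu * v z\<bar>" by (simp only: abs_mult abs_numeral)
      also have "\<dots> < 5 * (e / 5)" using N[OF m z(1)] by (rule mult_strict_left_mono) simp
      finally show ?thesis by simp
    next
      case False
      obtain k z where z: "k \<in> letters" "z \<in> vertices m" "x = sg_map k z"
        using x by (rule vertices_Suc_cases)
      then have "k \<noteq> i" using False by blast
      then have "glue g x = 0"
        using glue_sg_map[OF g z(1), of z] z vertices_subset_SG by (auto simp: g_def)
      then show ?thesis using neu False e by simp
    qed
  qed
  then have "\<bar>3/2 * 5 ^ m * neumann m (glue g) x + 5 * mu * glue g x\<bar> < e"
    if "m \<ge> Suc N" "x \<in> vertices m" for m x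
    using that by (cases m) auto
  then show "\<exists>N. \<forall>m\<ge>N. \<forall>x\<in>vertices m. \<bar>3/2 * 5 ^ m * neumann m (transplant1 i v) x + 5 * mu * transplant1 i v x\<bar> < e"
    unfolding T by blast
qed

lemma transplant_in_localizable:
  assumes "v \<in> localizable (lam / 5 ^ m)" "w \<in> words m"
  shows "transplant w v \<in> localizable lam"
  using assms
proof (induction m arbitrary: lam w)
  case (Suc m)
  then obtain i u where w: "w = i # u" "i \<in> letters" "u \<in> words m" by (auto simp: words_Suc)
  have "transplant u v \<in> localizable (lam / 5)"
    using Suc.prems(1) w(3) by (intro Suc.IH) (simp_all add: field_simps)
  from transplant1_in_localizable[OF this w(2)] show ?case by (simp add: w)
qed (simp add: words_0)

lemma transplant_word_map:
  assumes "v \<in> localizable mu" "w \<in> words m" "w' \<in> words m" "x \<in> SG"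
  shows "transplant w v (word_map w' x) = (if w' = w then v x else 0)"
  using assms
proof (induction m arbitrary: w w')
  case (Suc m)
  obtain i u where w: "w = i # u" "i \<in> letters" "u \<in> words m" using Suc.prems(2) by (auto simp: words_Suc)
  obtain k u' where w': "w' = k # u'" "k \<in> letters" "u' \<in> words m" using Suc.prems(3) by (auto simp: words_Suc)
  have "transplant u v \<in> localizable (5 ^ m * mu)"
    using Suc.prems(1) w(3) by (intro transplant_in_localizable) auto
  then have "transplant w v (word_map w' x) = (if k = i then transplant u v (word_map u' x) else 0)"
    using w w' transplant1_sg_map word_map_in_SG[OF w'(3) Suc.prems(4)] by simp
  also have "\<dots> = (if k = i then if u' = u then v x else 0 else 0)"
    unfolding Suc.IH[OF Suc.prems(1) w(3) w'(3) Suc.prems(4)] ..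
  finally show ?case unfolding w(1) w'(1) by simp
qed (simp add: words_0)

section \<open>Dimensions of the eigenspaces\<close>

text \<open>Each functional costs at most one more spanning element, a vector on which it does not
  vanish. Working with spanning sets makes finite dimension a conclusion.\<close>

lemma subset_span_of_functionals:
  fixes V :: "('a \<Rightarrow> real) set" and \<phi> :: "'j \<Rightarrow> ('a \<Rightarrow> real) \<Rightarrow> real"
  assumes "finite J" "finite B"
    and "\<And>a b u v. u \<in> V \<Longrightarrow> v \<in> V \<Longrightarrow> (\<lambda>x. a * u x + b * v x) \<in> V"
    and "\<And>j a b u v. j \<in> J \<Longrightarrow> u \<in> V \<Longrightarrow> v \<in> V \<Longrightarrow> \<phi> j (\<lambda>x. a * u x + b * v x) = a * \<phi> j u + b * \<phi> j v"
    and "{u \<in> V. \<forall>j\<in>J. \<phi> j u = 0} \<subseteq> fun_space.span B"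
  shows "\<exists>C. finite C \<and> card C \<le> card B + card J \<and> V \<subseteq> fun_space.span C"
  using assms
proof (induction J arbitrary: V rule: finite_induct)
  case empty
  then show ?case by auto
next
  case (insert j J)
  define W where "W = {u \<in> V. \<phi> j u = 0}"
  have "\<exists>C. finite C \<and> card C \<le> card B + card J \<and> W \<subseteq> fun_space.span C"
  proof (rule insert.IH)
    show "{u \<in> W. \<forall>j\<in>J. \<phi> j u = 0} \<subseteq> fun_space.span B"
      using insert.prems(4) unfolding W_def by blast
    show "(\<lambda>x. a * u x + b * v x) \<in> W" if "u \<in> W" "v \<in> W" for a b u v
      using that insert.prems(2,3) unfolding W_def by simp
    show "\<phi> k (\<lambda>x. a * u x + b * v x) = a * \<phi> k u + b * \<phi> k v" if "k \<in> J" "u \<in> W" "v \<in> W" for k a b u v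
      using that insert.prems(3) unfolding W_def by simp
  qed (rule insert.prems(1))
  then obtain C where C: "finite C" "card C \<le> card B + card J" "W \<subseteq> fun_space.span C" by blast
  show ?case
  proof (cases "W = V")
    case True
    then show ?thesis using C insert.hyps by (intro exI[of _ C]) auto
  next
    case False
    then obtain e where e: "e \<in> V" "\<phi> j e \<noteq> 0" unfolding W_def by blast
    have "V \<subseteq> fun_space.span (insert e C)"
    proof
      fix u assume u: "u \<in> V"
      define c where "c = \<phi> j u / \<phi> j e"
      have "(\<lambda>x. 1 * u x + (- c) * e x) \<in> W"
        unfolding W_def mem_Collect_eq
      proof
        show "(\<lambda>x. 1 * u x + (- c) * e x) \<in> V" by (rule insert.prems(2)[OF u e(1)])
        show "\<phi> j (\<lambda>x. 1 * u x + (- c) * e x) = 0"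
          using insert.prems(3)[OF insertI1 u e(1), of 1 "- c"] e(2) by (simp add: c_def)
      qed
      then have "(\<lambda>x. 1 * u x + (- c) * e x) \<in> fun_space.span (insert e C)"
        using C(3) fun_space.span_mono[of C "insert e C"] by blast
      moreover have "fun_scale c e \<in> fun_space.span (insert e C)"
        by (intro fun_space.span_scale fun_space.span_base) simp
      ultimately have "(\<lambda>x. 1 * u x + (- c) * e x) + fun_scale c e \<in> fun_space.span (insert e C)"
        by (rule fun_space.span_add)
      moreover have "(\<lambda>x. 1 * u x + (- c) * e x) + fun_scale c e = u"
        by (simp add: fun_eq_iff fun_scale_def)
      ultimately show "u \<in> fun_space.span (insert e C)" by simp
    qed
    moreover have "card (insert e C) \<le> card B + card (insert j J)"
      using C(1,2) insert.hyps by (simp add: card_insert_if)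
    ultimately show ?thesis using C(1) by blast
  qed
qed

lemma basis_of_finite_span:
  assumes "V \<subseteq> fun_space.span (C :: ('a \<Rightarrow> real) set)" "finite C"
  obtains B where "B \<subseteq> V" "fun_space.independent B" "V \<subseteq> fun_space.span B"
    "finite B" "card B = fun_space.dim V" "card B \<le> card C"
proof -
  obtain B where B: "B \<subseteq> V" "fun_space.independent B" "V \<subseteq> fun_space.span B" "card B = fun_space.dim V"
    using fun_space.basis_exists by blast
  moreover have "finite B \<and> card B \<le> card C"
    using assms B by (intro fun_space.independent_span_bound) auto
  ultimately show ?thesis using that by blast
qed

lemma sum_apply: "(\<Sum>a\<in>A. F a) x = (\<Sum>a\<in>A. F a x :: 'b :: comm_monoid_add)"
  by (induction A rule: infinite_finite_induct) simp_all

lemma fun_sum_apply: "(\<Sum>b\<in>B. fun_scale (a b) (h b)) x = (\<Sum>b\<in>B. a b * h b x)"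
  by (simp add: sum_apply fun_scale_def)

lemma dirichlet_eigenspace_linear:
  assumes "u \<in> dirichlet_eigenspace lam" "v \<in> dirichlet_eigenspace lam"
  shows "(\<lambda>x. a * u x + b * v x) \<in> dirichlet_eigenspace lam"
  using assms solutions_linear[of u lam v a b] by (simp add: dirichlet_eigenspace_eq)

text \<open>An eigenfunction is determined by its values on one vertex set of sufficiently high
  level; the functionals are these evaluations.\<close>

lemma dirichlet_eigenspace_finite_span:
  obtains C where "finite C" "dirichlet_eigenspace lam \<subseteq> fun_space.span C"
proof -
  obtain m where "\<bar>lam\<bar> < 5 ^ m" using real_arch_pow[of 5 "\<bar>lam\<bar>"] by auto
  moreover have "(5::real) ^ m \<le> 12 * 5 ^ m" by simp
  ultimately have m: "\<bar>lam\<bar> < 12 * 5 ^ m" by linarith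
  have "{u \<in> dirichlet_eigenspace lam. \<forall>x\<in>vertices m. u x = 0} \<subseteq> fun_space.span {}"
    using solutions_eq_0_of_vertices[OF _ _ m] by (auto simp: dirichlet_eigenspace_eq zero_fun_def)
  then have "\<exists>C. finite C \<and> card C \<le> card ({} :: (point \<Rightarrow> real) set) + card (vertices m) \<and>
      dirichlet_eigenspace lam \<subseteq> fun_space.span C"
    by (intro subset_span_of_functionals[where \<phi> = "\<lambda>x u. u x"] finite_vertices dirichlet_eigenspace_linear) auto
  then show ?thesis using that by blast
qed

lemma localizable_basis:
  obtains C where "C \<subseteq> localizable lam" "fun_space.independent C" "localizable lam \<subseteq> fun_space.span C"
    "finite C" "card C = fun_space.dim (localizable lam)"
proof -
  obtain D where "finite D" "dirichlet_eigenspace lam \<subseteq> fun_space.span D"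
    by (rule dirichlet_eigenspace_finite_span)
  then have "localizable lam \<subseteq> fun_space.span D" using localizable_subset_dirichlet by blast
  then show ?thesis using \<open>finite D\<close> that by (rule basis_of_finite_span)
qed

text \<open>Transplants into different cells are separated by evaluation: on the
  \<open>w\<close>-cell only the coefficients with first index \<open>w\<close> remain, and there
  the independence of \<open>C\<close> applies.\<close>

lemma transplanted_basis:
  assumes C: "C \<subseteq> localizable (lam / 5 ^ N)" "fun_space.independent C" "finite C"
    and W: "W \<subseteq> words N"
  shows "(\<lambda>(w, c). transplant w c) ` (W \<times> C) \<subseteq> dirichlet_eigenspace lam"
    "fun_space.independent ((\<lambda>(w, c). transplant w c) ` (W \<times> C))"
    "card ((\<lambda>(w, c). transplant w c) ` (W \<times> C)) = card W * card C"
proof -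
  let ?\<tau> = "\<lambda>(w, c). transplant w c"
  have finW: "finite W" using W finite_words finite_subset by blast
  have sub: "transplant w c \<in> localizable lam" if "w \<in> W" "c \<in> C" for w c
    using that W C(1) by (intro transplant_in_localizable[of _ _ N]) auto
  then show "?\<tau> ` (W \<times> C) \<subseteq> dirichlet_eigenspace lam"
    using localizable_subset_dirichlet by auto
  have ap: "transplant w c (word_map w' x) = (if w' = w then c x else 0)"
    if "w \<in> W" "w' \<in> W" "c \<in> C" "x \<in> SG" for w w' c x
    using that W C(1) by (intro transplant_word_map[of _ "lam / 5 ^ N" _ N]) auto
  have off: "c x = 0" if "c \<in> C" "x \<notin> SG" for c x
    using that C(1) localizableD(2) by blast
  have nz: "\<exists>x\<in>SG. c x \<noteq> 0" if "c \<in> C" for c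
  proof (rule ccontr)
    assume "\<not> ?thesis"
    then have "c = 0" using off[OF that] by (auto simp: fun_eq_iff)
    then show False using that C(2) fun_space.dependent_zero by blast
  qed
  have inj: "inj_on ?\<tau> (W \<times> C)"
  proof (rule inj_onI, clarify)
    fix w c w' c' assume *: "w \<in> W" "c \<in> C" "w' \<in> W" "c' \<in> C" and eq: "transplant w c = transplant w' c'"
    have "w = w'"
    proof (rule ccontr)
      assume ne: "w \<noteq> w'"
      obtain x where "x \<in> SG" "c x \<noteq> 0" using nz * by blast
      then show False using ap[of w w c x] ap[of w' w c' x] ne * eq by simp
    qed
    moreover have "c = c'"
    proof
      fix x show "c x = c' x"
        using ap[of w w c x] ap[of w w c' x] off[of c x] off[of c' x] * eq \<open>w = w'\<close> by (cases "x \<in> SG") auto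
    qed
    ultimately show "w = w' \<and> c = c'" by simp
  qed
  show "card (?\<tau> ` (W \<times> C)) = card W * card C"
    by (simp add: card_image[OF inj] card_cartesian_product)
  have fin: "finite (?\<tau> ` (W \<times> C))" using finW C(3) by simp
  have "a b = 0" if zero: "(\<Sum>b\<in>?\<tau> ` (W \<times> C). fun_scale (a b) b) = 0" and b: "b \<in> ?\<tau> ` (W \<times> C)" for a b
  proof -
    obtain w c where wc: "w \<in> W" "c \<in> C" "b = transplant w c" using b by auto
    have sum: "(\<Sum>p\<in>W \<times> C. fun_scale (a (?\<tau> p)) (?\<tau> p)) = 0"
      using zero by (simp add: sum.reindex[OF inj])
    have "(\<Sum>c\<in>C. fun_scale (a (transplant w c)) c) = 0"
    proof
      fix x
      show "(\<Sum>c\<in>C. fun_scale (a (transplant w c)) c) x = 0 x"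
      proof (cases "x \<in> SG")
        case True
        have "0 = (\<Sum>p\<in>W \<times> C. fun_scale (a (?\<tau> p)) (?\<tau> p)) (word_map w x)" using sum by simp
        also have "\<dots> = (\<Sum>w'\<in>W. \<Sum>c\<in>C. a (transplant w' c) * transplant w' c (word_map w x))"
          unfolding fun_sum_apply sum.cartesian_product by (simp add: case_prod_unfold)
        also have "\<dots> = (\<Sum>w'\<in>W. if w' = w then \<Sum>c\<in>C. a (transplant w c) * c x else 0)"
          using ap[OF _ wc(1) _ True] by (intro sum.cong) auto
        also have "\<dots> = (\<Sum>c\<in>C. a (transplant w c) * c x)" using wc(1) finW by simp
        finally show ?thesis by (simp add: fun_sum_apply)
      qed (simp add: fun_sum_apply off)
    qed
    then show ?thesis
      using fun_space.independentD[OF C(2,3) order_refl, of "\<lambda>c. a (transplant w c)" c] wc by simp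
  qed
  then show "fun_space.independent (?\<tau> ` (W \<times> C))"
    unfolding fun_space.dependent_finite[OF fin] by blast
qed

text \<open>Stated for an arbitrary independent family, since it serves both for a basis and for a
  single function.\<close>

lemma dim_dirichlet_ge:
  assumes C: "C \<subseteq> localizable (lam / 5 ^ N)" "fun_space.independent C" "finite C"
  shows "3 ^ N * card C \<le> fun_space.dim (dirichlet_eigenspace lam)"
proof -
  obtain D where D: "finite D" "dirichlet_eigenspace lam \<subseteq> fun_space.span D"
    by (rule dirichlet_eigenspace_finite_span)
  obtain B where B: "dirichlet_eigenspace lam \<subseteq> fun_space.span B" "finite B"
      "card B = fun_space.dim (dirichlet_eigenspace lam)"
    by (rule basis_of_finite_span[OF D(2,1)]) (rule that)
  let ?T = "(\<lambda>(w, c). transplant w c) ` (words N \<times> C)"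
  have "?T \<subseteq> fun_space.span B"
    using transplanted_basis(1)[OF C order_refl] B(1) by blast
  then have "card ?T \<le> card B"
    using fun_space.independent_span_bound[OF B(2) transplanted_basis(2)[OF C order_refl]] by blast
  then show ?thesis using transplanted_basis(3)[OF C order_refl] B(3) by (simp add: card_words)
qed

text \<open>6 is three corners times two kinds of conditions, value and normal derivative. A
  function satisfying them on every cell is localizable there, hence a combination of
  transplants.\<close>

lemma dim_dirichlet_le:
  "fun_space.dim (dirichlet_eigenspace lam) \<le> 3 ^ N * fun_space.dim (localizable (lam / 5 ^ N)) + 6 * 3 ^ N"
proof -
  obtain C where C: "C \<subseteq> localizable (lam / 5 ^ N)" "fun_space.independent C"
      "localizable (lam / 5 ^ N) \<subseteq> fun_space.span C" "finite C"
      "card C = fun_space.dim (localizable (lam / 5 ^ N))"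
    by (rule localizable_basis)
  let ?E = "dirichlet_eigenspace lam"
  let ?T = "(\<lambda>(w, c). transplant w c) ` (words N \<times> C)"
  define J where "J = words N \<times> letters \<times> (UNIV :: bool set)"
  define \<phi> where "\<phi> = (\<lambda>(w, i, b) u. if b then restrict_cell w u (corner i)
    else normal_derivative i (restrict_cell w u))"
  have res: "restrict_cell w u \<in> solutions (lam / 5 ^ N)" if "u \<in> ?E" "w \<in> words N" for u w
    using that by (intro restrict_cell_in_solutions) (auto simp: dirichlet_eigenspace_eq)
  have res_linear: "restrict_cell w (\<lambda>x. a * u x + b * v x) = (\<lambda>x. a * restrict_cell w u x + b * restrict_cell w v x)" for w a b u v
    by (auto simp: restrict_cell_def)
  have "{u \<in> ?E. \<forall>j\<in>J. \<phi> j u = 0} \<subseteq> fun_space.span ?T"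
  proof clarify
    fix u assume u: "u \<in> ?E" and zero: "\<forall>j\<in>J. \<phi> j u = 0"
    have "restrict_cell w u \<in> fun_space.span C" if w: "w \<in> words N" for w
    proof -
      have "restrict_cell w u \<in> localizable (lam / 5 ^ N)"
      proof (rule localizableI[OF res[OF u w]])
        fix i assume i: "i \<in> letters"
        show "restrict_cell w u (corner i) = 0"
          using bspec[OF zero, of "(w, i, True)"] w i by (simp add: J_def \<phi>_def)
        show "normal_derivative i (restrict_cell w u) = 0"
          using bspec[OF zero, of "(w, i, False)"] w i by (simp add: J_def \<phi>_def)
      qed
      then show ?thesis using C(3) by blast
    qed
    then have "\<exists>a. restrict_cell w u = (\<Sum>c\<in>C. fun_scale (a c) c)" if "w \<in> words N" for w
      using that unfolding fun_space.span_finite[OF C(4)] by blast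
    then obtain a where a: "\<And>w. w \<in> words N \<Longrightarrow> restrict_cell w u = (\<Sum>c\<in>C. fun_scale (a w c) c)"
      by metis
    have "u = (\<Sum>w\<in>words N. \<Sum>c\<in>C. fun_scale (a w c) (transplant w c))"
    proof
      fix x
      have sum_apply: "(\<Sum>w\<in>words N. \<Sum>c\<in>C. fun_scale (a w c) (transplant w c)) x =
          (\<Sum>w\<in>words N. \<Sum>c\<in>C. a w c * transplant w c x)"
        by (simp add: sum_apply fun_scale_def)
      show "u x = (\<Sum>w\<in>words N. \<Sum>c\<in>C. fun_scale (a w c) (transplant w c)) x"
      proof (cases "x \<in> SG")
        case True
        then obtain v y where v: "v \<in> words N" "y \<in> SG" "x = word_map v y"
          using SG_eq_UN_words[of N] by blast
        have "(\<Sum>w\<in>words N. \<Sum>c\<in>C. a w c * transplant w c x) =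
            (\<Sum>w\<in>words N. if w = v then \<Sum>c\<in>C. a v c * c y else 0)"
        proof (rule sum.cong[OF refl])
          fix w assume w: "w \<in> words N"
          have "transplant w c x = (if w = v then c y else 0)" if "c \<in> C" for c
            using transplant_word_map[OF _ w v(1,2), of c] C(1) that unfolding v(3) by auto
          then show "(\<Sum>c\<in>C. a w c * transplant w c x) = (if w = v then \<Sum>c\<in>C. a v c * c y else 0)"
            by simp
        qed
        also have "\<dots> = (\<Sum>c\<in>C. a v c * c y)" using v(1) finite_words by simp
        also have "\<dots> = restrict_cell v u y" using a[OF v(1)] by (simp add: fun_sum_apply)
        also have "\<dots> = u x" using v by (simp add: restrict_cell_def)
        finally show ?thesis using sum_apply by simp
      next
        case False
        have "transplant w c x = 0" if "w \<in> words N" "c \<in> C" for w c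
          using that C(1) False localizableD(2)[OF transplant_in_localizable] by blast
        moreover have "u \<in> solutions lam" using u by (simp add: dirichlet_eigenspace_eq)
        then have "u x = 0" using False by (rule solutionsD(2))
        ultimately show ?thesis using sum_apply by simp
      qed
    qed
    also have "\<dots> \<in> fun_space.span ?T"
      by (intro fun_space.span_sum fun_space.span_scale fun_space.span_base) auto
    finally show "u \<in> fun_space.span ?T" .
  qed
  moreover have "\<phi> j (\<lambda>x. a * u x + b * v x) = a * \<phi> j u + b * \<phi> j v"
    if "j \<in> J" "u \<in> ?E" "v \<in> ?E" for j a b u v
    using that normal_derivative_linear[OF res res] by (auto simp: \<phi>_def J_def res_linear)
  moreover have "finite J" "finite ?T" using C(4) finite_words by (auto simp: J_def)
  ultimately have "\<exists>D. finite D \<and> card D \<le> card ?T + card J \<and> ?E \<subseteq> fun_space.span D"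
    by (intro subset_span_of_functionals dirichlet_eigenspace_linear) auto
  then obtain D where D: "finite D" "card D \<le> card ?T + card J" "?E \<subseteq> fun_space.span D" by blast
  have "fun_space.dim ?E \<le> card D"
    using basis_of_finite_span[OF D(3,1)] by metis
  also have "\<dots> \<le> card ?T + card J" by (rule D(2))
  also have "card ?T = 3 ^ N * card C" using transplanted_basis(3)[OF C(1,2,4) order_refl] by (simp add: card_words)
  also have "card J = 6 * 3 ^ N" by (simp add: J_def card_cartesian_product card_words)
  finally show ?thesis by (simp add: C(5))
qed

section \<open>Spectral decimation\<close>

text \<open>The corner condition uses \<open>c / 2\<close>, the share of a single cell: when two
  cells are glued at a junction, the shares add up to \<open>c\<close>. \<open>F k\<close> is the
  remaining flux at corner \<open>k\<close>.\<close>

definition discrete_eigen :: "nat \<Rightarrow> real \<Rightarrow> (point \<Rightarrow> real) \<Rightarrow> (nat \<Rightarrow> real) \<Rightarrow> bool" where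
  "discrete_eigen n c u F \<longleftrightarrow>
     (\<forall>x\<in>vertices n - vertices 0. neumann n u x = - c * u x) \<and>
     (\<forall>k\<in>letters. neumann n u (corner k) + c / 2 * u (corner k) = F k)"

text \<open>At the junction of cells \<open>i\<close> and \<open>k\<close> the fluxes cancel and the
  half shares add up; at the outer corner \<open>i\<close> the flux is inherited from cell
  \<open>i\<close>.\<close>

lemma discrete_eigen_glue:
  assumes g: "compatible g" and eig: "\<And>i. i \<in> letters \<Longrightarrow> discrete_eigen n c (g i) (F i)"
    and F: "\<And>i k. i \<in> letters \<Longrightarrow> k \<in> letters \<Longrightarrow> i \<noteq> k \<Longrightarrow> F i k + F k i = 0"
  shows "discrete_eigen (Suc n) c (glue g) (\<lambda>i. F i i)"
  unfolding discrete_eigen_def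
proof (intro conjI ballI)
  have flux: "neumann n (g i) (corner k) + c / 2 * g i (corner k) = F i k" if "i \<in> letters" "k \<in> letters" for i k
    using eig that unfolding discrete_eigen_def by blast
  fix i assume i: "i \<in> letters"
  have "neumann (Suc n) (glue g) (corner i) = neumann n (g i) (corner i)"
    using neumann_glue_interior[OF g i corner_in_vertices[OF i], of n] by simp
  moreover have "glue g (corner i) = g i (corner i)"
    using glue_sg_map[OF g i corner_in_SG[OF i]] by simp
  ultimately show "neumann (Suc n) (glue g) (corner i) + c / 2 * glue g (corner i) = F i i"
    using flux[OF i i] by simp
next
  have flux: "neumann n (g i) (corner k) + c / 2 * g i (corner k) = F i k" if "i \<in> letters" "k \<in> letters" for i k
    using eig that unfolding discrete_eigen_def by blast
  fix x assume "x \<in> vertices (Suc n) - vertices 0"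
  then have x: "x \<in> vertices (Suc n)" "x \<notin> vertices 0" by blast+
  obtain i z where z: "i \<in> letters" "z \<in> vertices n" "x = sg_map i z"
    using x(1) by (rule vertices_Suc_cases)
  have val: "glue g x = g i z" unfolding z(3) using z vertices_subset_SG by (intro glue_sg_map g) blast+
  from z(2,1) show "neumann (Suc n) (glue g) x = - c * glue g x"
  proof (cases rule: vertices_cases)
    case interior
    then show ?thesis
      using neumann_glue_interior[OF g z(1,2)] eig[OF z(1)] z val unfolding discrete_eigen_def by auto
  next
    case fixed
    then show ?thesis using x(2) z by (simp add: vertices_0)
  next
    case (junction j)
    have "g i (corner j) = g j (corner i)" using g z(1) junction(1) by (simp add: compatible_def)
    moreover have "neumann (Suc n) (glue g) x = neumann n (g i) (corner j) + neumann n (g j) (corner i)"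
      unfolding z(3) junction(3) by (rule neumann_glue_junction[OF g z(1) junction(1,2)])
    ultimately show ?thesis
      using flux[OF z(1) junction(1)] flux[OF junction(1) z(1)] F[OF z(1) junction(1)] junction val
      by (simp add: field_simps)
  qed
qed

text \<open>For \<open>l \<noteq> k\<close> this is the decimation formula for midpoint values, ((4
  - \<gamma>) (T k + T l) + 2 T m) / ((2 - \<gamma>) (5 - \<gamma>)) with \<open>m\<close> the third
  index, rewritten with the total to be visibly symmetric. \<open>extend \<gamma> k T\<close> lists
  the corner values of the \<open>k\<close>-th subcell.\<close>

definition extend :: "real \<Rightarrow> nat \<Rightarrow> (nat \<Rightarrow> real) \<Rightarrow> nat \<Rightarrow> real" where
  "extend \<gamma> k T l = (if l = k then T k
     else ((2 - \<gamma>) * (T k + T l) + 2 * (T 1 + T 2 + T 3)) / ((2 - \<gamma>) * (5 - \<gamma>)))"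

text \<open>
  For a function with values \<open>T\<close> at the corners of a cell, the eigenvalue equation at a common corner of two
  cells says that the fluxes there cancel. The multiple of \<open>T i\<close> makes the fluxes before and after
  the extension proportional.
\<close>

definition flux :: "real \<Rightarrow> (nat \<Rightarrow> real) \<Rightarrow> nat \<Rightarrow> real" where
  "flux \<gamma> T i = T 1 + T 2 + T 3 - 3 * T i + \<gamma> / 2 * T i"

lemma extend_commute: "extend \<gamma> i T j = extend \<gamma> j T i"
  by (simp add: extend_def add.commute)

lemma extend_eq: "extend \<gamma> k T l = (if l = k then T k
     else ((2 - \<gamma>) * (T k + T l) + 2 * (T 1 + T 2 + T 3)) * inverse ((2 - \<gamma>) * (5 - \<gamma>)))"
  by (simp add: extend_def divide_inverse)

text \<open>The coarser level has eigenvalue \<open>\<gamma> * (5 - \<gamma>)\<close>, which is the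
  recursion for the parameters solved for the earlier one. The factor of proportionality depends
  neither on \<open>T\<close> nor on the corner.\<close>

lemma flux_extend:
  assumes i: "i \<in> letters" and \<gamma>: "\<gamma> \<noteq> 2" "\<gamma> \<noteq> 5"
  shows "flux \<gamma> (extend \<gamma> i T) i = (6 - \<gamma>) / ((2 - \<gamma>) * (5 - \<gamma>)) * flux (\<gamma> * (5 - \<gamma>)) T i"
proof -
  \<comment> \<open>With the inverse as an atom \<open>r\<close> both sides are polynomials; twice
    their difference is a multiple of 1 - r (2 - \<gamma>) (5 - \<gamma>), which vanishes.\<close>
  define r where "r = inverse ((2 - \<gamma>) * (5 - \<gamma>))"
  have r: "r * ((2 - \<gamma>) * (5 - \<gamma>)) = 1" using \<gamma> unfolding r_def by (intro left_inverse) simp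
  have "2 * flux \<gamma> (extend \<gamma> i T) i - 2 * ((6 - \<gamma>) * r * flux (\<gamma> * (5 - \<gamma>)) T i) =
      (1 - r * ((2 - \<gamma>) * (5 - \<gamma>))) * ((\<gamma> - 4) * T i)"
    using i unfolding flux_def extend_eq r_def[symmetric]
    by (elim letters_cases; simp; simp add: algebra_simps; simp add: add_divide_distrib diff_divide_distrib)
  then show ?thesis unfolding r by (simp add: divide_inverse r_def)
qed

text \<open>This is the eigenvalue equation at the midpoint of the side from \<open>i\<close> to
  \<open>j\<close>, the equation that determines the extension formula.\<close>

lemma flux_extend_cancel:
  assumes ij: "i \<in> letters" "j \<in> letters" "i \<noteq> j" and \<gamma>: "\<gamma> \<noteq> 2" "\<gamma> \<noteq> 5"
  shows "flux \<gamma> (extend \<gamma> i T) j + flux \<gamma> (extend \<gamma> j T) i = 0"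
proof -
  define r where "r = inverse ((2 - \<gamma>) * (5 - \<gamma>))"
  have r: "r * ((2 - \<gamma>) * (5 - \<gamma>)) = 1" using \<gamma> unfolding r_def by (intro left_inverse) simp
  have "flux \<gamma> (extend \<gamma> i T) j + flux \<gamma> (extend \<gamma> j T) i =
      (1 - r * ((2 - \<gamma>) * (5 - \<gamma>))) * (T i + T j)"
    using ij unfolding flux_def extend_eq r_def[symmetric]
    by (elim letters_cases; simp; simp add: algebra_simps)
  then show ?thesis unfolding r by simp
qed
definition flux_factor :: "(nat \<Rightarrow> real) \<Rightarrow> nat \<Rightarrow> nat \<Rightarrow> real" where
  "flux_factor \<gamma> p n = (\<Prod>k\<in>{p<..p + n}. (6 - \<gamma> k) / ((2 - \<gamma> k) * (5 - \<gamma> k)))"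

lemma flux_factor_0 [simp]: "flux_factor \<gamma> p 0 = 1"
  by (simp add: flux_factor_def)

lemma flux_factor_Suc:
  "flux_factor \<gamma> p (Suc n) = (6 - \<gamma> (Suc p)) / ((2 - \<gamma> (Suc p)) * (5 - \<gamma> (Suc p))) * flux_factor \<gamma> (Suc p) n"
proof -
  have "{p<..p + Suc n} = insert (Suc p) {Suc p<..Suc p + n}" by auto
  then show ?thesis by (simp add: flux_factor_def)
qed

text \<open>The fluxes on level \<open>n\<close> are one common multiple of the fluxes of the corner
  values \<open>T\<close>. Hence a cancellation of fluxes that is checked once, for the corner
  values, persists on every finer level.\<close>

definition decimation_function :: "(nat \<Rightarrow> real) \<Rightarrow> nat \<Rightarrow> (nat \<Rightarrow> real) \<Rightarrow> (point \<Rightarrow> real) \<Rightarrow> bool" where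
  "decimation_function \<gamma> p T e \<longleftrightarrow> continuous_on SG e \<and> (\<forall>x. x \<notin> SG \<longrightarrow> e x = 0) \<and>
     (\<forall>i\<in>letters. e (corner i) = T i) \<and>
     (\<forall>n. discrete_eigen n (\<gamma> (p + n)) e (\<lambda>k. flux_factor \<gamma> p n * flux (\<gamma> p) T k))"

lemma discrete_eigen_0:
  assumes "\<And>i. i \<in> letters \<Longrightarrow> e (corner i) = T i"
  shows "discrete_eigen 0 c e (flux c T)"
  using assms by (simp add: discrete_eigen_def flux_def sum_letters)

lemma compatible_extend:
  assumes "\<And>i k. i \<in> letters \<Longrightarrow> k \<in> letters \<Longrightarrow> e i (corner k) = extend c i T k"
  shows "compatible e"
  unfolding compatible_def using assms extend_commute by metis

lemma discrete_eigen_extend: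
  assumes \<gamma>: "\<gamma> (Suc p) \<noteq> 2" "\<gamma> (Suc p) \<noteq> 5" "\<gamma> p = \<gamma> (Suc p) * (5 - \<gamma> (Suc p))"
    and val: "\<And>i k. i \<in> letters \<Longrightarrow> k \<in> letters \<Longrightarrow> e i (corner k) = extend (\<gamma> (Suc p)) i T k"
    and eig: "\<And>i. i \<in> letters \<Longrightarrow> discrete_eigen n (\<gamma> (Suc p + n)) (e i)
      (\<lambda>k. flux_factor \<gamma> (Suc p) n * flux (\<gamma> (Suc p)) (extend (\<gamma> (Suc p)) i T) k)"
  shows "discrete_eigen (Suc n) (\<gamma> (p + Suc n)) (glue e) (\<lambda>k. flux_factor \<gamma> p (Suc n) * flux (\<gamma> p) T k)"
proof -
  have "discrete_eigen (Suc n) (\<gamma> (Suc p + n)) (glue e)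
      (\<lambda>i. flux_factor \<gamma> (Suc p) n * flux (\<gamma> (Suc p)) (extend (\<gamma> (Suc p)) i T) i)"
  proof (rule discrete_eigen_glue[OF compatible_extend[OF val] eig])
    fix i k assume ik: "i \<in> letters" "k \<in> letters" "i \<noteq> k"
    show "flux_factor \<gamma> (Suc p) n * flux (\<gamma> (Suc p)) (extend (\<gamma> (Suc p)) i T) k +
        flux_factor \<gamma> (Suc p) n * flux (\<gamma> (Suc p)) (extend (\<gamma> (Suc p)) k T) i = 0"
      using flux_extend_cancel[OF ik \<gamma>(1,2), of T] by (simp flip: distrib_left)
  qed
  then show ?thesis
    using flux_extend[OF _ \<gamma>(1,2), of _ T] \<gamma>(3) unfolding discrete_eigen_def flux_factor_Suc by simp
qed

lemma glue_corner: "compatible g \<Longrightarrow> i \<in> letters \<Longrightarrow> glue g (corner i) = g i (corner i)"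
  using glue_sg_map[OF _ _ corner_in_SG] by fastforce

lemma decimation_function_extend:
  assumes \<gamma>: "\<gamma> (Suc p) \<noteq> 2" "\<gamma> (Suc p) \<noteq> 5" "\<gamma> p = \<gamma> (Suc p) * (5 - \<gamma> (Suc p))"
    and e: "\<And>i. i \<in> letters \<Longrightarrow> decimation_function \<gamma> (Suc p) (extend (\<gamma> (Suc p)) i T) (e i)"
  shows "decimation_function \<gamma> p T (glue e)"
proof -
  have val: "e i (corner k) = extend (\<gamma> (Suc p)) i T k" if "i \<in> letters" "k \<in> letters" for i k
    using e that unfolding decimation_function_def by blast
  have comp: "compatible e" by (rule compatible_extend[OF val])
  have corner: "glue e (corner i) = T i" if "i \<in> letters" for i
    using glue_corner[OF comp that] val[OF that that] by (simp add: extend_def)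
  have "discrete_eigen n (\<gamma> (p + n)) (glue e) (\<lambda>k. flux_factor \<gamma> p n * flux (\<gamma> p) T k)" for n
  proof (cases n)
    case 0
    then show ?thesis using discrete_eigen_0[where e = "glue e" and T = T] corner by simp
  next
    case (Suc m)
    show ?thesis unfolding Suc
      using e unfolding decimation_function_def by (intro discrete_eigen_extend[OF \<gamma> val]) auto
  qed
  moreover have "continuous_on SG (glue e)"
    using e unfolding decimation_function_def by (intro continuous_on_glue comp) blast
  ultimately show ?thesis
    unfolding decimation_function_def using corner glue_outside by blast
qed

subsection \<open>Continuity of the extension for small parameters\<close>

text \<open>The affine function with values \<open>T\<close> at the corners; the two brackets with
  \<open>x\<close> are the barycentric coordinates belonging to corners 2 and 3. It is the starting
  point of the approximation.\<close>

definition linear_interpolant :: "(nat \<Rightarrow> real) \<Rightarrow> point \<Rightarrow> real" where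
  "linear_interpolant T x = T 1 + (T 2 - T 1) * (fst x - snd x / sqrt 3) + (T 3 - T 1) * (2 * snd x / sqrt 3)"

lemma linear_interpolant_corner: "i \<in> letters \<Longrightarrow> linear_interpolant T (corner i) = T i"
  by (elim letters_cases) (simp_all add: linear_interpolant_def corner_def)

lemma linear_interpolant_bound:
  assumes x: "x \<in> SG" and c: "\<And>i j. i \<in> letters \<Longrightarrow> j \<in> letters \<Longrightarrow> \<bar>T i - T j\<bar> \<le> c" and i: "i \<in> letters"
  shows "\<bar>linear_interpolant T x - T i\<bar> \<le> 3 * c"
proof -
  have "x \<in> triangle" using x SG_subset_triangle by blast
  then have t: "0 \<le> snd x" "snd x \<le> sqrt 3 * fst x" "snd x \<le> sqrt 3 * (1 - fst x)"
    by (simp_all add: triangle_def)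
  define s r where "s = fst x - snd x / sqrt 3" and "r = 2 * snd x / sqrt 3"
  have y: "snd x / sqrt 3 \<le> fst x" "snd x / sqrt 3 \<le> 1 - fst x" "0 \<le> snd x / sqrt 3"
    using t by (simp_all add: divide_le_eq mult.commute)
  then have s: "\<bar>s\<bar> \<le> 1" and r: "\<bar>r\<bar> \<le> 1" unfolding s_def r_def by linarith+
  have "\<bar>(T 2 - T 1) * s\<bar> \<le> c * 1" "\<bar>(T 3 - T 1) * r\<bar> \<le> c * 1"
    unfolding abs_mult using c[of 2 1] c[of 3 1] s r by (intro mult_mono; simp)+
  moreover have "linear_interpolant T x - T i = (T 1 - T i) + (T 2 - T 1) * s + (T 3 - T 1) * r"
    by (simp add: linear_interpolant_def s_def r_def)
  ultimately show ?thesis using c[of 1 i] i by simp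
qed

text \<open>Separates the oscillation of \<open>T\<close> from its size. For \<gamma> = 0 this is
  harmonic extension, whose first two terms are at most 1/5 + 2/5 = 3/5 of the oscillation; the last
  term is the price of a positive \<gamma>.\<close>

lemma extend_minus:
  assumes "\<gamma> \<noteq> 2" "\<gamma> \<noteq> 5" "l \<noteq> k" "{k, l, m} = letters"
  shows "extend \<gamma> k T l - T k = (T l - T k) / (5 - \<gamma>) + 2 * ((T l - T k) + (T m - T k)) / ((2 - \<gamma>) * (5 - \<gamma>)) + \<gamma> * T k / (2 - \<gamma>)"
proof -
  have "sum T letters = T k + T l + T m"
  proof -
    have "card {k, l, m} = 3" using assms(4) by simp
    then have "m \<noteq> k" "m \<noteq> l" using assms(3) by (auto simp: card_insert_if split: if_splits)
    then show ?thesis unfolding assms(4)[symmetric] using assms(3) by (simp add: add.assoc)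
  qed
  then have "T 1 + T 2 + T 3 = T k + T l + T m" by (simp add: sum_letters)
  then have "extend \<gamma> k T l = ((2 - \<gamma>) * (T k + T l) + 2 * (T k + T l + T m)) / ((2 - \<gamma>) * (5 - \<gamma>))"
    using assms(3) by (simp add: extend_def)
  moreover have "2 - \<gamma> \<noteq> 0" "5 - \<gamma> \<noteq> 0" using assms by auto
  ultimately show ?thesis by (simp add: divide_simps) algebra
qed

text \<open>
  The number \<open>c\<close> bounds the oscillation of \<open>T\<close> plus \<open>\<gamma> p\<close> times its size: extension contracts the
  former up to a multiple of the latter, and the size grows much more slowly than \<open>\<gamma>\<close> decreases.
\<close>

definition tame :: "(nat \<Rightarrow> real) \<Rightarrow> nat \<Rightarrow> real \<Rightarrow> (nat \<Rightarrow> real) \<Rightarrow> bool" where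
  "tame \<gamma> p c T \<longleftrightarrow> (\<exists>b\<ge>0. (\<forall>i\<in>letters. \<bar>T i\<bar> \<le> b) \<and>
     (\<forall>i\<in>letters. \<forall>j\<in>letters. \<bar>T i - T j\<bar> + \<gamma> p * b \<le> c))"

lemma tame_exists: "\<exists>c. tame \<gamma> p c T"
proof -
  define b where "b = \<bar>T 1\<bar> + \<bar>T 2\<bar> + \<bar>T 3\<bar>"
  have b: "\<bar>T i\<bar> \<le> b" if "i \<in> letters" for i
    using that by (elim letters_cases) (simp_all add: b_def)
  have "\<bar>T i - T j\<bar> + \<gamma> p * b \<le> 2 * b + \<gamma> p * b" if "i \<in> letters" "j \<in> letters" for i j
    using b[OF that(1)] b[OF that(2)] by linarith
  moreover have "b \<ge> 0" by (simp add: b_def)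
  ultimately show ?thesis unfolding tame_def using b by blast
qed

text \<open>Let g \<le> 1/10 be the new parameter, a the oscillation and b the size. The inverses of
  5 - g and 2 - g are at most 10/49 and 10/19, so the new oscillation is at most 590/931 a + 10/19 g
  b and the new size at most 20/19 b. As the previous parameter is at least 49/10 g, both resulting
  coefficients stay below 4/5.\<close>

lemma tame_extend:
  assumes \<gamma>: "0 \<le> \<gamma> (Suc p)" "\<gamma> (Suc p) \<le> 1/10" "\<gamma> p = \<gamma> (Suc p) * (5 - \<gamma> (Suc p))"
    and T: "tame \<gamma> p c T" and k: "k \<in> letters"
  shows "tame \<gamma> (Suc p) (4/5 * c) (extend (\<gamma> (Suc p)) k T)"
proof -
  define g where "g = \<gamma> (Suc p)"
  obtain b where b: "b \<ge> 0" "\<And>i. i \<in> letters \<Longrightarrow> \<bar>T i\<bar> \<le> b"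
    "\<And>i j. i \<in> letters \<Longrightarrow> j \<in> letters \<Longrightarrow> \<bar>T i - T j\<bar> + \<gamma> p * b \<le> c"
    using T unfolding tame_def by blast
  define a where "a = c - \<gamma> p * b"
  have a: "\<bar>T i - T j\<bar> \<le> a" if "i \<in> letters" "j \<in> letters" for i j
    using b(3)[OF that] by (simp add: a_def)
  have a0: "a \<ge> 0" using a[of 1 1] by simp
  have g: "0 \<le> g" "g \<le> 1/10" "\<gamma> p = g * (5 - g)" using \<gamma> by (simp_all add: g_def)
  have inv5: "1 / (5 - g) \<le> 10/49" using g by (simp add: field_simps)
  have inv2: "1 / (2 - g) \<le> 10/19" using g by (simp add: field_simps)
  have inv25: "1 / ((2 - g) * (5 - g)) \<le> 100/931"
  proof -
    have "1 / (2 - g) * (1 / (5 - g)) \<le> 10/19 * (10/49)" using inv5 inv2 g by (intro mult_mono) auto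
    then show ?thesis by simp
  qed
  let ?E = "extend g k T"
  have gb: "g * b \<ge> 0" using g b by simp
  have diff: "\<bar>?E l - T k\<bar> \<le> 590/931 * a + 10/19 * (g * b)" if l: "l \<in> letters" "l \<noteq> k" for l
  proof -
    obtain m where m: "m \<in> letters" "{k, l, m} = letters"
      using k l by (elim letters_cases) (auto simp: letters_def)
    have "\<bar>(T l - T k) * (1 / (5 - g))\<bar> \<le> a * (10/49)"
      unfolding abs_mult using a[OF l(1) k] inv5 g by (intro mult_mono) auto
    moreover have "\<bar>(2 * ((T l - T k) + (T m - T k))) * (1 / ((2 - g) * (5 - g)))\<bar> \<le> (4 * a) * (100/931)"
      unfolding abs_mult[of "2 * _" "1 / _"]
    proof (rule mult_mono)
      show "\<bar>2 * ((T l - T k) + (T m - T k))\<bar> \<le> 4 * a"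
        using a[OF l(1) k] a[OF m(1) k] unfolding abs_le_iff by argo
      show "\<bar>1 / ((2 - g) * (5 - g))\<bar> \<le> 100/931" using inv25 g by simp
    qed (use a0 in auto)
    moreover have "\<bar>(g * T k) * (1 / (2 - g))\<bar> \<le> (g * b) * (10/19)"
      unfolding abs_mult using b(2)[OF k] inv2 g b(1) by (intro mult_mono) auto
    moreover have "?E l - T k = (T l - T k) * (1 / (5 - g)) + (2 * ((T l - T k) + (T m - T k))) * (1 / ((2 - g) * (5 - g))) + (g * T k) * (1 / (2 - g))"
      using extend_minus[of g l k m T] g l(2) m(2) by simp
    moreover have "\<bar>X + Y + Z\<bar> \<le> x + y + z" if "\<bar>X\<bar> \<le> x" "\<bar>Y\<bar> \<le> y" "\<bar>Z\<bar> \<le> z" for X Y Z x y z :: real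
      using that by linarith
    ultimately have "\<bar>?E l - T k\<bar> \<le> a * (10/49) + (4 * a) * (100/931) + (g * b) * (10/19)" by metis
    then show ?thesis by simp
  qed
  have diff2: "\<bar>?E l - ?E m\<bar> \<le> 590/931 * a + 10/19 * (g * b)" if lm: "l \<in> letters" "m \<in> letters" for l m
  proof (cases "l = k \<or> m = k")
    case True
    then show ?thesis using diff[of l] diff[of m] lm a0 gb by (auto simp: extend_def abs_minus_commute)
  next
    case False
    have "?E l - ?E m = ((2 - g) * (T l - T m)) / ((2 - g) * (5 - g))"
      using False by (simp add: extend_def diff_divide_distrib[symmetric] algebra_simps)
    also have "\<dots> = (T l - T m) * (1 / (5 - g))" using g by simp
    also have "\<bar>\<dots>\<bar> \<le> a * (10/49)"
      unfolding abs_mult using a[OF lm] inv5 g by (intro mult_mono) auto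
    finally show ?thesis using a0 gb by linarith
  qed
  have size: "\<bar>?E l\<bar> \<le> 20/19 * b" if l: "l \<in> letters" for l
  proof (cases "l = k")
    case True
    have "?E l = T k" using True by (simp add: extend_def)
    then show ?thesis using b(1) b(2)[OF k] by simp
  next
    case False
    have "\<bar>(2 - g) * (T k + T l) + 2 * (T 1 + T 2 + T 3)\<bar> \<le> (2 - g) * (2 * b) + 2 * (3 * b)"
    proof -
      have "\<bar>(2 - g) * (T k + T l)\<bar> \<le> (2 - g) * (2 * b)"
        unfolding abs_mult using g b(2)[OF k] b(2)[OF l] by (intro mult_mono) auto
      then show ?thesis using b(2)[of 1] b(2)[of 2] b(2)[of 3] by simp
    qed
    then have "\<bar>?E l\<bar> \<le> ((2 - g) * (2 * b) + 2 * (3 * b)) / ((2 - g) * (5 - g))"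
      using False g by (simp add: extend_def abs_divide divide_right_mono abs_mult)
    also have "\<dots> = 2 * b * (1 / (2 - g))"
    proof -
      have "2 - g \<noteq> 0" "5 - g \<noteq> 0" using g by auto
      then show ?thesis by (simp add: divide_simps) (simp add: algebra_simps)
    qed
    also have "\<dots> \<le> 2 * b * (10/19)" using inv2 b(1) by (intro mult_left_mono) auto
    finally show ?thesis by simp
  qed
  have "\<bar>?E l - ?E m\<bar> + g * (20/19 * b) \<le> 4/5 * c" if "l \<in> letters" "m \<in> letters" for l m
  proof -
    have "g * (49/10) \<le> g * (5 - g)" using g by (intro mult_left_mono) auto
    then have "g * (49/10) * b \<le> \<gamma> p * b" using b(1) g by (intro mult_right_mono) auto
    then have "49/10 * (g * b) \<le> \<gamma> p * b" by (simp add: mult.assoc)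
    moreover have "c = a + \<gamma> p * b" by (simp add: a_def)
    moreover have "g * (20/19 * b) = 20/19 * (g * b)" by simp
    ultimately show ?thesis using diff2[OF that] a0 gb by argo
  qed
  then show ?thesis
    unfolding tame_def g_def[symmetric] using size b(1) by (intro exI[of _ "20/19 * b"]) auto
qed

text \<open>Follows the decimation formula for \<open>n\<close> levels and is affine on the cells of
  that level. The recursion peels off the outermost map, so that estimates pass from a cell to the
  gasket.\<close>

primrec approximant :: "(nat \<Rightarrow> real) \<Rightarrow> nat \<Rightarrow> nat \<Rightarrow> (nat \<Rightarrow> real) \<Rightarrow> point \<Rightarrow> real" where
  "approximant \<gamma> 0 p T = (\<lambda>x. if x \<in> SG then linear_interpolant T x else 0)"
| "approximant \<gamma> (Suc n) p T = glue (\<lambda>i. approximant \<gamma> n (Suc p) (extend (\<gamma> (Suc p)) i T))"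

lemma approximant_corner: "i \<in> letters \<Longrightarrow> approximant \<gamma> n p T (corner i) = T i"
proof (induction n arbitrary: p T i)
  case (Suc n)
  have "compatible (\<lambda>i. approximant \<gamma> n (Suc p) (extend (\<gamma> (Suc p)) i T))"
    by (rule compatible_extend[OF Suc.IH])
  from glue_corner[OF this Suc.prems] show ?case using Suc by (simp add: extend_def)
qed (simp add: corner_in_SG linear_interpolant_corner)

lemma approximant_Suc_sg_map:
  assumes "i \<in> letters" "x \<in> SG"
  shows "approximant \<gamma> (Suc n) p T (sg_map i x) = approximant \<gamma> n (Suc p) (extend (\<gamma> (Suc p)) i T) x"
  using glue_sg_map[OF compatible_extend[OF approximant_corner] assms] by simp

lemma continuous_on_approximant: "continuous_on SG (approximant \<gamma> n p T)"
proof (induction n arbitrary: p T)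
  case 0
  have "continuous_on SG (linear_interpolant T)" unfolding linear_interpolant_def[abs_def] by (intro continuous_intros) auto
  then show ?case by (simp cong: continuous_on_cong)
next
  case (Suc n)
  then show ?case by (simp add: continuous_on_glue compatible_extend approximant_corner)
qed

text \<open>6 is twice the 3 of the interpolation bound: initially both interpolants differ from the
  common corner value \<open>T i\<close> by at most 3 c. Each level then multiplies the constant of
  \<open>tame\<close> by 4/5.\<close>

lemma approximant_step:
  assumes \<gamma>: "\<And>k. k \<ge> p \<Longrightarrow> 0 \<le> \<gamma> k \<and> \<gamma> k \<le> 1/10 \<and> \<gamma> k = \<gamma> (Suc k) * (5 - \<gamma> (Suc k))"
    and T: "tame \<gamma> p c T" and x: "x \<in> SG"
  shows "\<bar>approximant \<gamma> (Suc n) p T x - approximant \<gamma> n p T x\<bar> \<le> 6 * c * (4/5) ^ n"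
  using assms
proof (induction n arbitrary: p c T x)
  case (0 p c T x)
  have osc: "\<bar>T i - T j\<bar> \<le> c" if A: "\<gamma> p \<ge> 0" "tame \<gamma> p c T" "i \<in> letters" "j \<in> letters" for i j p c and T :: "nat \<Rightarrow> real"
  proof -
    obtain b where b: "b \<ge> 0" "\<forall>i\<in>letters. \<forall>j\<in>letters. \<bar>T i - T j\<bar> + \<gamma> p * b \<le> c"
      using A(2) unfolding tame_def by blast
    have "\<bar>T i - T j\<bar> + \<gamma> p * b \<le> c" by (rule bspec[OF bspec[OF b(2) A(3)] A(4)])
    then show ?thesis using mult_nonneg_nonneg[OF A(1) b(1)] by linarith
  qed
  obtain i y where y: "i \<in> letters" "y \<in> SG" "x = sg_map i y" using 0(3) by (rule SG_cases)
  let ?E = "extend (\<gamma> (Suc p)) i T"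
  have E: "tame \<gamma> (Suc p) (4/5 * c) ?E"
    using 0(1)[of p] 0(1)[of "Suc p"] 0(2) y(1) by (intro tame_extend) auto
  have "\<bar>linear_interpolant ?E y - ?E i\<bar> \<le> 3 * (4/5 * c)"
    using 0(1)[of "Suc p"] E by (intro linear_interpolant_bound y osc[of "Suc p"]) auto
  moreover have "\<bar>linear_interpolant T x - T i\<bar> \<le> 3 * c"
    using 0(1)[of p] 0(2,3) by (intro linear_interpolant_bound y osc[of p]) auto
  moreover have "?E i = T i" by (simp add: extend_def)
  moreover have "approximant \<gamma> (Suc 0) p T x = linear_interpolant ?E y"
    unfolding y(3) approximant_Suc_sg_map[OF y(1,2)] using y(2) by simp
  moreover have "approximant \<gamma> 0 p T x = linear_interpolant T x" using 0(3) by simp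
  moreover have "c \<ge> 0"
    using osc[OF conjunct1[OF 0(1)[OF order_refl]] 0(2), of 1 1] by simp
  ultimately show ?case unfolding power_0 mult_1_right by linarith
next
  case (Suc n p c T x)
  obtain i y where y: "i \<in> letters" "y \<in> SG" "x = sg_map i y" using Suc.prems(3) by (rule SG_cases)
  let ?E = "extend (\<gamma> (Suc p)) i T"
  have tame: "tame \<gamma> (Suc p) (4/5 * c) ?E"
    using Suc.prems(1)[of p] Suc.prems(1)[of "Suc p"] Suc.prems(2) y(1) by (intro tame_extend) auto
  have "\<bar>approximant \<gamma> (Suc n) (Suc p) ?E y - approximant \<gamma> n (Suc p) ?E y\<bar> \<le> 6 * (4/5 * c) * (4/5) ^ n"
  proof (rule Suc.IH[OF _ tame y(2)])
    show "0 \<le> \<gamma> k \<and> \<gamma> k \<le> 1/10 \<and> \<gamma> k = \<gamma> (Suc k) * (5 - \<gamma> (Suc k))" if "k \<ge> Suc p" for k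
      by (rule Suc.prems(1)) (use that in simp)
  qed
  then show ?case unfolding y(3) approximant_Suc_sg_map[OF y(1,2)] by simp
qed

lemma decimation_limit:
  assumes \<gamma>: "\<And>k. k \<ge> p \<Longrightarrow> 0 \<le> \<gamma> k \<and> \<gamma> k \<le> 1/10 \<and> \<gamma> k = \<gamma> (Suc k) * (5 - \<gamma> (Suc k))"
  obtains e where "continuous_on SG e" "\<And>x. x \<in> SG \<Longrightarrow> (\<lambda>n. approximant \<gamma> n p T x) \<longlonglongrightarrow> e x"
    "\<And>x. x \<notin> SG \<Longrightarrow> e x = 0"
proof -
  obtain c where c: "tame \<gamma> p c T" using tame_exists by blast
  define f where "f n x = approximant \<gamma> (Suc n) p T x - approximant \<gamma> n p T x" for n x
  define h where "h x = approximant \<gamma> 0 p T x + (\<Sum>n. f n x)" for x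
  have tele: "approximant \<gamma> n p T x = approximant \<gamma> 0 p T x + (\<Sum>k<n. f k x)" for n x
    unfolding f_def sum_lessThan_telescope[of "\<lambda>n. approximant \<gamma> n p T x"] by simp
  have lim: "uniform_limit SG (\<lambda>n x. \<Sum>k<n. f k x) (\<lambda>x. \<Sum>n. f n x) sequentially"
  proof (rule Weierstrass_m_test)
    show "norm (f n x) \<le> 6 * c * (4/5) ^ n" if "x \<in> SG" for n x
      using approximant_step[OF \<gamma> c that, of n] by (simp add: f_def)
    show "summable (\<lambda>n. 6 * c * (4/5::real) ^ n)" by (intro summable_mult summable_geometric) simp
  qed
  have "continuous_on SG (\<lambda>x. \<Sum>n. f n x)"
  proof (rule uniform_limit_theorem[OF _ lim])
    show "\<forall>\<^sub>F n in sequentially. continuous_on SG (\<lambda>x. \<Sum>k<n. f k x)"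
      unfolding f_def by (intro always_eventually allI continuous_intros continuous_on_approximant)
  qed simp
  then have cont: "continuous_on SG h"
    unfolding h_def[abs_def] by (intro continuous_intros continuous_on_approximant)
  have conv: "(\<lambda>n. approximant \<gamma> n p T x) \<longlonglongrightarrow> h x" if "x \<in> SG" for x
  proof -
    have "(\<lambda>n. approximant \<gamma> 0 p T x + (\<Sum>k<n. f k x)) \<longlonglongrightarrow> h x"
      unfolding h_def by (intro tendsto_intros tendsto_uniform_limitI[OF lim that])
    then show ?thesis unfolding tele[symmetric] .
  qed
  define e where "e x = (if x \<in> SG then h x else 0)" for x
  have "continuous_on SG e = continuous_on SG h" by (rule continuous_on_cong) (auto simp: e_def)
  with cont conv show ?thesis by (intro that[of e]) (auto simp: e_def)
qed

text \<open>The approximants satisfy the gluing relation, so their limits do; the eigenvalue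
  equation on level \<open>n\<close> follows by induction on \<open>n\<close>, with the start
  \<open>q\<close> of the parameters moving along.\<close>

lemma decimation_function_exists_small:
  assumes \<gamma>: "\<And>k. k \<ge> p \<Longrightarrow> 0 \<le> \<gamma> k \<and> \<gamma> k \<le> 1/10 \<and> \<gamma> k = \<gamma> (Suc k) * (5 - \<gamma> (Suc k))"
  shows "\<exists>e. decimation_function \<gamma> p T e"
proof -
  have "\<exists>e. continuous_on SG e \<and> (\<forall>x\<in>SG. (\<lambda>n. approximant \<gamma> n q T x) \<longlonglongrightarrow> e x) \<and> (\<forall>x. x \<notin> SG \<longrightarrow> e x = 0)"
    if "q \<ge> p" for q T
  proof -
    have "0 \<le> \<gamma> k \<and> \<gamma> k \<le> 1/10 \<and> \<gamma> k = \<gamma> (Suc k) * (5 - \<gamma> (Suc k))" if "k \<ge> q" for k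
      by (rule \<gamma>) (use that \<open>q \<ge> p\<close> in simp)
    from decimation_limit[of q \<gamma> T, OF this] show ?thesis by metis
  qed
  then obtain E where E: "\<And>q T. q \<ge> p \<Longrightarrow> continuous_on SG (E q T)"
    "\<And>q T x. q \<ge> p \<Longrightarrow> x \<in> SG \<Longrightarrow> (\<lambda>n. approximant \<gamma> n q T x) \<longlonglongrightarrow> E q T x"
    "\<And>q T x. q \<ge> p \<Longrightarrow> x \<notin> SG \<Longrightarrow> E q T x = 0"
    by metis
  have corner: "E q T (corner i) = T i" if "q \<ge> p" "i \<in> letters" for q T i
  proof -
    have "(\<lambda>n. T i) \<longlonglongrightarrow> E q T (corner i)"
      using E(2)[OF that(1) corner_in_SG[OF that(2)], of T] approximant_corner[OF that(2)] by simp
    then show ?thesis using LIMSEQ_unique tendsto_const by metis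
  qed
  have glue: "E q T = glue (\<lambda>i. E (Suc q) (extend (\<gamma> (Suc q)) i T))" if q: "q \<ge> p" for q T
  proof
    fix x
    have comp: "compatible (\<lambda>i. E (Suc q) (extend (\<gamma> (Suc q)) i T))"
      using q by (intro compatible_extend[where c = "\<gamma> (Suc q)" and T = T] corner) auto
    show "E q T x = glue (\<lambda>i. E (Suc q) (extend (\<gamma> (Suc q)) i T)) x"
    proof (cases "x \<in> SG")
      case True
      then obtain i y where y: "i \<in> letters" "y \<in> SG" "x = sg_map i y" by (rule SG_cases)
      have "(\<lambda>n. approximant \<gamma> (Suc n) q T x) \<longlonglongrightarrow> E q T x"
        using E(2)[OF q True] by (rule LIMSEQ_Suc)
      moreover have "(\<lambda>n. approximant \<gamma> (Suc n) q T x) \<longlonglongrightarrow> E (Suc q) (extend (\<gamma> (Suc q)) i T) y"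
        unfolding y(3) approximant_Suc_sg_map[OF y(1,2)] using q y(2) by (intro E(2)) auto
      ultimately have "E q T x = E (Suc q) (extend (\<gamma> (Suc q)) i T) y" by (rule LIMSEQ_unique)
      then show ?thesis using glue_sg_map[OF comp y(1,2)] y(3) by simp
    qed (simp add: E(3)[OF q] glue_outside)
  qed
  have "discrete_eigen n (\<gamma> (q + n)) (E q T) (\<lambda>k. flux_factor \<gamma> q n * flux (\<gamma> q) T k)" if "q \<ge> p" for n q T
    using that
  proof (induction n arbitrary: q T)
    case 0
    then show ?case using discrete_eigen_0[where e = "E q T" and T = T] corner by simp
  next
    case (Suc n)
    have s: "\<gamma> (Suc q) \<noteq> 2" "\<gamma> (Suc q) \<noteq> 5" "\<gamma> q = \<gamma> (Suc q) * (5 - \<gamma> (Suc q))"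
      using \<gamma>[of q] \<gamma>[of "Suc q"] Suc.prems by auto
    show ?case
      unfolding glue[OF Suc.prems] using Suc.prems
      by (intro discrete_eigen_extend s corner Suc.IH) auto
  qed
  then show ?thesis
    unfolding decimation_function_def using E corner by (intro exI[of _ "E p T"]) auto
qed

subsection \<open>Parameters of the decimation\<close>

text \<open>The extension divides by 2 - \<gamma> and 5 - \<gamma>. A new value stays below 5
  because the previous one is positive. It could be 2 only after 6, hence only at the first step of
  a 6-series, where the sign +1 selects 3 instead.\<close>

lemma decimation_parameters:
  assumes dec: "decimation_sequence j \<epsilon> \<gamma>" and start: "\<gamma> j = 5 \<or> \<gamma> j = 6 \<and> \<epsilon> (Suc j) = 1"
    and k: "k \<ge> j"
  shows "0 < \<gamma> (Suc k)" "\<gamma> (Suc k) < 5" "\<gamma> (Suc k) \<noteq> 2" "\<gamma> k = \<gamma> (Suc k) * (5 - \<gamma> (Suc k))"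
proof -
  have rec: "\<epsilon> (Suc k) = -1 \<or> \<epsilon> (Suc k) = 1" "\<gamma> (Suc k) = 1/2 * (5 + \<epsilon> (Suc k) * sqrt (25 - 4 * \<gamma> k))" if "k \<ge> j" for k
    using dec that unfolding decimation_sequence_def by (auto dest: spec[of _ "Suc k"])
  have next_value: "0 < \<gamma> (Suc k) \<and> \<gamma> (Suc k) < 5 \<and> \<gamma> k = \<gamma> (Suc k) * (5 - \<gamma> (Suc k))"
    if k: "k \<ge> j" "0 < \<gamma> k" "\<gamma> k \<le> 6" for k
  proof -
    define s where "s = sqrt (25 - 4 * \<gamma> k)"
    have s2: "s * s = 25 - 4 * \<gamma> k" using k by (simp add: s_def)
    have s0: "s \<ge> 0" using k by (simp add: s_def)
    have s5: "s < 5" unfolding s_def using k by (intro real_less_lsqrt) auto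
    consider "\<gamma> (Suc k) = (5 - s) / 2" | "\<gamma> (Suc k) = (5 + s) / 2"
      using rec[OF k(1)] unfolding s_def[symmetric] by auto
    then show ?thesis
    proof cases
      case 1
      have "\<gamma> k = (5 - s) / 2 * (5 - (5 - s) / 2)" using s2 by (simp add: field_simps)
      then show ?thesis unfolding 1 using s0 s5 by simp
    next
      case 2
      have "\<gamma> k = (5 + s) / 2 * (5 - (5 + s) / 2)" using s2 by (simp add: field_simps)
      then show ?thesis unfolding 2 using s0 s5 by simp
    qed
  qed
  have bounds: "0 < \<gamma> k \<and> \<gamma> k \<le> 6 \<and> (\<gamma> k = 6 \<longrightarrow> k = j)" if "k \<ge> j" for k
    using that
  proof (induction k rule: dec_induct)
    case (step k)
    then show ?case using next_value[of k] by auto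
  qed (use start in auto)
  from next_value[OF k] bounds[OF k]
  show "0 < \<gamma> (Suc k)" "\<gamma> (Suc k) < 5" "\<gamma> k = \<gamma> (Suc k) * (5 - \<gamma> (Suc k))" by blast+
  show "\<gamma> (Suc k) \<noteq> 2"
  proof
    assume 2: "\<gamma> (Suc k) = 2"
    then have "\<gamma> k = 6" using next_value[OF k] bounds[OF k] by auto
    moreover from this have "k = j" using bounds[OF k] by blast
    ultimately show False using rec(2)[OF k] start 2 by auto
  qed
qed

text \<open>Convergence of 5^k \<gamma> k forces \<gamma> to 0, so the parameters are eventually
  small; the finitely many coarser levels are added by backward induction.\<close>

lemma decimation_function_exists:
  assumes dec: "decimation_sequence j \<epsilon> \<gamma>" and start: "\<gamma> j = 5 \<or> \<gamma> j = 6 \<and> \<epsilon> (Suc j) = 1"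
    and lim: "(\<lambda>k. 3/2 * (5 ^ k * \<gamma> k)) \<longlonglongrightarrow> lam"
  shows "\<exists>e. decimation_function \<gamma> j T e"
proof -
  have "(\<lambda>k. 2/3 * (3/2 * (5 ^ k * \<gamma> k)) * (1/5) ^ k) \<longlonglongrightarrow> 2/3 * lam * 0"
    by (intro tendsto_intros lim) auto
  then have "\<gamma> \<longlonglongrightarrow> 0" by (simp add: power_divide)
  then have "eventually (\<lambda>k. \<gamma> k < 1/10) sequentially" by (rule order_tendstoD) simp
  then obtain M where M: "\<And>k. k \<ge> M \<Longrightarrow> \<gamma> k < 1/10" unfolding eventually_sequentially by blast
  define p where "p = max M (Suc j)"
  have small: "0 \<le> \<gamma> k \<and> \<gamma> k \<le> 1/10 \<and> \<gamma> k = \<gamma> (Suc k) * (5 - \<gamma> (Suc k))" if k: "k \<ge> p" for k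
  proof -
    obtain l where l: "k = Suc l" "l \<ge> j" using k by (cases k) (auto simp: p_def)
    have "0 < \<gamma> k" unfolding l(1) by (rule decimation_parameters(1)[OF dec start l(2)])
    moreover have "\<gamma> k < 1/10" using k by (intro M) (simp add: p_def)
    moreover have "\<gamma> k = \<gamma> (Suc k) * (5 - \<gamma> (Suc k))"
      by (rule decimation_parameters(4)[OF dec start]) (use l in simp)
    ultimately show ?thesis by linarith
  qed
  have "j \<le> p" by (simp add: p_def)
  then have "\<forall>T. \<exists>e. decimation_function \<gamma> j T e"
  proof (induction rule: inc_induct)
    case base
    show ?case using decimation_function_exists_small[of p \<gamma>, OF small] by blast
  next
    case (step q)
    show ?case
    proof
      fix T
      define e where "e i = (SOME u. decimation_function \<gamma> (Suc q) (extend (\<gamma> (Suc q)) i T) u)" for i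
      have e: "decimation_function \<gamma> (Suc q) (extend (\<gamma> (Suc q)) i T) (e i)" for i
        unfolding e_def by (rule someI_ex[of "decimation_function \<gamma> (Suc q) (extend (\<gamma> (Suc q)) i T)"])
          (use step.IH in blast)
      have \<gamma>: "\<gamma> (Suc q) < 5" "\<gamma> (Suc q) \<noteq> 2" "\<gamma> q = \<gamma> (Suc q) * (5 - \<gamma> (Suc q))"
        using decimation_parameters(2,3,4)[OF dec start step.hyps(1)] by blast+
      have "\<gamma> (Suc q) \<noteq> 5" using \<gamma>(1) by simp
      from decimation_function_extend[OF \<gamma>(2) this \<gamma>(3) e]
      show "\<exists>e. decimation_function \<gamma> q T e" by blast
    qed
  qed
  then show ?thesis by blast
qed

subsection \<open>Localized eigenfunctions on two levels\<close>

text \<open>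
  The value \<open>T i k l\<close> is taken at the image of the \<open>l\<close>-th corner under the \<open>i\<close>-th and \<open>k\<close>-th maps.
\<close>

lemma localizable_of_seed:
  fixes T :: "nat \<Rightarrow> nat \<Rightarrow> nat \<Rightarrow> real"
  assumes dec: "decimation_sequence j \<epsilon> \<gamma>" and start: "\<gamma> j = 5 \<or> \<gamma> j = 6 \<and> \<epsilon> (Suc j) = 1"
    and lim: "(\<lambda>k. 3/2 * (5 ^ k * \<gamma> k)) \<longlonglongrightarrow> lam" and j: "j \<ge> 2"
    and T1: "\<And>i k l. i \<in> letters \<Longrightarrow> k \<in> letters \<Longrightarrow> l \<in> letters \<Longrightarrow> T i k l = T i l k"
    and T2: "\<And>i k. i \<in> letters \<Longrightarrow> k \<in> letters \<Longrightarrow> T i k k = T k i i"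
    and T3: "\<And>i. i \<in> letters \<Longrightarrow> T i i i = 0"
    and F1: "\<And>i k l. i \<in> letters \<Longrightarrow> k \<in> letters \<Longrightarrow> l \<in> letters \<Longrightarrow> k \<noteq> l \<Longrightarrow> flux (\<gamma> j) (T i k) l + flux (\<gamma> j) (T i l) k = 0"
    and F2: "\<And>i k. i \<in> letters \<Longrightarrow> k \<in> letters \<Longrightarrow> i \<noteq> k \<Longrightarrow> flux (\<gamma> j) (T i k) k + flux (\<gamma> j) (T k i) i = 0"
    and F3: "\<And>i. i \<in> letters \<Longrightarrow> flux (\<gamma> j) (T i i) i = 0"
    and nz: "i0 \<in> letters" "k0 \<in> letters" "l0 \<in> letters" "T i0 k0 l0 \<noteq> 0"
  shows "\<exists>v\<in>localizable (lam / 5 ^ (j - 2)). v \<noteq> (\<lambda>x. 0)"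
proof -
  define e where "e i k = (SOME u. decimation_function \<gamma> j (T i k) u)" for i k
  have e: "decimation_function \<gamma> j (T i k) (e i k)" for i k
    unfolding e_def by (rule someI_ex[OF decimation_function_exists[OF dec start lim]])
  have e_corner: "e i k (corner l) = T i k l" if "l \<in> letters" for i k l
    using e that unfolding decimation_function_def by blast
  have e_cont: "continuous_on SG (e i k)" for i k
    using e unfolding decimation_function_def by blast
  have e_eig: "discrete_eigen n (\<gamma> (j + n)) (e i k) (\<lambda>l. flux_factor \<gamma> j n * flux (\<gamma> j) (T i k) l)" for n i k
    using e unfolding decimation_function_def by blast
  define g where "g i = glue (e i)" for i
  define v where "v = glue g"
  have comp1: "compatible (e i)" if "i \<in> letters" for i
    using T1[OF that] e_corner by (simp add: compatible_def)
  have g_corner: "g i (corner k) = T i k k" if "i \<in> letters" "k \<in> letters" for i k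
    unfolding g_def using glue_corner[OF comp1[OF that(1)] that(2)] e_corner[OF that(2)] by simp
  have comp2: "compatible g" using g_corner T2 by (simp add: compatible_def)
  have v_corner: "v (corner i) = 0" if "i \<in> letters" for i
    unfolding v_def using glue_corner[OF comp2 that] g_corner[OF that that] T3[OF that] by simp
  have v_eig: "discrete_eigen (Suc (Suc n)) (\<gamma> (j + n)) v (\<lambda>i. flux_factor \<gamma> j n * flux (\<gamma> j) (T i i) i)" for n
    unfolding v_def
  proof (rule discrete_eigen_glue[OF comp2, where F = "\<lambda>i k. flux_factor \<gamma> j n * flux (\<gamma> j) (T i k) k"])
    show "discrete_eigen (Suc n) (\<gamma> (j + n)) (g i) (\<lambda>k. flux_factor \<gamma> j n * flux (\<gamma> j) (T i k) k)"
      if i: "i \<in> letters" for i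
      unfolding g_def
    proof (rule discrete_eigen_glue[OF comp1[OF i], where F = "\<lambda>k l. flux_factor \<gamma> j n * flux (\<gamma> j) (T i k) l"])
      show "discrete_eigen n (\<gamma> (j + n)) (e i k) (\<lambda>l. flux_factor \<gamma> j n * flux (\<gamma> j) (T i k) l)" for k
        by (rule e_eig)
      show "flux_factor \<gamma> j n * flux (\<gamma> j) (T i k) l + flux_factor \<gamma> j n * flux (\<gamma> j) (T i l) k = 0"
        if "k \<in> letters" "l \<in> letters" "k \<noteq> l" for k l
        using F1[OF i that] by (simp flip: distrib_left)
    qed
    show "flux_factor \<gamma> j n * flux (\<gamma> j) (T i k) k + flux_factor \<gamma> j n * flux (\<gamma> j) (T k i) i = 0"
      if "i \<in> letters" "k \<in> letters" "i \<noteq> k" for i k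
      using F2[OF that] by (simp flip: distrib_left)
  qed
  \<comment> \<open>At the boundary both the value and the flux of \<open>v\<close> vanish, so the
    equation holds there as well; this is what \<open>localizable\<close> asks beyond the Dirichlet
    condition.\<close>
  have neu: "neumann (Suc (Suc n)) v x = - \<gamma> (j + n) * v x" if "x \<in> vertices (Suc (Suc n))" for n x
  proof (cases "x \<in> vertices 0")
    case True
    then obtain i where i: "i \<in> letters" "x = corner i" unfolding vertices_0 by blast
    have "neumann (Suc (Suc n)) v (corner i) + \<gamma> (j + n) / 2 * v (corner i) = flux_factor \<gamma> j n * flux (\<gamma> j) (T i i) i"
      using v_eig[of n] i(1) unfolding discrete_eigen_def by blast
    then show ?thesis using v_corner[OF i(1)] F3[OF i(1)] i(2) by simp
  next
    case False
    then show ?thesis using v_eig[of n] that unfolding discrete_eigen_def by blast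
  qed
  have v_cont: "continuous_on SG v"
    unfolding v_def
  proof (rule continuous_on_glue[OF comp2])
    show "continuous_on SG (g i)" if "i \<in> letters" for i
      unfolding g_def by (rule continuous_on_glue[OF comp1[OF that] e_cont])
  qed
  obtain B where B: "B > 0" "\<And>x. x \<in> SG \<Longrightarrow> \<bar>v x\<bar> \<le> B" using bounded_on_SG[OF v_cont] by blast
  \<comment> \<open>Two levels are spent on the seed, so level \<open>n + 2\<close> carries the
    parameter with index \<open>j + n\<close>; this shift produces the division by
    \<open>5 ^ (j - 2)\<close>.\<close>
  define mu where "mu = lam / 5 ^ (j - 2)"
  have "(\<lambda>n. 3/2 * (5 ^ (n + j) * \<gamma> (n + j)) / 5 ^ (j - 2)) \<longlonglongrightarrow> mu"
    unfolding mu_def using LIMSEQ_ignore_initial_segment[OF lim, of j] by (intro tendsto_divide tendsto_const) auto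
  moreover have "3/2 * (5 ^ (n + j) * \<gamma> (n + j)) / 5 ^ (j - 2) = 3/2 * 5 ^ Suc (Suc n) * \<gamma> (j + n)" for n
  proof -
    have "n + j = Suc (Suc n) + (j - 2)" using j by simp
    then have "(5::real) ^ (n + j) = 5 ^ Suc (Suc n) * 5 ^ (j - 2)" by (metis power_add)
    then show ?thesis by (simp add: add.commute)
  qed
  ultimately have mu: "(\<lambda>n. 3/2 * 5 ^ Suc (Suc n) * \<gamma> (j + n)) \<longlonglongrightarrow> mu" by (simp only:)
  have "v \<in> localizable mu"
    unfolding localizable_def
  proof (intro CollectI conjI allI impI ballI v_cont v_corner)
    show "v x = 0" if "x \<notin> SG" for x using that by (simp add: v_def glue_outside)
    fix d :: real assume d: "d > 0"
    then have "d / B > 0" using B by simp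
    then obtain N where N: "\<And>n. n \<ge> N \<Longrightarrow> \<bar>3/2 * 5 ^ Suc (Suc n) * \<gamma> (j + n) - mu\<bar> < d / B"
      using LIMSEQ_D[OF mu] by (metis real_norm_def)
    have "\<bar>3/2 * 5 ^ m * neumann m v x + mu * v x\<bar> < d" if "m \<ge> Suc (Suc N)" "x \<in> vertices m" for m x
    proof -
      define n where "n = m - 2"
      have m: "m = Suc (Suc n)" "n \<ge> N" using that(1) by (simp_all add: n_def)
      have x: "x \<in> SG" using that(2) vertices_subset_SG by blast
      have "3/2 * 5 ^ m * neumann m v x + mu * v x = - ((3/2 * 5 ^ Suc (Suc n) * \<gamma> (j + n) - mu) * v x)"
        using neu[of x n] that(2) unfolding m(1) by (simp add: algebra_simps)
      then have "\<bar>3/2 * 5 ^ m * neumann m v x + mu * v x\<bar> = \<bar>3/2 * 5 ^ Suc (Suc n) * \<gamma> (j + n) - mu\<bar> * \<bar>v x\<bar>"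
        by (simp only: abs_minus_cancel abs_mult)
      also have "\<dots> \<le> \<bar>3/2 * 5 ^ Suc (Suc n) * \<gamma> (j + n) - mu\<bar> * B"
        using B(2)[OF x] by (intro mult_left_mono) auto
      also have "\<dots> < d / B * B" using N[OF m(2)] B(1) by (rule mult_strict_right_mono)
      finally show ?thesis using B(1) by simp
    qed
    then show "\<exists>N. \<forall>m\<ge>N. \<forall>x\<in>vertices m. \<bar>3/2 * 5 ^ m * neumann m v x + mu * v x\<bar> < d" by blast
  qed
  moreover have "v \<noteq> (\<lambda>x. 0)"
  proof
    assume "v = (\<lambda>x. 0)"
    moreover have "v (sg_map i0 (sg_map k0 (corner l0))) = T i0 k0 l0"
      using glue_sg_map[OF comp2 nz(1) sg_map_in_SG[OF nz(2) corner_in_SG[OF nz(3)]]]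
        glue_sg_map[OF comp1[OF nz(1)] nz(2) corner_in_SG[OF nz(3)]] e_corner[OF nz(3)]
      by (simp add: v_def g_def)
    ultimately show False using nz(4) by simp
  qed
  ultimately show ?thesis unfolding mu_def by blast
qed

text \<open>The values alternate around the hexagon formed by the six outer midpoints of the three 1-cells.\<close>

definition hexagon_seed :: "nat \<Rightarrow> nat \<Rightarrow> nat \<Rightarrow> real" where
  "hexagon_seed i k l = (if k = l \<or> (k \<noteq> i \<and> l \<noteq> i) then 0
     else let q = (if k = i then l else k) in
       if (i, q) \<in> {(1, 2), (2, 3), (3, 1)} then 1 else -1)"

text \<open>The support consists of the two 1-cells at the common corner of the cells 1 and 2, where the value is 2.\<close>

definition pair_seed :: "nat \<Rightarrow> nat \<Rightarrow> nat \<Rightarrow> real" where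
  "pair_seed i k l = (if i = 3 then 0 else let q = 3 - i in
     if k = q \<and> l = q then 2 else if k = l then 0 else if k = q \<or> l = q then -1 else 1)"

text \<open>The two seeds are eigenfunctions of the level 2 graph for 5 and 6 with neither values
  nor fluxes at the outer corners, which is a finite check; at position \<open>1 1 2\<close> both
  are nonzero.\<close>

lemma localizable_nontrivial:
  assumes series: "five_series j lam \<or> six_series j lam" and j: "j \<ge> 2"
  shows "\<exists>v\<in>localizable (lam / 5 ^ (j - 2)). v \<noteq> (\<lambda>x. 0)"
  using series
proof
  assume "five_series j lam"
  then obtain \<epsilon> \<gamma> where dec: "decimation_sequence j \<epsilon> \<gamma>" and 5: "\<gamma> j = 5"
    and lim: "(\<lambda>k. 3/2 * (5 ^ k * \<gamma> k)) \<longlonglongrightarrow> lam"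
    unfolding five_series_def by blast
  show ?thesis
    by (rule localizable_of_seed[OF dec _ lim j, of hexagon_seed 1 1 2])
      ((elim letters_cases)?; simp add: 5 flux_def hexagon_seed_def)+
next
  assume "six_series j lam"
  then obtain \<epsilon> \<gamma> where dec: "decimation_sequence j \<epsilon> \<gamma>" and 6: "\<gamma> j = 6" and \<epsilon>: "\<epsilon> (Suc j) = 1"
    and lim: "(\<lambda>k. 3/2 * (5 ^ k * \<gamma> k)) \<longlonglongrightarrow> lam"
    unfolding six_series_def by blast
  show ?thesis
    by (rule localizable_of_seed[OF dec _ lim j, of pair_seed 1 1 2])
      ((elim letters_cases)?; simp add: 6 \<epsilon> flux_def pair_seed_def)+
qed

section \<open>Compressions to finite-dimensional spaces\<close>

definition ip :: "(point \<Rightarrow> real) \<Rightarrow> (point \<Rightarrow> real) \<Rightarrow> real" where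
  "ip u v = (\<integral>x. u x * v x \<partial>sg_measure)"

lemma ip_commute: "ip u v = ip v u"
  by (simp add: ip_def mult.commute)

lemma ip_linear_left:
  assumes "continuous_on SG u" "continuous_on SG v" "continuous_on SG w"
  shows "ip (\<lambda>x. a * u x + b * v x) w = a * ip u w + b * ip v w"
proof -
  have "integrable sg_measure (\<lambda>x. u x * w x)" "integrable sg_measure (\<lambda>x. v x * w x)"
    using assms by (auto intro!: integrable_sg continuous_intros)
  then show ?thesis unfolding ip_def by (simp add: algebra_simps)
qed

lemma ip_sum_left:
  assumes "\<And>i. i \<in> I \<Longrightarrow> continuous_on SG (h i)" "continuous_on SG w"
  shows "ip (\<lambda>x. \<Sum>i\<in>I. h i x) w = (\<Sum>i\<in>I. ip (h i) w)"
proof -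
  have "integrable sg_measure (\<lambda>x. h i x * w x)" if "i \<in> I" for i
    using assms that by (auto intro!: integrable_sg continuous_intros)
  then show ?thesis unfolding ip_def by (simp add: sum_distrib_right)
qed

lemma ip_nonneg: "ip u u \<ge> 0"
  unfolding ip_def by (intro integral_nonneg_AE AE_I2) auto

text \<open>Functions on the gasket, represented by their extensions by zero.\<close>

definition sg_functions :: "(point \<Rightarrow> real) set" where
  "sg_functions = {u. continuous_on SG u \<and> (\<forall>x. x \<notin> SG \<longrightarrow> u x = 0)}"

lemma sg_functionsD:
  assumes "u \<in> sg_functions"
  shows "continuous_on SG u" "x \<notin> SG \<Longrightarrow> u x = 0"
  using assms unfolding sg_functions_def by blast+

lemma subspace_sg_functions: "fun_space.subspace sg_functions"
proof (rule subspaceI_linear)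
  show "sg_functions \<noteq> {}" unfolding sg_functions_def by (auto intro!: exI[of _ "\<lambda>x. 0"])
  show "(\<lambda>x. a * u x + b * v x) \<in> sg_functions" if "u \<in> sg_functions" "v \<in> sg_functions" for a b u v
    using that unfolding sg_functions_def by (auto intro!: continuous_intros)
qed

lemma span_sg_functions: "B \<subseteq> sg_functions \<Longrightarrow> fun_space.span B \<subseteq> sg_functions"
  by (rule fun_space.span_minimal[OF _ subspace_sg_functions])

lemma eq_0_of_ip:
  assumes "u \<in> sg_functions" "ip u u = 0"
  shows "u = (\<lambda>x. 0)"
proof
  fix x show "u x = 0"
    using SG_eqI_of_integral[of u x] sg_functionsD[OF assms(1)] assms(2)
    by (cases "x \<in> SG") (simp_all add: ip_def)
qed

lemma span_linear:
  assumes "u \<in> fun_space.span B" "v \<in> fun_space.span B"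
  shows "(\<lambda>x. a * u x + b * v x) \<in> fun_space.span B"
proof -
  have "fun_scale a u + fun_scale b v \<in> fun_space.span B"
    using assms by (intro fun_space.span_add fun_space.span_scale)
  then show ?thesis by (simp add: fun_scale_def plus_fun_def)
qed

text \<open>Gram-Schmidt: the new vector is replaced by \<open>b'\<close>, its difference from its
  projection onto the old span.\<close>

lemma projection_exists:
  assumes "finite B" "B \<subseteq> sg_functions" "continuous_on SG g"
  shows "\<exists>h\<in>fun_space.span B. \<forall>v\<in>fun_space.span B. ip (\<lambda>x. g x - h x) v = 0"
  using assms
proof (induction B arbitrary: g rule: finite_induct)
  case empty
  have "ip (\<lambda>x. g x - 0) (\<lambda>x. 0) = 0" by (simp add: ip_def)
  then show ?case by (simp add: zero_fun_def)
next
  case (insert b B)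
  have B: "B \<subseteq> sg_functions" and b: "b \<in> sg_functions" using insert.prems by auto
  have cont: "continuous_on SG u" if "u \<in> fun_space.span B" for u
    using span_sg_functions[OF B] that by (auto simp: sg_functions_def)
  have b_cont: "continuous_on SG b" using b by (rule sg_functionsD)
  obtain h0 where h0: "h0 \<in> fun_space.span B" "\<And>v. v \<in> fun_space.span B \<Longrightarrow> ip (\<lambda>x. g x - h0 x) v = 0"
    using insert.IH[OF B insert.prems(2)] by blast
  obtain p where p: "p \<in> fun_space.span B" "\<And>v. v \<in> fun_space.span B \<Longrightarrow> ip (\<lambda>x. b x - p x) v = 0"
    using insert.IH[OF B b_cont] by blast
  define b' where "b' x = b x - p x" for x
  have b': "ip b' v = 0" if "v \<in> fun_space.span B" for v using p(2)[OF that] by (simp add: b'_def[abs_def])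
  have b'_cont: "continuous_on SG b'" unfolding b'_def[abs_def] by (intro continuous_intros b_cont cont p)
  have mono: "fun_space.span B \<subseteq> fun_space.span (insert b B)" by (rule fun_space.span_mono) blast
  have "(\<lambda>x. 1 * b x + (-1) * p x) \<in> fun_space.span (insert b B)"
    using mono p(1) by (intro span_linear) (auto intro: fun_space.span_base)
  then have b'_span: "b' \<in> fun_space.span (insert b B)" by (simp add: b'_def[abs_def])
  \<comment> \<open>If \<open>b'\<close> is 0, division by zero gives \<open>c = 0\<close>, and
    orthogonality to \<open>b'\<close> is trivial.\<close>
  define c where "c = ip g b' / ip b' b'"
  define h where "h x = 1 * h0 x + c * b' x" for x
  have h_span: "h \<in> fun_space.span (insert b B)"
    unfolding h_def[abs_def] using mono h0(1) b'_span by (intro span_linear) auto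
  have gh0_cont: "continuous_on SG (\<lambda>x. g x - h0 x)" by (intro continuous_intros insert.prems(2) cont h0)
  have split: "ip (\<lambda>x. g x - h x) w = ip (\<lambda>x. g x - h0 x) w - c * ip b' w" if "continuous_on SG w" for w
    using ip_linear_left[OF gh0_cont b'_cont that, of 1 "- c"] by (simp add: h_def[abs_def] algebra_simps)
  have zero_b': "ip (\<lambda>x. g x - h x) b' = 0"
  proof (cases "ip b' b' = 0")
    case True
    have "b' \<in> sg_functions"
      using b'_span span_sg_functions[OF insert.prems(1)] by blast
    then have "b' = (\<lambda>x. 0)" using True by (rule eq_0_of_ip)
    then show ?thesis by (simp add: ip_def)
  next
    case False
    have "ip (\<lambda>x. g x - h0 x) b' = ip g b' - ip h0 b'"
      using ip_linear_left[OF insert.prems(2) cont[OF h0(1)] b'_cont, of 1 "-1"] by simp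
    also have "ip h0 b' = 0" using b'[OF h0(1)] by (simp add: ip_commute)
    finally show ?thesis using split[OF b'_cont] False by (simp add: c_def)
  qed
  have "ip (\<lambda>x. g x - h x) v = 0" if v: "v \<in> fun_space.span (insert b B)" for v
  proof -
    obtain k where k: "v - fun_scale k b \<in> fun_space.span B"
      using fun_space.span_breakdown[of b "insert b B" v] v insert.hyps(2) by auto
    define w where "w x = 1 * (v - fun_scale k b) x + k * p x" for x
    have w: "w \<in> fun_space.span B" unfolding w_def[abs_def] by (intro span_linear k p)
    have v_eq: "v = (\<lambda>x. k * b' x + 1 * w x)"
      by (simp add: w_def b'_def fun_scale_def fun_eq_iff algebra_simps)
    have gh_cont: "continuous_on SG (\<lambda>x. g x - h x)"
      unfolding h_def[abs_def] by (intro continuous_intros insert.prems(2) cont h0 b'_cont)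
    have "ip (\<lambda>x. g x - h x) v = k * ip (\<lambda>x. g x - h x) b' + ip (\<lambda>x. g x - h x) w"
      unfolding v_eq ip_commute[of "\<lambda>x. g x - h x"]
      using ip_linear_left[OF b'_cont cont[OF w] gh_cont, of k 1] by simp
    then show ?thesis using zero_b' split[OF cont[OF w]] h0(2)[OF w] b'[OF w] by simp
  qed
  then show ?case using h_span by blast
qed

text \<open>The inner product is definite on functions represented by their extension by zero, so
  the projection is unique and the description in \<open>l2_projection\<close> denotes it.\<close>

lemma l2_projection:
  assumes V: "fun_space.subspace V" "V \<subseteq> sg_functions" "V \<subseteq> fun_space.span B" "finite B" and g: "continuous_on SG g"
  shows "l2_projection V g \<in> V" "v \<in> V \<Longrightarrow> ip (\<lambda>x. g x - l2_projection V g x) v = 0"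
proof -
  obtain C where C: "C \<subseteq> V" "V \<subseteq> fun_space.span C" "finite C"
    using basis_of_finite_span[OF V(3,4)] by metis
  have span: "fun_space.span C = V"
    using C(1,2) fun_space.span_minimal[OF C(1) V(1)] by blast
  have "\<exists>h\<in>V. \<forall>v\<in>V. ip (\<lambda>x. g x - h x) v = 0"
    using projection_exists[OF C(3) _ g] C(1) V(2) unfolding span by blast
  then obtain h where h: "h \<in> V" "\<forall>v\<in>V. ip (\<lambda>x. g x - h x) v = 0" by blast
  have "h' = h" if h': "h' \<in> V" "\<forall>v\<in>V. ip (\<lambda>x. g x - h' x) v = 0" for h'
  proof -
    have cont: "continuous_on SG h" "continuous_on SG h'"
      using h(1) h'(1) V(2) by (auto simp: sg_functions_def)
    define d where "d x = 1 * h' x + (-1) * h x" for x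
    have "h' - h \<in> V" by (rule fun_space.subspace_diff[OF V(1) h'(1) h(1)])
    moreover have "d = h' - h" by (simp add: d_def fun_eq_iff)
    ultimately have d: "d \<in> V" by simp
    have "ip d d = ip (\<lambda>x. 1 * (g x - h x) + (-1) * (g x - h' x)) d"
      by (rule arg_cong[where f = "\<lambda>u. ip u d"]) (simp add: d_def fun_eq_iff)
    also have "\<dots> = 1 * ip (\<lambda>x. g x - h x) d + (-1) * ip (\<lambda>x. g x - h' x) d"
      using d V(2) by (intro ip_linear_left continuous_intros g cont) (auto simp: sg_functions_def)
    also have "\<dots> = 0" using h(2) h'(2) d by simp
    finally have "d = (\<lambda>x. 0)" using d V(2) by (intro eq_0_of_ip) auto
    then show ?thesis by (simp add: d_def fun_eq_iff)
  qed
  then have "(THE h. h \<in> V \<and> (\<forall>v\<in>V. ip (\<lambda>x. g x - h x) v = 0)) = h"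
    using h by (intro the_equality conjI) blast+
  then have eq: "l2_projection V g = h"
    unfolding l2_projection_def ip_def .
  show "l2_projection V g \<in> V" "v \<in> V \<Longrightarrow> ip (\<lambda>x. g x - l2_projection V g x) v = 0"
    unfolding eq using h by blast+
qed

lemma l2_projection_id:
  assumes V: "fun_space.subspace V" "V \<subseteq> sg_functions" "V \<subseteq> fun_space.span B" "finite B" and u: "u \<in> V"
  shows "l2_projection V u = u"
proof -
  have cont: "continuous_on SG u" using u V(2) by (auto simp: sg_functions_def)
  let ?h = "l2_projection V u"
  have h: "?h \<in> V" "\<And>v. v \<in> V \<Longrightarrow> ip (\<lambda>x. u x - ?h x) v = 0"
    using l2_projection[OF V cont] by blast+
  have "u - ?h \<in> V" by (rule fun_space.subspace_diff[OF V(1) u h(1)])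
  then have d: "(\<lambda>x. u x - ?h x) \<in> V" by (simp add: fun_diff_def)
  have "(\<lambda>x. u x - ?h x) = (\<lambda>x. 0)"
    using d V(2) h(2)[OF d] by (intro eq_0_of_ip) auto
  then show ?thesis by (auto simp: fun_eq_iff)
qed

text \<open>Testing against elements of \<open>V\<close> removes the projections. In this weak form
  of the eigenvalue equation the symmetry in \<open>u\<close> and \<open>v\<close> is
  visible.\<close>

lemma eigenvector_compression:
  assumes V: "fun_space.subspace V" "V \<subseteq> sg_functions" "V \<subseteq> fun_space.span B" "finite B"
    and f: "continuous_on SG f" and u: "u \<in> V" and eig: "compressed_multiplication V f u = fun_scale t u"
    and v: "v \<in> V"
  shows "ip (\<lambda>x. f x * u x) v = t * ip u v"
proof -
  have cont: "continuous_on SG u" "continuous_on SG v" using u v V(2) by (auto simp: sg_functions_def)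
  have fu: "continuous_on SG (\<lambda>x. f x * u x)" by (intro continuous_intros f cont)
  have "l2_projection V (\<lambda>x. f x * u x) = fun_scale t u"
    using eig unfolding compressed_multiplication_def l2_projection_id[OF V u] .
  then have "0 = ip (\<lambda>x. 1 * (f x * u x) + (- t) * u x) v"
    using l2_projection(2)[OF V fu v] by (simp add: fun_scale_def)
  also have "\<dots> = 1 * ip (\<lambda>x. f x * u x) v + (- t) * ip u v" by (rule ip_linear_left[OF fu cont])
  finally show ?thesis by simp
qed

section \<open>Counting eigenvalues on one side of a threshold\<close>

text \<open>An indexed family rather than a set: one function might occur at two indices, which the
  independence of the family excludes.\<close>

lemma card_le_of_independent_family:
  fixes h :: "'i \<Rightarrow> 'a \<Rightarrow> real"
  assumes I: "finite I" and B: "finite B" "\<And>i. i \<in> I \<Longrightarrow> h i \<in> fun_space.span B"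
    and ind: "\<And>a i. (\<And>x. (\<Sum>i\<in>I. a i * h i x) = 0) \<Longrightarrow> i \<in> I \<Longrightarrow> a i = 0"
  shows "card I \<le> card B"
proof -
  have inj: "inj_on h I"
  proof (rule inj_onI, rule ccontr)
    fix i j assume ij: "i \<in> I" "j \<in> I" "h i = h j" "i \<noteq> j"
    define a where "a k = (if k = i then 1 else 0) - (if k = j then 1 else (0::real))" for k
    have "(\<Sum>k\<in>I. a k * h k x) = 0" for x
    proof -
      have "(\<Sum>k\<in>I. a k * h k x) = (\<Sum>k\<in>I. (if k = i then h k x else 0) - (if k = j then h k x else 0))"
        by (intro sum.cong) (auto simp: a_def)
      then show ?thesis using ij I by (simp add: sum_subtractf)
    qed
    from ind[of a, OF this ij(1)] show False using ij(4) by (simp add: a_def)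
  qed
  have "a b = 0" if zero: "(\<Sum>b\<in>h ` I. fun_scale (a b) b) = 0" and b: "b \<in> h ` I" for a b
  proof -
    obtain i where i: "i \<in> I" "b = h i" using b by blast
    have "(\<Sum>i\<in>I. a (h i) * h i x) = 0" for x
    proof -
      have "(\<Sum>i\<in>I. a (h i) * h i x) = (\<Sum>b\<in>h ` I. fun_scale (a b) b) x"
        by (simp add: sum_apply fun_scale_def sum.reindex[OF inj])
      then show ?thesis using zero by simp
    qed
    from ind[of "\<lambda>i. a (h i)", OF this i(1)] show ?thesis using i(2) by simp
  qed
  moreover have "finite (h ` I)" using I by simp
  ultimately have "fun_space.independent (h ` I)"
    unfolding fun_space.dependent_finite[OF \<open>finite (h ` I)\<close>] by blast
  moreover have "h ` I \<subseteq> fun_space.span B" using B(2) by blast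
  ultimately have "card (h ` I) \<le> card B"
    using fun_space.independent_span_bound[OF B(1)] by blast
  then show ?thesis by (simp add: card_image[OF inj])
qed

text \<open>
  The space spanned by \<open>X\<close>, on which the quadratic form of \<open>f - t\<close> has one sign, meets the span of
  the eigenvectors whose eigenvalue lies on the other side of \<open>t\<close> only in zero. The factor \<open>c\<close> of
  modulus one covers both signs.
\<close>

lemma eigenvalue_count_ge:
  assumes V: "fun_space.subspace V" "V \<subseteq> sg_functions" "V \<subseteq> fun_space.span B" "finite B"
    and f: "continuous_on SG f"
    and listing: "eigenvalue_listing V (compressed_multiplication V f) \<sigma>"
    and X: "X \<subseteq> V" "fun_space.independent X" "finite X"
    and sign: "\<And>u. u \<in> fun_space.span X \<Longrightarrow> c * (ip (\<lambda>x. f x * u x) u - t * ip u u) \<ge> 0"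
  shows "card X \<le> card {k \<in> {1..fun_space.dim V}. c * (\<sigma> k - t) \<ge> 0}"
proof -
  let ?d = "fun_space.dim V"
  define Eig where "Eig s = {u \<in> V. compressed_multiplication V f u = fun_scale s u}" for s
  have "\<exists>C. C \<subseteq> Eig s \<and> fun_space.independent C \<and> finite C \<and> card C = fun_space.dim (Eig s)" for s
  proof -
    have "Eig s \<subseteq> fun_space.span B" using V(3) by (auto simp: Eig_def)
    then show ?thesis using basis_of_finite_span[OF _ V(4)] by metis
  qed
  then obtain C where C: "\<And>s. C s \<subseteq> Eig s" "\<And>s. fun_space.independent (C s)" "\<And>s. finite (C s)"
      "\<And>s. card (C s) = fun_space.dim (Eig s)"
    by metis
  \<comment> \<open>The eigenvalues on the wrong side of \<open>t\<close>; the listing turns their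
    number, with multiplicity, into a sum of dimensions.\<close>
  define S where "S = \<sigma> ` {k \<in> {1..?d}. c * (\<sigma> k - t) < 0}"
  have finS: "finite S" by (simp add: S_def)
  have cardS: "(\<Sum>s\<in>S. card (C s)) = card {k \<in> {1..?d}. c * (\<sigma> k - t) < 0}"
  proof -
    have "{k \<in> {1..?d}. c * (\<sigma> k - t) < 0} = (\<Union>s\<in>S. {k \<in> {1..?d}. \<sigma> k = s})"
      by (auto simp: S_def)
    also have "card \<dots> = (\<Sum>s\<in>S. card {k \<in> {1..?d}. \<sigma> k = s})"
      by (rule card_UN_disjoint) (auto simp: finS)
    also have "\<dots> = (\<Sum>s\<in>S. card (C s))"
      using listing unfolding eigenvalue_listing_def C(4) Eig_def by simp
    finally show ?thesis by simp
  qed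
  \<comment> \<open>\<open>None\<close> stands for \<open>X\<close> and \<open>Some s\<close> for
    the eigenspace of \<open>s\<close>; independence of the combined family bounds the sum of the
    dimensions by \<open>?d\<close>.\<close>
  define Z where "Z = insert None (Some ` S)"
  define D where "D z = (case z of None \<Rightarrow> X | Some s \<Rightarrow> C s)" for z
  define I where "I = Sigma Z D"
  have finD: "finite (D z)" for z using X(3) C(3) by (simp add: D_def split: option.split)
  have indD: "fun_space.independent (D z)" for z using X(2) C(2) by (simp add: D_def split: option.split)
  have DV: "D z \<subseteq> V" for z using X(1) C(1) by (auto simp: D_def Eig_def split: option.split)
  have finZ: "finite Z" by (simp add: Z_def finS)
  have finI: "finite I" unfolding I_def using finZ finD by (intro finite_SigmaI)
  have sumZ: "(\<Sum>z\<in>Z. F z) = F None + (\<Sum>s\<in>S. F (Some s))" for F :: "real option \<Rightarrow> 'b :: comm_monoid_add"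
    unfolding Z_def using finS by (subst sum.insert) (auto simp: sum.reindex)
  have cardI: "card I = card X + card {k \<in> {1..?d}. c * (\<sigma> k - t) < 0}"
    unfolding I_def using finZ finD by (subst card_SigmaI) (simp_all add: sumZ D_def cardS)
  obtain BV where BV: "V \<subseteq> fun_space.span BV" "finite BV" "card BV = ?d"
    using basis_of_finite_span[OF V(3,4)] by metis
  have "card I \<le> card BV"
  proof (rule card_le_of_independent_family[OF finI BV(2), of snd])
    show "snd i \<in> fun_space.span BV" if "i \<in> I" for i
    proof -
      have "snd i \<in> D (fst i)" using that by (auto simp: I_def)
      then show ?thesis using DV BV(1) by blast
    qed
    fix a :: "real option \<times> (point \<Rightarrow> real) \<Rightarrow> real" and i
    assume zero: "\<And>x. (\<Sum>i\<in>I. a i * snd i x) = 0" and i: "i \<in> I"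
    define y where "y z x = (\<Sum>b\<in>D z. a (z, b) * b x)" for z x
    have y_eq: "y z = (\<Sum>b\<in>D z. fun_scale (a (z, b)) b)" for z
      by (simp add: y_def fun_eq_iff sum_apply fun_scale_def)
    have y_span: "y z \<in> fun_space.span (D z)" for z
      unfolding y_eq by (intro fun_space.span_sum fun_space.span_scale fun_space.span_base)
    have y_V: "y z \<in> V" for z
      using y_span fun_space.span_minimal[OF DV V(1)] by blast
    have y_sg: "y z \<in> sg_functions" for z using y_V V(2) by blast
    have y_cont: "continuous_on SG (y z)" for z using y_sg by (rule sg_functionsD)
    have total: "y None x + (\<Sum>s\<in>S. y (Some s) x) = 0" for x
    proof -
      have "(\<Sum>i\<in>I. a i * snd i x) = (\<Sum>z\<in>Z. y z x)"
        unfolding I_def y_def using finZ finD by (subst sum.Sigma) (auto intro!: sum.cong)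
      then show ?thesis using zero[of x] by (simp add: sumZ)
    qed
    have eig: "ip (\<lambda>x. f x * y (Some s) x) v = s * ip (y (Some s)) v" if v: "v \<in> V" for s v
    proof -
      have v_cont: "continuous_on SG v" using v V(2) by (auto simp: sg_functions_def)
      have b_cont: "continuous_on SG b" if "b \<in> C s" for b
        using that C(1) V(2) by (auto simp: Eig_def sg_functions_def)
      have "ip (\<lambda>x. f x * y (Some s) x) v = ip (\<lambda>x. \<Sum>b\<in>C s. a (Some s, b) * (f x * b x)) v"
        by (simp add: y_def D_def sum_distrib_left mult.left_commute)
      also have "\<dots> = (\<Sum>b\<in>C s. ip (\<lambda>x. a (Some s, b) * (f x * b x)) v)"
        by (intro ip_sum_left continuous_intros f b_cont v_cont)
      also have "\<dots> = (\<Sum>b\<in>C s. s * ip (\<lambda>x. a (Some s, b) * b x) v)"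
      proof (rule sum.cong[OF refl])
        fix b assume b: "b \<in> C s"
        have bV: "b \<in> V" "compressed_multiplication V f b = fun_scale s b"
          using b C(1) by (auto simp: Eig_def)
        have "ip (\<lambda>x. a (Some s, b) * (f x * b x)) v = a (Some s, b) * ip (\<lambda>x. f x * b x) v"
          by (simp add: ip_def mult.assoc)
        also have "\<dots> = a (Some s, b) * (s * ip b v)"
          by (simp add: eigenvector_compression[OF V f bV v])
        also have "\<dots> = s * ip (\<lambda>x. a (Some s, b) * b x) v"
          by (simp add: ip_def mult.assoc)
        finally show "ip (\<lambda>x. a (Some s, b) * (f x * b x)) v = s * ip (\<lambda>x. a (Some s, b) * b x) v" .
      qed
      also have "\<dots> = s * ip (\<lambda>x. \<Sum>b\<in>C s. a (Some s, b) * b x) v"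
      proof -
        have "continuous_on SG (\<lambda>x. a (Some s, b) * b x)" if "b \<in> C s" for b
          by (intro continuous_on_mult_left b_cont that)
        from ip_sum_left[of "C s" "\<lambda>b x. a (Some s, b) * b x", OF this v_cont]
        show ?thesis by (simp add: sum_distrib_left)
      qed
      finally show ?thesis by (simp add: y_def[abs_def] D_def)
    qed
    \<comment> \<open>The form of \<open>f\<close> is symmetric, so eigenvectors for different
      eigenvalues are orthogonal.\<close>
    have orth: "ip (y (Some s)) (y (Some r)) = 0" if "s \<noteq> r" for s r
    proof -
      have "s * ip (y (Some s)) (y (Some r)) = ip (\<lambda>x. f x * y (Some s) x) (y (Some r))"
        using eig[OF y_V] by simp
      also have "\<dots> = ip (\<lambda>x. f x * y (Some r) x) (y (Some s))"
        unfolding ip_def by (intro Bochner_Integration.integral_cong) auto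
      also have "\<dots> = r * ip (y (Some s)) (y (Some r))"
        using eig[OF y_V] by (simp add: ip_commute)
      finally show ?thesis using that by simp
    qed
    define u where "u x = (\<Sum>s\<in>S. y (Some s) x)" for x
    have u_cont: "continuous_on SG u" unfolding u_def[abs_def] by (intro continuous_intros y_cont)
    have u_V: "u \<in> V"
    proof -
      have "(\<Sum>s\<in>S. y (Some s)) \<in> V" by (intro fun_space.subspace_sum V(1) y_V)
      moreover have "(\<Sum>s\<in>S. y (Some s)) = u" by (simp add: fun_eq_iff u_def sum_apply)
      ultimately show ?thesis by simp
    qed
    have u_y: "ip (y (Some s)) u = ip (y (Some s)) (y (Some s))" if s: "s \<in> S" for s
    proof -
      have "ip (y (Some s)) u = ip u (y (Some s))" by (rule ip_commute)
      also have "\<dots> = (\<Sum>r\<in>S. ip (y (Some r)) (y (Some s)))"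
        unfolding u_def[abs_def] by (intro ip_sum_left y_cont)
      also have "\<dots> = (\<Sum>r\<in>S. if r = s then ip (y (Some s)) (y (Some s)) else 0)"
        using orth by (intro sum.cong) auto
      finally show ?thesis using s finS by simp
    qed
    have uu: "ip u u = (\<Sum>s\<in>S. ip (y (Some s)) (y (Some s)))"
    proof -
      have "ip u u = (\<Sum>s\<in>S. ip (y (Some s)) u)"
        using ip_sum_left[of S "\<lambda>s. y (Some s)" u] y_cont u_cont by (simp add: u_def[abs_def])
      then show ?thesis using u_y by simp
    qed
    have fuu: "ip (\<lambda>x. f x * u x) u = (\<Sum>s\<in>S. s * ip (y (Some s)) (y (Some s)))"
    proof -
      have "ip (\<lambda>x. f x * u x) u = ip (\<lambda>x. \<Sum>s\<in>S. f x * y (Some s) x) u"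
        by (simp add: u_def sum_distrib_left)
      also have "\<dots> = (\<Sum>s\<in>S. ip (\<lambda>x. f x * y (Some s) x) u)"
        by (intro ip_sum_left continuous_intros f y_cont u_cont)
      finally show ?thesis using eig[OF u_V] u_y by simp
    qed
    \<comment> \<open>The relation puts \<open>u\<close>, a sum of eigenvectors, into the span of
      \<open>X\<close> up to sign. The form at \<open>u\<close> is nonnegative by
      \<open>sign\<close> and, expanded in eigenvectors, a sum of nonpositive terms; so every
      component vanishes.\<close>
    have "y None = (\<lambda>x. - u x)"
      using total by (auto simp: fun_eq_iff u_def add_eq_0_iff2)
    moreover have "y None \<in> fun_space.span X" using y_span[of None] by (simp add: D_def)
    ultimately have "c * (ip (\<lambda>x. f x * - u x) (\<lambda>x. - u x) - t * ip (\<lambda>x. - u x) (\<lambda>x. - u x)) \<ge> 0"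
      using sign by metis
    then have "0 \<le> c * (ip (\<lambda>x. f x * u x) u - t * ip u u)" by (simp add: ip_def)
    also have "\<dots> = (\<Sum>s\<in>S. c * (s - t) * ip (y (Some s)) (y (Some s)))"
      unfolding uu fuu by (simp add: sum_distrib_left sum_subtractf algebra_simps)
    finally have nonneg: "0 \<le> (\<Sum>s\<in>S. c * (s - t) * ip (y (Some s)) (y (Some s)))" .
    have neg: "c * (s - t) < 0" if "s \<in> S" for s using that by (auto simp: S_def)
    have nonpos: "c * (s - t) * ip (y (Some s)) (y (Some s)) \<le> 0" if "s \<in> S" for s
      by (rule mult_nonpos_nonneg[OF less_imp_le[OF neg[OF that]] ip_nonneg])
    have "(\<Sum>s\<in>S. - (c * (s - t) * ip (y (Some s)) (y (Some s)))) = 0"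
      using nonneg sum_nonpos[of S "\<lambda>s. c * (s - t) * ip (y (Some s)) (y (Some s))"] nonpos
      by (simp add: sum_negf)
    then have "c * (s - t) * ip (y (Some s)) (y (Some s)) = 0" if "s \<in> S" for s
      using sum_nonneg_eq_0_iff[OF finS, of "\<lambda>s. - (c * (s - t) * ip (y (Some s)) (y (Some s)))"] nonpos that by auto
    then have y0: "y (Some s) = (\<lambda>x. 0)" if "s \<in> S" for s
      using neg[OF that] that y_sg by (intro eq_0_of_ip) (auto simp: less_le)
    have yN: "y None = (\<lambda>x. 0)"
      using total y0 by (auto simp: fun_eq_iff)
    obtain z b where zb: "i = (z, b)" "z \<in> Z" "b \<in> D z" using i by (auto simp: I_def)
    have "y z = 0" using zb(2) y0 yN by (auto simp: Z_def zero_fun_def)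
    then have "(\<Sum>b\<in>D z. fun_scale (a (z, b)) b) = 0" using y_eq by simp
    then show "a i = 0"
      using fun_space.independentD[OF indD finD order_refl, of "\<lambda>b. a (z, b)" z b] zb by simp
  qed
  then have "card X + card {k \<in> {1..?d}. c * (\<sigma> k - t) < 0} \<le> ?d" by (simp add: cardI BV(3))
  moreover have "card {k \<in> {1..?d}. c * (\<sigma> k - t) < 0} + card {k \<in> {1..?d}. c * (\<sigma> k - t) \<ge> 0} = ?d"
  proof -
    have "{1..?d} = {k \<in> {1..?d}. c * (\<sigma> k - t) < 0} \<union> {k \<in> {1..?d}. c * (\<sigma> k - t) \<ge> 0}" by auto
    then have "card {1..?d} = card {k \<in> {1..?d}. c * (\<sigma> k - t) < 0} + card {k \<in> {1..?d}. c * (\<sigma> k - t) \<ge> 0}"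
      by (metis (no_types, lifting) card_Un_disjoint disjoint_iff finite_atLeastAtMost finite_Un linorder_not_less mem_Collect_eq)
    then show ?thesis by simp
  qed
  ultimately show ?thesis by linarith
qed

lemma dirichlet_subset_sg_functions: "dirichlet_eigenspace lam \<subseteq> sg_functions"
  unfolding dirichlet_eigenspace_eq solutions_def sg_functions_def by blast

lemma quadratic_form_eq:
  assumes "continuous_on SG f" "continuous_on SG u"
  shows "c * (ip (\<lambda>x. f x * u x) u - t * ip u u) = (\<integral>x. c * (f x - t) * (u x * u x) \<partial>sg_measure)"
proof -
  have "integrable sg_measure (\<lambda>x. f x * u x * u x)" "integrable sg_measure (\<lambda>x. u x * u x)"
    using assms by (auto intro!: integrable_sg continuous_intros)
  then have "ip (\<lambda>x. f x * u x) u - t * ip u u = (\<integral>x. f x * u x * u x - t * (u x * u x) \<partial>sg_measure)"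
    unfolding ip_def by simp
  then have "c * (ip (\<lambda>x. f x * u x) u - t * ip u u) = (\<integral>x. c * (f x * u x * u x - t * (u x * u x)) \<partial>sg_measure)"
    by simp
  then show ?thesis by (simp add: algebra_simps)
qed

text \<open>The test space consists of the transplants into the cells of \<open>W\<close>. Their
  combinations vanish on all other cells, so the integrand of the form has the sign prescribed on
  \<open>W\<close>.\<close>

lemma eigenvalue_count_cells:
  assumes f: "continuous_on SG f"
    and listing: "eigenvalue_listing (dirichlet_eigenspace lam) (compressed_multiplication (dirichlet_eigenspace lam) f) \<sigma>"
    and W: "W \<subseteq> words N" "\<And>w x. w \<in> W \<Longrightarrow> x \<in> SG \<Longrightarrow> c * (f (word_map w x) - t) \<ge> 0"
  shows "card W * fun_space.dim (localizable (lam / 5 ^ N)) \<le>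
    card {k \<in> {1..fun_space.dim (dirichlet_eigenspace lam)}. c * (\<sigma> k - t) \<ge> 0}"
proof -
  let ?E = "dirichlet_eigenspace lam"
  obtain B where B: "finite B" "?E \<subseteq> fun_space.span B" by (rule dirichlet_eigenspace_finite_span)
  obtain C where C: "C \<subseteq> localizable (lam / 5 ^ N)" "fun_space.independent C" "finite C"
      "card C = fun_space.dim (localizable (lam / 5 ^ N))"
    by (rule localizable_basis)
  let ?X = "(\<lambda>(w, c). transplant w c) ` (W \<times> C)"
  have X: "?X \<subseteq> ?E" "fun_space.independent ?X" "card ?X = card W * card C"
    using transplanted_basis[OF C(1-3) W(1)] by blast+
  have "finite W" using W(1) finite_words finite_subset by blast
  then have finX: "finite ?X" using C(3) by simp
  have "card ?X \<le> card {k \<in> {1..fun_space.dim ?E}. c * (\<sigma> k - t) \<ge> 0}"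
  proof (rule eigenvalue_count_ge[OF subspace_dirichlet_eigenspace dirichlet_subset_sg_functions B(2,1) f listing X(1,2) finX])
    fix u assume u: "u \<in> fun_space.span ?X"
    let ?U = "{u. \<forall>w\<in>words N - W. \<forall>x\<in>SG. u (word_map w x) = (0 :: real)}"
    have "fun_space.subspace ?U"
      by (rule subspaceI_linear) (auto intro!: exI[of _ "\<lambda>x. 0"])
    moreover have "?X \<subseteq> ?U"
    proof clarify
      fix w c w' x assume *: "w \<in> W" "c \<in> C" "w' \<in> words N" "w' \<notin> W" "x \<in> SG"
      then have "c \<in> localizable (lam / 5 ^ N)" "w \<in> words N" "w' \<noteq> w" using C(1) W(1) by blast+
      then show "transplant w c (word_map w' x) = 0"
        using transplant_word_map[of c "lam / 5 ^ N" w N w' x] * by simp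
    qed
    ultimately have zero: "u \<in> ?U" using fun_space.span_minimal[of ?X ?U] u by blast
    have "u \<in> sg_functions"
      using u X(1) dirichlet_subset_sg_functions span_sg_functions[of ?X] by blast
    then have u_cont: "continuous_on SG u" by (rule sg_functionsD)
    have "0 \<le> c * (f x - t) * (u x * u x)" if x: "x \<in> SG" for x
    proof -
      obtain w y where w: "w \<in> words N" "y \<in> SG" "x = word_map w y" using x SG_eq_UN_words[of N] by blast
      show ?thesis
      proof (cases "w \<in> W")
        case True
        then show ?thesis unfolding w(3) by (intro mult_nonneg_nonneg[OF W(2)[OF True w(2)]]) simp
      next
        case False
        then have "u x = 0" using zero w by blast
        then show ?thesis by simp
      qed
    qed
    then show "0 \<le> c * (ip (\<lambda>x. f x * u x) u - t * ip u u)"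
      unfolding quadratic_form_eq[OF f u_cont] by (intro integral_nonneg_AE AE_I2) simp
  qed
  then show ?thesis using X(3) C(4) by simp
qed

text \<open>When the sign holds on the entire gasket, the whole eigenspace is a test space, so the
  count covers every eigenvalue: bounds of \<open>f\<close> pass to the \<sigma>'s.\<close>

lemma eigenvalue_bound:
  assumes f: "continuous_on SG f"
    and listing: "eigenvalue_listing (dirichlet_eigenspace lam) (compressed_multiplication (dirichlet_eigenspace lam) f) \<sigma>"
    and t: "\<And>x. x \<in> SG \<Longrightarrow> c * (f x - t) \<ge> 0"
    and k: "k \<in> {1..fun_space.dim (dirichlet_eigenspace lam)}"
  shows "c * (\<sigma> k - t) \<ge> 0"
proof -
  let ?E = "dirichlet_eigenspace lam"
  obtain B where B: "finite B" "?E \<subseteq> fun_space.span B" by (rule dirichlet_eigenspace_finite_span)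
  obtain X where X: "X \<subseteq> ?E" "fun_space.independent X" "finite X" "card X = fun_space.dim ?E"
    using basis_of_finite_span[OF B(2,1)] by metis
  have "card X \<le> card {k \<in> {1..fun_space.dim ?E}. c * (\<sigma> k - t) \<ge> 0}"
  proof (rule eigenvalue_count_ge[OF subspace_dirichlet_eigenspace dirichlet_subset_sg_functions B(2,1) f listing X(1-3)])
    fix u assume u: "u \<in> fun_space.span X"
    then have "u \<in> sg_functions"
      using X(1) dirichlet_subset_sg_functions span_sg_functions[of X] by blast
    then have u_cont: "continuous_on SG u" by (rule sg_functionsD)
    show "0 \<le> c * (ip (\<lambda>x. f x * u x) u - t * ip u u)"
      unfolding quadratic_form_eq[OF f u_cont] using t by (intro integral_nonneg_AE AE_I2) simp
  qed
  then have "{k \<in> {1..fun_space.dim ?E}. c * (\<sigma> k - t) \<ge> 0} = {1..fun_space.dim ?E}"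
    unfolding X(4) by (intro card_seteq) auto
  then show ?thesis using k by blast
qed

section \<open>Convergence of the averages\<close>

text \<open>Greedy matching: the largest \<open>b j\<close> is paired with some \<open>a k\<close>
  above it, and both are removed. Nonnegativity of \<open>G\<close> accounts for the unmatched part
  of \<open>K\<close>.\<close>

lemma sum_le_of_counts:
  fixes a :: "'k \<Rightarrow> real" and b :: "'j \<Rightarrow> real"
  assumes "finite J" "finite K" "mono G" "\<And>y. G y \<ge> (0 :: real)"
    and "\<And>t. card {j \<in> J. b j \<ge> t} \<le> card {k \<in> K. a k \<ge> t}"
  shows "(\<Sum>j\<in>J. G (b j)) \<le> (\<Sum>k\<in>K. G (a k))"
  using assms(1,2,5)
proof (induction "card J" arbitrary: J K)
  case 0
  then show ?case using assms(4) by (simp add: sum_nonneg)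
next
  case (Suc n)
  have "J \<noteq> {}" using Suc.hyps(2) by auto
  define m where "m = Max (b ` J)"
  have "m \<in> b ` J" unfolding m_def using \<open>J \<noteq> {}\<close> Suc.prems(1) by (intro Max_in) auto
  then obtain j where j: "j \<in> J" "b j = m" by blast
  have max: "b i \<le> b j" if "i \<in> J" for i unfolding j(2) m_def using that Suc.prems(1) by (intro Max_ge) auto
  have "card {i \<in> J. b i \<ge> b j} > 0" using j(1) Suc.prems(1) by (subst card_gt_0_iff) auto
  then have "card {k \<in> K. a k \<ge> b j} > 0" using Suc.prems(3)[of "b j"] by linarith
  then obtain k where k: "k \<in> K" "a k \<ge> b j" by (auto simp: card_gt_0_iff)
  have "(\<Sum>i\<in>J - {j}. G (b i)) \<le> (\<Sum>k\<in>K - {k}. G (a k))"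
  proof (rule Suc.hyps(1))
    show "n = card (J - {j})" using Suc.hyps(2) j(1) Suc.prems(1) by simp
    fix t
    show "card {i \<in> J - {j}. b i \<ge> t} \<le> card {i \<in> K - {k}. a i \<ge> t}"
    proof (cases "t \<le> b j")
      case True
      have "{i \<in> J - {j}. b i \<ge> t} = {i \<in> J. b i \<ge> t} - {j}" "{i \<in> K - {k}. a i \<ge> t} = {i \<in> K. a i \<ge> t} - {k}" by auto
      then show ?thesis using Suc.prems j k True by (simp add: card_Diff_singleton_if diff_le_mono)
    next
      case False
      then have empty: "{i \<in> J - {j}. b i \<ge> t} = {}" using max by force
      show ?thesis unfolding empty by simp
    qed
  qed (use Suc.prems in auto)
  moreover have "G (b j) \<le> G (a k)" using assms(3) k(2) by (rule monoD)
  ultimately show ?case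
    using sum.remove[OF Suc.prems(1) j(1), of "\<lambda>i. G (b i)"] sum.remove[OF Suc.prems(2) k(1), of "\<lambda>i. G (a i)"]
    by linarith
qed

text \<open>Each cell value is repeated \<open>e\<close> times, as many times as a cell carries
  independent localized functions.\<close>

lemma sum_le_of_cell_counts:
  fixes b :: "nat list \<Rightarrow> real" and a :: "nat \<Rightarrow> real"
  assumes G: "mono G" "\<And>y. G y \<ge> (0 :: real)"
    and cnt: "\<And>t. card {w \<in> words N. b w \<ge> t} * e \<le> card {k \<in> {1..d}. a k \<ge> t}"
  shows "real e * (\<Sum>w\<in>words N. G (b w)) \<le> (\<Sum>k=1..d. G (a k))"
proof -
  have "(\<Sum>p\<in>words N \<times> {..<e}. G (b (fst p))) \<le> (\<Sum>k=1..d. G (a k))"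
  proof (rule sum_le_of_counts[OF _ _ G])
    fix t
    have "{p \<in> words N \<times> {..<e}. t \<le> b (fst p)} = {w \<in> words N. b w \<ge> t} \<times> {..<e}" by auto
    then show "card {p \<in> words N \<times> {..<e}. t \<le> b (fst p)} \<le> card {k \<in> {1..d}. t \<le> a k}"
      using cnt by (simp add: card_cartesian_product)
  qed (auto simp: finite_words)
  moreover have "(\<Sum>p\<in>words N \<times> {..<e}. G (b (fst p))) = (\<Sum>w\<in>words N. \<Sum>i\<in>{..<e}. G (b w))"
    unfolding sum.cartesian_product by (intro sum.cong) auto
  ultimately show ?thesis by (simp add: sum_distrib_left)
qed

text \<open>Cell values lowered by \<delta> bound the eigenvalue sum from below; for the upper bound
  the same comparison is applied to a reflected function. At most \<open>6 * 3 ^ N\<close>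
  eigenvalues escape, a number independent of \<open>j\<close>, so their share vanishes as
  \<open>d\<close> grows.\<close>

lemma average_convergence_mono:
  fixes lam :: "nat \<Rightarrow> real" and d :: "nat \<Rightarrow> nat" and f :: "point \<Rightarrow> real" and \<sigma> :: "nat \<Rightarrow> nat \<Rightarrow> real"
  assumes d: "\<And>j. j \<ge> 1 \<Longrightarrow> d j = fun_space.dim (dirichlet_eigenspace (lam j))"
    and dlim: "filterlim d at_top sequentially"
    and f: "continuous_on SG f"
    and listing: "\<And>j. j \<ge> 1 \<Longrightarrow> eigenvalue_listing (dirichlet_eigenspace (lam j))
      (compressed_multiplication (dirichlet_eigenspace (lam j)) f) (\<sigma> j)"
    and G: "mono G" "continuous_on UNIV G" "\<And>y. G y \<ge> (0 :: real)"
  shows "(\<lambda>j. 1 / real (d j) * (\<Sum>k=1..d j. G (\<sigma> j k))) \<longlonglongrightarrow> (\<integral>x. G (f x) \<partial>sg_measure)"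
proof (rule LIMSEQ_I)
  fix r :: real assume r: "r > 0"
  define I where "I = (\<integral>x. G (f x) \<partial>sg_measure)"
  define \<eta> where "\<eta> = r / 2"
  have \<eta>: "\<eta> > 0" using r by (simp add: \<eta>_def)
  have Gf: "continuous_on SG (\<lambda>x. G (f x))"
    by (rule continuous_on_compose2[OF G(2) f]) auto
  have I0: "I \<ge> 0" unfolding I_def using G(3) by (intro integral_nonneg_AE AE_I2) auto
  obtain C0 where C0: "\<And>x. x \<in> SG \<Longrightarrow> \<bar>f x\<bar> \<le> C0" using bounded_on_SG[OF f] by blast
  \<comment> \<open>One unit of room for the shifts by \<open>\<delta> \<le> 1\<close>, so that
    uniform continuity applies to the shifted values.\<close>
  define C where "C = C0 + 1"
  have "uniformly_continuous_on {- C..C} G"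
    using continuous_on_subset[OF G(2)] by (intro compact_uniformly_continuous) auto
  then obtain \<delta>0 where \<delta>0: "\<delta>0 > 0" "\<And>y z. y \<in> {- C..C} \<Longrightarrow> z \<in> {- C..C} \<Longrightarrow> dist z y < \<delta>0 \<Longrightarrow> dist (G z) (G y) < \<eta>"
    using \<eta> unfolding uniformly_continuous_on_def by metis
  \<comment> \<open>A cell value and a value of \<open>f\<close> in the same cell differ by less
    than \<delta>, and the shift adds another \<delta>; hence
    \<open>2 * \<delta> < \<delta>0\<close> is wanted.\<close>
  define \<delta> where "\<delta> = min 1 (\<delta>0 / 3)"
  have \<delta>: "\<delta> > 0" "\<delta> \<le> 1" "2 * \<delta> < \<delta>0" using \<delta>0(1) by (auto simp: \<delta>_def)
  obtain N where N: "\<And>n w x y. n \<ge> N \<Longrightarrow> w \<in> words n \<Longrightarrow> x \<in> SG \<Longrightarrow> y \<in> SG \<Longrightarrow>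
      dist (f (word_map w x)) (f (word_map w y)) < \<delta>"
    using uniform_on_cells[OF f \<delta>(1)] by metis
  define x0 where "x0 = corner 1"
  have x0: "x0 \<in> SG" by (simp add: x0_def corner_in_SG)
  define c where "c w = f (word_map w x0)" for w
  have osc: "\<bar>f (word_map w x) - c w\<bar> < \<delta>" if "w \<in> words N" "x \<in> SG" for w x
    using N[OF order_refl that x0] by (simp add: c_def dist_real_def)
  have c_bound: "\<bar>c w\<bar> \<le> C0" if "w \<in> words N" for w
    unfolding c_def using C0 word_map_in_SG[OF that x0] by blast
  have riemann: "G (c w + \<delta>) \<le> (\<integral>x. G (f (word_map w x)) \<partial>sg_measure) + \<eta>"
    "(\<integral>x. G (f (word_map w x)) \<partial>sg_measure) - \<eta> \<le> G (c w - \<delta>)" if w: "w \<in> words N" for w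
  proof -
    have int: "integrable sg_measure (\<lambda>x. G (f (word_map w x)))"
      by (intro integrable_sg continuous_on_comp_word_map[OF Gf w])
    have close: "G (c w + \<delta>) - \<eta> \<le> G (f (word_map w x)) \<and> G (f (word_map w x)) \<le> G (c w - \<delta>) + \<eta>" if x: "x \<in> SG" for x
    proof -
      let ?y = "f (word_map w x)"
      have y: "?y \<in> {- C..C}" using C0[OF word_map_in_SG[OF w x]] by (auto simp: C_def)
      have cw: "c w + \<delta> \<in> {- C..C}" "c w - \<delta> \<in> {- C..C}"
        using c_bound[OF w] \<delta> by (auto simp: C_def)
      have "dist (c w + \<delta>) ?y < \<delta>0" "dist (c w - \<delta>) ?y < \<delta>0"
        using osc[OF w x] \<delta> by (auto simp: dist_real_def)
      then have "dist (G (c w + \<delta>)) (G ?y) < \<eta>" "dist (G (c w - \<delta>)) (G ?y) < \<eta>"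
        using \<delta>0(2) y cw by blast+
      then show ?thesis by (auto simp: dist_real_def)
    qed
    have "(\<integral>x. G (c w + \<delta>) - \<eta> \<partial>sg_measure) \<le> (\<integral>x. G (f (word_map w x)) \<partial>sg_measure)"
      using close by (intro integral_mono int integrable_sg continuous_intros) auto
    then show "G (c w + \<delta>) \<le> (\<integral>x. G (f (word_map w x)) \<partial>sg_measure) + \<eta>"
      using sg.prob_space by simp
    have "(\<integral>x. G (f (word_map w x)) \<partial>sg_measure) \<le> (\<integral>x. G (c w - \<delta>) + \<eta> \<partial>sg_measure)"
      using close by (intro integral_mono int integrable_sg continuous_intros) auto
    then show "(\<integral>x. G (f (word_map w x)) \<partial>sg_measure) - \<eta> \<le> G (c w - \<delta>)"
      using sg.prob_space by simp
  qed
  have I_words: "(\<Sum>w\<in>words N. \<integral>x. G (f (word_map w x)) \<partial>sg_measure) = 3 ^ N * I"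
    using integral_sg_words[OF Gf, of N] by (simp add: I_def)
  have upper_sum: "(\<Sum>w\<in>words N. G (c w + \<delta>)) \<le> 3 ^ N * (I + \<eta>)"
  proof -
    have "(\<Sum>w\<in>words N. G (c w + \<delta>)) \<le> (\<Sum>w\<in>words N. (\<integral>x. G (f (word_map w x)) \<partial>sg_measure) + \<eta>)"
      by (intro sum_mono riemann)
    also have "\<dots> = 3 ^ N * (I + \<eta>)" by (simp add: sum.distrib I_words card_words distrib_left)
    finally show ?thesis .
  qed
  have lower_sum: "3 ^ N * (I - \<eta>) \<le> (\<Sum>w\<in>words N. G (c w - \<delta>))"
  proof -
    have "3 ^ N * (I - \<eta>) = (\<Sum>w\<in>words N. (\<integral>x. G (f (word_map w x)) \<partial>sg_measure) - \<eta>)"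
      by (simp add: sum_subtractf I_words card_words right_diff_distrib)
    also have "\<dots> \<le> (\<Sum>w\<in>words N. G (c w - \<delta>))" by (intro sum_mono riemann)
    finally show ?thesis .
  qed
  \<comment> \<open>Bounds the error from the at most \<open>6 * 3 ^ N\<close> eigenvalues not
    matched with cells; it depends neither on \<open>j\<close> nor on \<open>e\<close>.\<close>
  define M where "M = 6 * 3 ^ N * (G C + I)"
  have M0: "M \<ge> 0" unfolding M_def using G(3) I0 by (intro mult_nonneg_nonneg add_nonneg_nonneg) auto
  have bound: "\<bar>(\<Sum>k=1..d j. G (\<sigma> j k)) - d j * I\<bar> \<le> M + d j * \<eta>" if j: "j \<ge> 1" for j
  proof -
    define e where "e = fun_space.dim (localizable (lam j / 5 ^ N))"
    define A where "A = real e * 3 ^ N"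
    have "3 ^ N * e \<le> d j"
      using localizable_basis[of "lam j / 5 ^ N"] dim_dirichlet_ge[of _ "lam j" N] unfolding d[OF j] e_def by metis
    then have "real (3 ^ N * e) \<le> d j" by (rule of_nat_mono)
    then have A1: "A \<le> d j" by (simp add: A_def mult.commute)
    have "d j \<le> 3 ^ N * e + 6 * 3 ^ N" unfolding d[OF j] e_def by (rule dim_dirichlet_le)
    then have "real (d j) \<le> real (3 ^ N * e + 6 * 3 ^ N)" by (rule of_nat_mono)
    then have A2: "d j - A \<le> 6 * 3 ^ N" by (simp add: A_def mult.commute)
    have counts: "card W * e \<le> card {k \<in> {1..d j}. s * (\<sigma> j k - t) \<ge> 0}"
      if "W \<subseteq> words N" "\<And>w x. w \<in> W \<Longrightarrow> x \<in> SG \<Longrightarrow> s * (f (word_map w x) - t) \<ge> 0" for W s t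
      unfolding e_def d[OF j] using that by (rule eigenvalue_count_cells[OF f listing[OF j]])
    have \<sigma>_le: "\<sigma> j k \<le> C" if "k \<in> {1..d j}" for k
    proof -
      have "-1 * (\<sigma> j k - C) \<ge> 0"
      proof (rule eigenvalue_bound[OF f listing[OF j]])
        show "0 \<le> -1 * (f x - C)" if "x \<in> SG" for x using C0[OF that] by (simp add: C_def)
        show "k \<in> {1..fun_space.dim (dirichlet_eigenspace (lam j))}" using that d[OF j] by simp
      qed
      then show ?thesis by simp
    qed
    have "real e * (\<Sum>w\<in>words N. G (c w - \<delta>)) \<le> (\<Sum>k=1..d j. G (\<sigma> j k))"
    proof (rule sum_le_of_cell_counts[OF G(1,3)])
      fix t
      have "card {w \<in> words N. t \<le> c w - \<delta>} * e \<le> card {k \<in> {1..d j}. 1 * (\<sigma> j k - t) \<ge> 0}"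
        using osc by (intro counts) (auto, force)
      then show "card {w \<in> words N. t \<le> c w - \<delta>} * e \<le> card {k \<in> {1..d j}. t \<le> \<sigma> j k}" by simp
    qed
    moreover have "real e * (3 ^ N * (I - \<eta>)) \<le> real e * (\<Sum>w\<in>words N. G (c w - \<delta>))"
      by (intro mult_left_mono lower_sum) auto
    ultimately have "A * (I - \<eta>) \<le> (\<Sum>k=1..d j. G (\<sigma> j k))" by (simp add: A_def mult.assoc)
    moreover have "d j * (I - \<eta>) - M \<le> A * (I - \<eta>)"
    proof -
      have "(d j - A) * (I - \<eta>) \<le> (d j - A) * I" using A1 \<eta> by (intro mult_left_mono) auto
      also have "\<dots> \<le> 6 * 3 ^ N * I" using A2 I0 by (rule mult_right_mono)
      also have "\<dots> \<le> M" using G(3)[of C] by (simp add: M_def)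
      finally show ?thesis by (simp add: algebra_simps)
    qed
    ultimately have lower: "d j * (I - \<eta>) - M \<le> (\<Sum>k=1..d j. G (\<sigma> j k))" by linarith
    \<comment> \<open>Reflection keeps monotonicity and turns an upper bound for \<open>G\<close>
      into a lower bound for \<open>H\<close>. The \<open>max 0\<close> makes \<open>H\<close>
      nonnegative everywhere and is inactive here, since the values before reflection are at most
      \<open>C\<close>.\<close>
    define H where "H y = max 0 (G C - G (- y))" for y
    have H: "mono H"
    proof (rule monoI)
      fix y z :: real assume "y \<le> z"
      then have "G (- z) \<le> G (- y)" using G(1) by (intro monoD[of G]) auto
      then show "H y \<le> H z" by (simp add: H_def)
    qed
    have H_eq: "H (- y) = G C - G y" if "y \<le> C" for y
      using monoD[OF G(1) that] by (simp add: H_def)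
    have "real e * (\<Sum>w\<in>words N. H (- (c w + \<delta>))) \<le> (\<Sum>k=1..d j. H (- \<sigma> j k))"
    proof (rule sum_le_of_cell_counts[OF H])
      show "H y \<ge> 0" for y by (simp add: H_def)
      fix t
      have "card {w \<in> words N. t \<le> - (c w + \<delta>)} * e \<le> card {k \<in> {1..d j}. -1 * (\<sigma> j k - (- t)) \<ge> 0}"
        using osc by (intro counts) (auto, force)
      moreover have "{k \<in> {1..d j}. -1 * (\<sigma> j k - (- t)) \<ge> 0} = {k \<in> {1..d j}. t \<le> - \<sigma> j k}" by auto
      ultimately show "card {w \<in> words N. t \<le> - (c w + \<delta>)} * e \<le> card {k \<in> {1..d j}. t \<le> - \<sigma> j k}" by simp
    qed
    moreover have "(\<Sum>k=1..d j. H (- \<sigma> j k)) = d j * G C - (\<Sum>k=1..d j. G (\<sigma> j k))"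
      using H_eq[OF \<sigma>_le] by (simp add: sum_subtractf)
    moreover have "(\<Sum>w\<in>words N. H (- (c w + \<delta>))) = 3 ^ N * G C - (\<Sum>w\<in>words N. G (c w + \<delta>))"
    proof -
      have "c w + \<delta> \<le> C" if "w \<in> words N" for w using c_bound[OF that] \<delta> by (simp add: C_def)
      then have "(\<Sum>w\<in>words N. H (- (c w + \<delta>))) = (\<Sum>w\<in>words N. G C - G (c w + \<delta>))"
        by (intro sum.cong refl H_eq)
      then show ?thesis by (simp add: sum_subtractf card_words)
    qed
    ultimately have "(\<Sum>k=1..d j. G (\<sigma> j k)) \<le> d j * G C - real e * (3 ^ N * G C - (\<Sum>w\<in>words N. G (c w + \<delta>)))"
      by simp
    also have "\<dots> = (d j - A) * G C + real e * (\<Sum>w\<in>words N. G (c w + \<delta>))"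
      by (simp add: A_def algebra_simps)
    also have "\<dots> \<le> 6 * 3 ^ N * G C + real e * (3 ^ N * (I + \<eta>))"
      using A2 G(3) upper_sum by (intro add_mono mult_right_mono mult_left_mono) auto
    also have "real e * (3 ^ N * (I + \<eta>)) = A * (I + \<eta>)" by (simp add: A_def)
    also have "A * (I + \<eta>) \<le> d j * (I + \<eta>)" using A1 I0 \<eta> by (intro mult_right_mono) auto
    also have "6 * 3 ^ N * G C \<le> M" using I0 by (simp add: M_def)
    finally have "(\<Sum>k=1..d j. G (\<sigma> j k)) \<le> M + d j * (I + \<eta>)" by simp
    with lower show ?thesis by (simp add: abs_le_iff algebra_simps)
  qed
  obtain J where J: "\<And>j. j \<ge> J \<Longrightarrow> real (d j) > M / \<eta> + 1"
  proof -
    have "filterlim (\<lambda>j. real (d j)) at_top sequentially"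
      by (rule filterlim_compose[OF filterlim_real_sequentially dlim])
    then have "eventually (\<lambda>j. real (d j) > M / \<eta> + 1) sequentially"
      by (simp add: filterlim_at_top_dense)
    then show ?thesis using that unfolding eventually_sequentially by blast
  qed
  have "norm (1 / real (d j) * (\<Sum>k=1..d j. G (\<sigma> j k)) - I) < r" if "j \<ge> max J 1" for j
  proof -
    have dj: "real (d j) > M / \<eta> + 1" using J that by simp
    then have d0: "real (d j) > 0" using M0 \<eta> by (smt (verit) divide_nonneg_pos)
    have "M / \<eta> < real (d j)" using dj by linarith
    then have "M < d j * \<eta>" using \<eta> by (simp add: divide_less_eq)
    then have "\<bar>(\<Sum>k=1..d j. G (\<sigma> j k)) - d j * I\<bar> < d j * r"
      using bound[of j] that by (simp add: \<eta>_def)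
    moreover have "1 / real (d j) * (\<Sum>k=1..d j. G (\<sigma> j k)) - I = ((\<Sum>k=1..d j. G (\<sigma> j k)) - d j * I) / d j"
      using d0 by (simp add: diff_divide_distrib)
    ultimately show ?thesis using d0 by (simp add: abs_divide divide_less_eq mult.commute)
  qed
  then show "\<exists>n0. \<forall>n\<ge>n0. norm (1 / real (d n) * (\<Sum>k=1..d n. G (\<sigma> n k)) - (\<integral>x. G (f x) \<partial>sg_measure)) < r"
    unfolding I_def by blast
qed

text \<open>The shift by 2 leaves room for the two levels of the seed; \<open>3 ^ j\<close> copies
  of one function are more than \<open>j\<close>.\<close>

lemma dirichlet_dim_at_top:
  assumes series: "\<And>j. j \<ge> 1 \<Longrightarrow> five_series j (lam j) \<or> six_series j (lam j)"
    and d: "\<And>j. j \<ge> 1 \<Longrightarrow> d j = fun_space.dim (dirichlet_eigenspace (lam j))"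
  shows "filterlim d at_top sequentially"
proof -
  have "j \<le> d (j + 2)" for j
  proof -
    obtain v where v: "v \<in> localizable (lam (j + 2) / 5 ^ j)" "v \<noteq> (\<lambda>x. 0)"
      using localizable_nontrivial[OF series[of "j + 2"]] by auto
    have "fun_space.independent {v}"
      using v(2) by (simp add: fun_space.dependent_single zero_fun_def)
    then have "3 ^ j * card {v} \<le> d (j + 2)"
      using v(1) dim_dirichlet_ge[of "{v}" "lam (j + 2)" j] d[of "j + 2"] by simp
    moreover have "j < 3 ^ j" by (rule power_gt_expt) simp
    ultimately show ?thesis by simp
  qed
  then have "n \<le> d j" if "j \<ge> n + 2" for j n
    using that by (metis add_leD2 add_le_cancel_right le_add_diff_inverse2 order_trans)
  then have "eventually (\<lambda>j. n \<le> d j) sequentially" for n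
    unfolding eventually_sequentially by blast
  then show ?thesis unfolding filterlim_at_top by blast
qed

theorem theorem3:
  fixes lam :: "nat \<Rightarrow> real" and E :: "nat \<Rightarrow> (point \<Rightarrow> real) set" and d :: "nat \<Rightarrow> nat"
    and f :: "point \<Rightarrow> real" and \<sigma> :: "nat \<Rightarrow> nat \<Rightarrow> real"
  assumes "\<And>j. j \<ge> 1 \<Longrightarrow> five_series j (lam j) \<or> six_series j (lam j)"
    and "\<And>j. j \<ge> 1 \<Longrightarrow> E j = dirichlet_eigenspace (lam j)"
    and "\<And>j. j \<ge> 1 \<Longrightarrow> d j = fun_space.dim (E j)"
    and "continuous_on SG f" and "\<And>x. x \<in> SG \<Longrightarrow> f x > 0"
    and "\<And>j. j \<ge> 1 \<Longrightarrow> eigenvalue_listing (E j) (compressed_multiplication (E j) f) (\<sigma> j)"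
  shows "(\<forall>F :: real \<Rightarrow> real. continuous_on {0..} F \<longrightarrow>
            (\<lambda>j. 1 / real (d j) * (\<Sum>k=1..d j. F (\<sigma> j k)))
              \<longlonglongrightarrow> (\<integral>x. F (f x) \<partial>sg_measure)) \<and>
         (\<exists>s :: nat \<Rightarrow> nat \<Rightarrow> point.
            (\<forall>j\<ge>1. \<forall>k\<in>{1..d j}. s j k \<in> SG) \<and>
            almost_equally_distributed {0..Linfty_norm f} d \<sigma> (\<lambda>j k. f (s j k)))"
proof -
  have f: "continuous_on SG f" by (rule assms(4))
  have d: "d j = fun_space.dim (dirichlet_eigenspace (lam j))" if "j \<ge> 1" for j
    using assms(2,3)[OF that] by simp
  have listing: "eigenvalue_listing (dirichlet_eigenspace (lam j))
      (compressed_multiplication (dirichlet_eigenspace (lam j)) f) (\<sigma> j)" if "j \<ge> 1" for j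
    using assms(2,6)[OF that] by simp
  have dlim: "filterlim d at_top sequentially"
    using assms(1) d by (rule dirichlet_dim_at_top)
  obtain xl where xl: "xl \<in> SG" "\<And>x. x \<in> SG \<Longrightarrow> f xl \<le> f x"
    using continuous_attains_inf[OF compact_SG SG_nonempty f] by blast
  obtain xu where xu: "xu \<in> SG" "\<And>x. x \<in> SG \<Longrightarrow> f x \<le> f xu"
    using continuous_attains_sup[OF compact_SG SG_nonempty f] by blast
  have range: "f xl \<le> \<sigma> j k \<and> \<sigma> j k \<le> f xu" if "j \<ge> 1" "k \<in> {1..d j}" for j k
  proof -
    have k: "k \<in> {1..fun_space.dim (dirichlet_eigenspace (lam j))}" using that d by simp
    have "1 * (\<sigma> j k - f xl) \<ge> 0" "-1 * (\<sigma> j k - f xu) \<ge> 0"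
      using xl(2) xu(2) by (intro eigenvalue_bound[OF f listing[OF that(1)] _ k]; simp)+
    then show ?thesis by simp
  qed
  have pos: "0 \<le> f xl" using assms(5)[OF xl(1)] by simp
  \<comment> \<open>The \<open>max 0\<close> makes the power monotone and nonnegative on the whole
    line; it is inactive because the \<sigma>'s and the values of \<open>f\<close> are
    nonnegative.\<close>
  have power: "(\<lambda>j. 1 / real (d j) * (\<Sum>k=1..d j. \<sigma> j k ^ p)) \<longlonglongrightarrow> (\<integral>x. f x ^ p \<partial>sg_measure)" for p
  proof -
    have A: "(\<lambda>j. 1 / real (d j) * (\<Sum>k=1..d j. (max 0 (\<sigma> j k)) ^ p)) \<longlonglongrightarrow> (\<integral>x. (max 0 (f x)) ^ p \<partial>sg_measure)"
      by (rule average_convergence_mono[OF d dlim f listing])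
        (auto intro!: monoI power_mono continuous_intros)
    have B: "(\<integral>x. (max 0 (f x)) ^ p \<partial>sg_measure) = (\<integral>x. f x ^ p \<partial>sg_measure)"
      using assms(5) by (intro Bochner_Integration.integral_cong) (auto simp: max_def dest: less_imp_le)
    have "eventually (\<lambda>j. 1 / real (d j) * (\<Sum>k=1..d j. (max 0 (\<sigma> j k)) ^ p) =
        1 / real (d j) * (\<Sum>k=1..d j. \<sigma> j k ^ p)) sequentially"
      using eventually_ge_at_top[of 1]
    proof eventually_elim
      case (elim j)
      have "max 0 (\<sigma> j k) = \<sigma> j k" if "k \<in> {1..d j}" for k using range[OF elim that] pos by simp
      then show ?case by simp
    qed
    from Lim_transform_eventually[OF A this] show ?thesis unfolding B .
  qed
  have main: "(\<lambda>j. 1 / real (d j) * (\<Sum>k=1..d j. F (\<sigma> j k))) \<longlonglongrightarrow> (\<integral>x. F (f x) \<partial>sg_measure)"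
    if F: "continuous_on {0..} F" for F :: "real \<Rightarrow> real"
  proof (rule LIMSEQ_I)
    fix r :: real assume r: "r > 0"
    \<comment> \<open>All eigenvalues and all values of \<open>f\<close> lie in this compact
      interval, where polynomials approximate \<open>F\<close> uniformly.\<close>
    have "continuous_on {0..f xu} F" using F by (rule continuous_on_subset) auto
    then obtain P where P: "real_polynomial_function P" "\<And>y. y \<in> {0..f xu} \<Longrightarrow> \<bar>F y - P y\<bar> < r / 3"
      using Stone_Weierstrass_real_polynomial_function[of "{0..f xu}" F "r / 3"] r by auto
    obtain a n where a: "P = (\<lambda>y. \<Sum>i\<le>n. a i * y ^ i)"
      using P(1) unfolding real_polynomial_function_iff_sum by blast
    have P_cont: "continuous_on SG (\<lambda>x. P (f x))" unfolding a by (intro continuous_intros f)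
    have F_cont: "continuous_on SG (\<lambda>x. F (f x))"
      using assms(5) by (intro continuous_on_compose2[OF F f]) (auto simp: less_imp_le)
    have f_in: "f x \<in> {0..f xu}" if "x \<in> SG" for x using assms(5)[OF that] xu(2)[OF that] by simp
    have "(\<lambda>j. \<Sum>i\<le>n. a i * (1 / real (d j) * (\<Sum>k=1..d j. \<sigma> j k ^ i))) \<longlonglongrightarrow> (\<Sum>i\<le>n. a i * (\<integral>x. f x ^ i \<partial>sg_measure))"
      by (intro tendsto_sum tendsto_mult tendsto_const power)
    moreover have "(\<Sum>i\<le>n. a i * (1 / real (d j) * (\<Sum>k=1..d j. \<sigma> j k ^ i))) = 1 / real (d j) * (\<Sum>k=1..d j. P (\<sigma> j k))" for j
    proof -
      have "(\<Sum>k=1..d j. P (\<sigma> j k)) = (\<Sum>i\<le>n. a i * (\<Sum>k=1..d j. \<sigma> j k ^ i))"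
        unfolding a by (subst sum.swap) (simp add: sum_distrib_left)
      then show ?thesis by (simp only: sum_distrib_left mult.left_commute)
    qed
    moreover have "(\<Sum>i\<le>n. a i * (\<integral>x. f x ^ i \<partial>sg_measure)) = (\<integral>x. P (f x) \<partial>sg_measure)"
    proof -
      have "integrable sg_measure (\<lambda>x. a i * f x ^ i)" for i by (intro integrable_sg continuous_intros f)
      then show ?thesis unfolding a by simp
    qed
    ultimately have "(\<lambda>j. 1 / real (d j) * (\<Sum>k=1..d j. P (\<sigma> j k))) \<longlonglongrightarrow> (\<integral>x. P (f x) \<partial>sg_measure)" by simp
    then obtain J where J: "\<And>j. j \<ge> J \<Longrightarrow> norm (1 / real (d j) * (\<Sum>k=1..d j. P (\<sigma> j k)) - (\<integral>x. P (f x) \<partial>sg_measure)) < r / 3"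
    proof -
      have "r / 3 > 0" using r by simp
      from LIMSEQ_D[OF \<open>_ \<longlonglongrightarrow> (\<integral>x. P (f x) \<partial>sg_measure)\<close> this] show ?thesis using that by blast
    qed
    have int: "\<bar>(\<integral>x. F (f x) \<partial>sg_measure) - (\<integral>x. P (f x) \<partial>sg_measure)\<bar> \<le> r / 3"
    proof -
      have close: "F (f x) \<le> P (f x) + r / 3" "P (f x) - r / 3 \<le> F (f x)" if "x \<in> SG" for x
        using P(2)[OF f_in[OF that]] by linarith+
      have "(\<integral>x. F (f x) \<partial>sg_measure) \<le> (\<integral>x. P (f x) + r / 3 \<partial>sg_measure)"
        using close(1) by (intro integral_mono integrable_sg continuous_intros F_cont P_cont) auto
      moreover have "(\<integral>x. P (f x) - r / 3 \<partial>sg_measure) \<le> (\<integral>x. F (f x) \<partial>sg_measure)"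
        using close(2) by (intro integral_mono integrable_sg continuous_intros F_cont P_cont) auto
      moreover have "(\<integral>x. P (f x) + r / 3 \<partial>sg_measure) = (\<integral>x. P (f x) \<partial>sg_measure) + r / 3"
        "(\<integral>x. P (f x) - r / 3 \<partial>sg_measure) = (\<integral>x. P (f x) \<partial>sg_measure) - r / 3"
        using integrable_sg[OF P_cont] sg.prob_space by simp_all
      ultimately show ?thesis by linarith
    qed
    have "norm (1 / real (d j) * (\<Sum>k=1..d j. F (\<sigma> j k)) - (\<integral>x. F (f x) \<partial>sg_measure)) < r" if "j \<ge> max J 1" for j
    proof -
      have "\<bar>(\<Sum>k=1..d j. F (\<sigma> j k)) - (\<Sum>k=1..d j. P (\<sigma> j k))\<bar> \<le> (\<Sum>k=1..d j. \<bar>F (\<sigma> j k) - P (\<sigma> j k)\<bar>)"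
        unfolding sum_subtractf[symmetric] by (rule sum_abs)
      also have "\<dots> \<le> (\<Sum>k=1..d j. r / 3)"
        using P(2) range[of j] pos that by (intro sum_mono less_imp_le) fastforce
      finally have "\<bar>(\<Sum>k=1..d j. F (\<sigma> j k)) - (\<Sum>k=1..d j. P (\<sigma> j k))\<bar> \<le> d j * (r / 3)" by simp
      \<comment> \<open>For \<open>d j = 0\<close> both averages are 0, by division by zero.\<close>
      then have "\<bar>1 / real (d j) * (\<Sum>k=1..d j. F (\<sigma> j k)) - 1 / real (d j) * (\<Sum>k=1..d j. P (\<sigma> j k))\<bar> \<le> r / 3"
        using r by (cases "d j = 0") (simp_all add: diff_divide_distrib[symmetric] abs_divide divide_le_eq mult.commute)
      moreover have "\<bar>1 / real (d j) * (\<Sum>k=1..d j. P (\<sigma> j k)) - (\<integral>x. P (f x) \<partial>sg_measure)\<bar> < r / 3"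
        using J[of j] that unfolding real_norm_def by linarith
      ultimately show ?thesis using int unfolding real_norm_def by linarith
    qed
    then show "\<exists>n0. \<forall>n\<ge>n0. norm (1 / real (d n) * (\<Sum>k=1..d n. F (\<sigma> n k)) - (\<integral>x. F (f x) \<partial>sg_measure)) < r" by blast
  qed
  have "\<exists>x\<in>SG. f x = \<sigma> j k" if "j \<ge> 1" "k \<in> {1..d j}" for j k
  proof -
    have "connected (f ` SG)" using f connected_SG by (rule connected_continuous_image)
    then have "\<sigma> j k \<in> f ` SG"
      using connectedD_interval[of "f ` SG" "f xl" "f xu" "\<sigma> j k"] xl(1) xu(1) range[OF that] by blast
    then show ?thesis by force
  qed
  then obtain s where s: "\<And>j k. j \<ge> 1 \<Longrightarrow> k \<in> {1..d j} \<Longrightarrow> s j k \<in> SG \<and> f (s j k) = \<sigma> j k"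
    by metis
  have "almost_equally_distributed {0..Linfty_norm f} d \<sigma> (\<lambda>j k. f (s j k))"
    unfolding almost_equally_distributed_def
  proof (intro conjI allI impI ballI)
    fix j k assume jk: "(1::nat) \<le> j" "k \<in> {1..d j}"
    have "\<sigma> j k \<le> Linfty_norm f"
      using range[OF jk] sg_le_Linfty_norm[OF f xu(1)] by linarith
    then show "\<sigma> j k \<in> {0..Linfty_norm f}" "f (s j k) \<in> {0..Linfty_norm f}"
      using range[OF jk] pos s[OF jk] by auto
  next
    fix G :: "real \<Rightarrow> real"
    \<comment> \<open>The two families coincide, so every term vanishes; the index 0 is left out
      because the hypotheses start at 1.\<close>
    have "eventually (\<lambda>j. 0 = 1 / real (d j) * (\<Sum>k=1..d j. G (\<sigma> j k) - G (f (s j k)))) sequentially"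
      using eventually_ge_at_top[of 1] by eventually_elim (simp add: s)
    then show "(\<lambda>j. 1 / real (d j) * (\<Sum>k=1..d j. G (\<sigma> j k) - G (f (s j k)))) \<longlonglongrightarrow> 0"
      using tendsto_const by (rule Lim_transform_eventually[rotated])
  qed
  then show ?thesis using main s by blast
qed

end
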